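(* For every integer $d\geq 2$ and every nonzero quadratic form $Q\in\mathbb{Q}[X_1,\dots,X_d]$, as $n\to\infty$, \[ n-o(n)\;\leq\; f_Q([n]^d,\mathbb{R}^d)\;\leq\; d\cdot n. \]
   Context: A quadratic form is a homogeneous polynomial of degree $2$. For a quadratic form $Q\in\mathbb{R}[X_1,\dots,X_d]$, a $Q$-quadric in $\mathbb{R}^d$ is a set of the form $\{x\in\mathbb{R}^d: Q(x)+f(x)=0\}$, where $f\in\mathbb{R}[X_1,\dots,X_d]$ has degree at most $1$. Let $[n]=\{1,\dots,n\}$ and regard $[n]^d\subset\mathbb{R}^d$. $f_Q([n]^d,\mathbb{R}^d)$ is the maximum size of a subset $D\subseteq[n]^d$ such that (i) no $d+1$ points of $D$ lie on a common affine hyperplane of $\mathbb{R}^d$, and (ii) no $d+2$ points of $D$ lie on a common $Q$-quadric in $\mathbb{R}^d$. *)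

theory Defs
  imports "HOL-Analysis.Analysis" "HOL-Library.Poly_Mapping" "HOL-Library.Landau_Symbols"
begin

text \<open>
  A polynomial in the variables \<open>X\<^sub>i\<close> (\<open>i :: 'd\<close>) is a finitely supported map from exponent
  vectors to coefficients. The dimension is \<open>d = CARD('d)\<close>.
\<close>

type_synonym ('d, 'a) mpoly = "('d \<Rightarrow>\<^sub>0 nat) \<Rightarrow>\<^sub>0 'a"

definition monom_degree :: "('d::finite \<Rightarrow>\<^sub>0 nat) \<Rightarrow> nat" where
  "monom_degree m = (\<Sum>i\<in>UNIV. Poly_Mapping.lookup m i)"

definition eval_mpoly :: "('d::finite, real) mpoly \<Rightarrow> real ^ 'd \<Rightarrow> real" where
  "eval_mpoly p x = (\<Sum>m\<in>Poly_Mapping.keys p. Poly_Mapping.lookup p m * (\<Prod>i\<in>UNIV. (x $ i) ^ Poly_Mapping.lookup m i))"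

text \<open>The zero polynomial gets total degree 0, and it is homogeneous of every degree.\<close>

definition total_degree :: "('d::finite, 'a::zero) mpoly \<Rightarrow> nat" where
  "total_degree p = Max (insert 0 (monom_degree ` Poly_Mapping.keys p))"

definition homogeneous :: "nat \<Rightarrow> ('d::finite, 'a::zero) mpoly \<Rightarrow> bool" where
  "homogeneous k p \<longleftrightarrow> (\<forall>m\<in>Poly_Mapping.keys p. monom_degree m = k)"

definition quadratic_form :: "('d::finite, 'a::zero) mpoly \<Rightarrow> bool" where
  "quadratic_form Q \<longleftrightarrow> homogeneous 2 Q"

definition is_quadric :: "('d::finite, real) mpoly \<Rightarrow> (real ^ 'd) set \<Rightarrow> bool" where
  "is_quadric Q S \<longleftrightarrow>
     (\<exists>f :: ('d, real) mpoly. total_degree f \<le> 1 \<and> S = {x. eval_mpoly Q x + eval_mpoly f x = 0})"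

definition is_hyperplane :: "(real ^ 'd::finite) set \<Rightarrow> bool" where
  "is_hyperplane H \<longleftrightarrow> (\<exists>a b. a \<noteq> 0 \<and> H = {x. a \<bullet> x = b})"

definition grid :: "nat \<Rightarrow> (real ^ 'd::finite) set" where
  "grid n = {x. \<forall>i. x $ i \<in> real ` {1..n}}"

definition general_position :: "('d::finite, real) mpoly \<Rightarrow> (real ^ 'd) set \<Rightarrow> bool" where
  "general_position Q D \<longleftrightarrow>
     (\<forall>S\<subseteq>D. card S = CARD('d) + 1 \<longrightarrow> \<not> (\<exists>H. is_hyperplane H \<and> S \<subseteq> H)) \<and>
     (\<forall>S\<subseteq>D. card S = CARD('d) + 2 \<longrightarrow> \<not> (\<exists>C. is_quadric Q C \<and> S \<subseteq> C))"

text \<open>Only meaningful for finite \<open>A\<close>.\<close>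

definition max_general_position :: "('d::finite, real) mpoly \<Rightarrow> (real ^ 'd) set \<Rightarrow> nat" where
  "max_general_position Q A = Max {card D | D. D \<subseteq> A \<and> general_position Q D}"

end

theory Submission
  imports Defs "HOL-Complex_Analysis.Complex_Analysis" "HOL-Number_Theory.Number_Theory"
begin

text \<open>
  Upper bound: \<open>[n]\<^sup>d\<close> is covered by the \<open>n\<close> hyperplanes \<open>x\<^sub>i = k\<close>, each containing at most \<open>d\<close> points.

  Lower bound: let \<open>p\<close> be a prime, \<open>v\<^sub>1, \<dots>, v\<^sub>d\<close> a basis of \<open>F\<^sub>p\<^sup>d\<close> all of whose members but one are
  isotropic for \<open>Q\<close>, and \<open>\<alpha>\<^sub>1, \<dots>, \<alpha>\<^sub>d\<close> distinct elements of \<open>F\<^sub>p\<close>. On the curve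
  \<open>t \<mapsto> \<Sum>\<^sub>k v\<^sub>k / (t - \<alpha>\<^sub>k)\<close> an affine form has at most \<open>d\<close> zeros. Since \<open>Q\<close> restricted to the curve
  has a double pole only at the anisotropic \<open>\<alpha>\<^sub>k\<close>, a \<open>Q\<close>-quadric meets it in at most \<open>d + 1\<close> points.
  Lifting the \<open>p - d\<close> points of the curve to \<open>[p]\<^sup>d\<close> keeps both properties, because a real relation
  between integer points yields an integer relation that is nontrivial modulo \<open>p\<close>.

  Such a basis exists as soon as finitely many integers depending on \<open>Q\<close> are squares modulo \<open>p\<close>: if
  \<open>Q(u) \<noteq> 0\<close>, the line through \<open>u\<close> and a unit vector \<open>e\<^sub>k\<close> contains an isotropic point iff a
  discriminant is a square. It remains to find such primes in \<open>[(1 - \<epsilon>)n, n]\<close> for all large \<open>n\<close>. By quadratic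
  reciprocity the condition on \<open>p\<close> is that finitely many real characters take the value 1 at \<open>p\<close>.
  The \<open>L\<close>-series of a real character does not vanish on the line \<open>Re s = 1\<close>, and averaging against a
  Fejer kernel, as in the proof of the Wiener-Ikehara theorem, produces the primes.
\<close>

section \<open>Fejer means and a Tauberian theorem\<close>

text \<open>Over F_p the functions c_0 + \<Sum> c_k / (t - \<alpha>_k) form a space of dimension d +
  1, already spanned by 1 and the d coordinates of the curve. If all basis vectors were isotropic, Q
  along the curve would belong to this space and the whole curve would lie on one Q-quadric. The
  single anisotropic vector prevents this: its double pole makes Q independent of the affine forms.
  A second double pole would allow d + 2 zeros, one too many.

  The leading constant 1 in the lower bound requires primes in every interval
  [(1 - \<epsilon>) n, n]; primes within a constant factor of n would lose that factor. Prescribing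
  quadratic residues involves only characters with values 1, -1 and 0, so nonvanishing is
  established for real characters alone. Moreover only the existence of one prime per logarithmic
  window matters, not a count. The Tauberian step can therefore argue by contradiction with one
  fixed large T instead of letting T tend to infinity.\<close>

definition fejer :: "real \<Rightarrow> real \<Rightarrow> real" where
  "fejer T u = (if u = 0 then T else 2 * (1 - cos (T * u)) / (T * u\<^sup>2))"

definition dirichlet_series :: "(nat \<Rightarrow> real) \<Rightarrow> complex \<Rightarrow> complex" where
  "dirichlet_series a s = suminf (\<lambda>n. of_real (a n) * of_nat n powr (-s))"

text \<open>The kernel is the Fourier transform of the tent on [-T, T]. The compact support of the
  tent confines the Fourier side to a bounded segment, and the nonnegativity of the kernel preserves
  the sign of the coefficients.\<close>

lemma fejer_has_integral:
  assumes "T > 0"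
  shows "((\<lambda>t. (1 - \<bar>t\<bar> / T) * cos (t * u)) has_integral fejer T u) {-T..T}"
proof -
  define K where "K = fejer T u / 2"
  have right: "((\<lambda>t. (1 - t / T) * cos (t * u)) has_integral K) {0..T}"
  proof (cases "u = 0")
    case True
    have "((\<lambda>t. (1 - t / T) * cos (t * u)) has_integral ((T - T^2 / (2 * T)) - (0 - 0^2 / (2 * T)))) {0..T}"
      using assms True
      by (intro fundamental_theorem_of_calculus)
         (auto intro!: derivative_eq_intros simp flip: has_real_derivative_iff_has_vector_derivative)
    then show ?thesis using assms True by (simp add: K_def fejer_def power2_eq_square)
  next
    case False
    let ?F = "\<lambda>t. (1 - t / T) * sin (t * u) / u - cos (t * u) / (T * u\<^sup>2)"
    have "((\<lambda>t. (1 - t / T) * cos (t * u)) has_integral (?F T - ?F 0)) {0..T}"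
      using assms False
      by (intro fundamental_theorem_of_calculus)
         (auto intro!: derivative_eq_intros simp: field_simps power2_eq_square simp flip: has_real_derivative_iff_has_vector_derivative)
    moreover have "?F T - ?F 0 = K"
      using assms False by (simp add: K_def fejer_def diff_divide_distrib)
    ultimately show ?thesis by simp
  qed
  have left: "((\<lambda>t. (1 + t / T) * cos (t * u)) has_integral K) {-T..0}"
    using has_integral_reflect_real[THEN iffD2, OF right] by (simp del: has_integral_reflect_real)
  have "((\<lambda>t. (1 - \<bar>t\<bar> / T) * cos (t * u)) has_integral (K + K)) {-T..T}"
  proof (rule has_integral_combine[where c = 0])
    show "((\<lambda>t. (1 - \<bar>t\<bar> / T) * cos (t * u)) has_integral K) {-T..0}"
      by (rule has_integral_eq[OF _ left]) auto
    show "((\<lambda>t. (1 - \<bar>t\<bar> / T) * cos (t * u)) has_integral K) {0..T}"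
      by (rule has_integral_eq[OF _ right]) auto
  qed (use assms in auto)
  then show ?thesis by (simp add: K_def)
qed

lemma fejer_nonneg: "T > 0 \<Longrightarrow> fejer T u \<ge> 0"
  by (simp add: fejer_def)

text \<open>Away from 0 the kernel is O(1/T); this factor makes the contribution from outside the
  window small.\<close>

lemma fejer_le_inverse_square:
  assumes "T > 0" "u \<noteq> 0"
  shows "fejer T u \<le> 4 / (T * u\<^sup>2)"
proof -
  have "2 * (1 - c) \<le> 4" if "-1 \<le> c" for c :: real using that by simp
  from this[OF cos_ge_minus_one] have "2 * (1 - cos (T * u)) / (T * u\<^sup>2) \<le> 4 / (T * u\<^sup>2)"
    by (rule divide_right_mono) (use assms in simp)
  then show ?thesis using assms by (simp add: fejer_def)
qed

lemma fejer_le: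
  assumes "T > 0"
  shows "fejer T u \<le> T"
proof (cases "u = 0")
  case False
  have "1 - cos (T * u) = 2 * (sin (T * u / 2))\<^sup>2"
    using cos_double_sin[of "T * u / 2"] by simp
  also have "(sin (T * u / 2))\<^sup>2 \<le> (T * u / 2)\<^sup>2"
    using abs_sin_x_le_abs_x[of "T * u / 2"] by (metis abs_le_square_iff)
  finally have "2 * (1 - cos (T * u)) \<le> T * (T * u\<^sup>2)"
    by (simp add: power_divide power2_eq_square mult_ac)
  moreover have "T * u\<^sup>2 > 0" using assms False by simp
  ultimately show ?thesis using False by (simp add: fejer_def pos_divide_le_eq)
qed (simp add: fejer_def)

lemma fejer_ge:
  assumes "T > 0" "\<bar>T * u\<bar> \<le> 1"
  shows "fejer T u \<ge> T / 4"
proof (cases "u = 0")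
  case False
  \<comment> \<open>The mean value theorem on [0, y], with cos \<ge> 1/2 on [0, pi/3] and 1 <
    pi/3.\<close>
  have sin_ge: "(sin y)\<^sup>2 \<ge> y\<^sup>2 / 4" if "\<bar>y\<bar> \<le> 1" for y :: real
  proof -
    have *: "sin y \<ge> y / 2" if y: "0 < y" "y \<le> 1" for y :: real
    proof -
      obtain z where z: "0 < z" "z < y" "sin y - sin 0 = (y - 0) * cos z"
        using MVT2[of 0 y sin cos] y by (auto intro!: derivative_eq_intros)
      have "cos (pi / 3) \<le> cos z"
        using z y pi_gt3 by (intro cos_monotone_0_pi_le) auto
      then have "1 / 2 \<le> cos z" by (simp add: cos_60)
      then have "y * (1 / 2) \<le> y * cos z" using y by (intro mult_left_mono) auto
      then show ?thesis using z by simp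
    qed
    have "\<bar>sin y\<bar> \<ge> \<bar>y\<bar> / 2"
      using *[of y] *[of "-y"] that by (cases y "0::real" rule: linorder_cases) auto
    then have "(\<bar>y\<bar> / 2)\<^sup>2 \<le> \<bar>sin y\<bar>\<^sup>2" by (intro power_mono) auto
    then show ?thesis by (simp add: power_divide)
  qed
  have "1 - cos (T * u) = 2 * (sin (T * u / 2))\<^sup>2"
    using cos_double_sin[of "T * u / 2"] by simp
  also have "\<dots> \<ge> 2 * ((T * u / 2)\<^sup>2 / 4)"
    using sin_ge[of "T * u / 2"] assms by (intro mult_left_mono) auto
  finally have "T / 4 * (T * u\<^sup>2) \<le> 2 * (1 - cos (T * u))"
    by (simp add: power_divide power2_eq_square mult_ac)
  moreover have "T * u\<^sup>2 > 0" using assms False by simp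
  ultimately have "T / 4 \<le> 2 * (1 - cos (T * u)) / (T * u\<^sup>2)" by (subst pos_le_divide_eq)
  then show ?thesis using False by (simp add: fejer_def)
qed (use assms in \<open>simp add: fejer_def\<close>)

lemma fejer_one_le: "fejer 1 u \<le> 5 / (1 + u\<^sup>2)"
\<comment> \<open>The bounds 1, 4 / u^2 and 5 / (1 + u^2) all equal 1 at u^2 = 4, which fixes both
  the threshold and the constant 5.\<close>
proof (cases "u\<^sup>2 \<le> 4")
  case True
  have "fejer 1 u \<le> 1" by (rule fejer_le) simp
  also have "1 \<le> 5 / (1 + u\<^sup>2)"
    using True by (subst le_divide_eq_1_pos) (auto intro: add_pos_nonneg)
  finally show ?thesis .
next
  case False
  then have "u \<noteq> 0" by auto
  then have "fejer 1 u \<le> 4 / u\<^sup>2" using fejer_le_inverse_square[of 1 u] by simp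
  also have "4 / w \<le> 5 / (1 + w)" if "w > 4" for w :: real
    using that by (simp add: field_simps)
  then have "4 / u\<^sup>2 \<le> 5 / (1 + u\<^sup>2)" using False by simp
  finally show ?thesis .
qed

text \<open>\<open>fejer 1\<close> has zeros, but two shifts of it have no common zero.\<close>

lemma fejer_one_shift_ge:
  "fejer 1 u + fejer 1 (u + 1) \<ge> 4 / 3 * (1 - cos (1/2)) / (1 + u\<^sup>2)"
proof -
  have base: "fejer 1 v \<ge> 2 * (1 - cos v) / (1 + v\<^sup>2)" for v
    by (auto simp: fejer_def intro!: divide_left_mono mult_pos_pos add_pos_nonneg)
  have "2 * (1 - cos (u + 1)) / (1 + (u + 1)\<^sup>2) \<ge> 2 * (1 - cos (u + 1)) / (3 * (1 + u\<^sup>2))"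
  proof (rule divide_left_mono)
    have "0 \<le> (u - 1)\<^sup>2 + u\<^sup>2" by simp
    then show "1 + (u + 1)\<^sup>2 \<le> 3 * (1 + u\<^sup>2)" by (simp add: power2_eq_square algebra_simps)
  qed (auto intro!: mult_pos_pos add_pos_nonneg)
  moreover have "2 * (1 - cos u) / (1 + u\<^sup>2) \<ge> 2 * (1 - cos u) / (3 * (1 + u\<^sup>2))"
    by (rule divide_left_mono) (auto intro!: mult_pos_pos add_pos_nonneg)
  ultimately have "fejer 1 u + fejer 1 (u + 1) \<ge> 2 * (1 - cos u) / (3 * (1 + u\<^sup>2)) + 2 * (1 - cos (u + 1)) / (3 * (1 + u\<^sup>2))"
    using base[of u] base[of "u + 1"] by linarith
  also have "2 * x / (3 * w) + 2 * y / (3 * w) = 2 / 3 * (x + y) / w" for x y w :: real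
    by (simp add: add_divide_distrib)
  then have "2 * (1 - cos u) / (3 * (1 + u\<^sup>2)) + 2 * (1 - cos (u + 1)) / (3 * (1 + u\<^sup>2))
      = 2 / 3 * ((1 - cos u) + (1 - cos (u + 1))) / (1 + u\<^sup>2)" .
  also have "(1 - cos u) + (1 - cos (u + 1)) = 2 - (cos u + cos (u + 1))" by simp
  finally have *: "fejer 1 u + fejer 1 (u + 1) \<ge> 2 / 3 * (2 - (cos u + cos (u + 1))) / (1 + u\<^sup>2)" .
  \<comment> \<open>The two cosines cannot both be near 1: their sum is at most 2 cos (1/2) <
    2.\<close>
  have "cos u + cos (u + 1) = 2 * (cos (u + 1/2) * cos (1/2))"
    using cos_plus_cos[of "u + 1" u] by (simp add: add_divide_distrib mult.assoc add.commute)
  also have "\<dots> \<le> 2 * (1 * cos (1/2))"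
    using pi_gt3 by (intro mult_left_mono mult_right_mono cos_le_one cos_ge_zero) auto
  finally have "2 / 3 * (2 - (cos u + cos (u + 1))) / (1 + u\<^sup>2) \<ge> 4 / 3 * (1 - cos (1/2)) / (1 + u\<^sup>2)"
    by (intro divide_right_mono) auto
  with * show ?thesis by linarith
qed

section \<open>Dirichlet series tested against the Fejer kernel\<close>

lemma Re_complex_of_real_mult: "Re (of_real r * z) = r * Re z"
  by simp

text \<open>The twist by \<open>cis (t * x)\<close> moves the centre to x: with u = ln n - x the
  cosine is the one integrated in \<open>fejer_has_integral\<close>. For n = 0 both sides are 0 by
  the convention for powers of 0.\<close>

lemma Re_nat_powr_cis:
  "Re (of_nat n powr (- Complex \<sigma> t) * cis (t * x)) = real n powr (-\<sigma>) * cos (t * (ln (real n) - x))"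
proof (cases "n = 0")
  case False
  then have "of_nat n powr (- Complex \<sigma> t) = exp (- Complex \<sigma> t * of_real (ln (real n)))"
    by (simp add: powr_def Ln_of_nat)
  also have "- Complex \<sigma> t * of_real (ln (real n)) = of_real (- \<sigma> * ln (real n)) + \<i> * of_real (- t * ln (real n))"
    by (simp add: complex_eq_iff)
  also have "exp \<dots> = of_real (real n powr (-\<sigma>)) * cis (- t * ln (real n))"
    using False by (subst exp_add) (simp add: cis_conv_exp powr_def flip: exp_of_real)
  finally have "of_nat n powr (- Complex \<sigma> t) * cis (t * x) = of_real (real n powr (-\<sigma>)) * cis (- (t * (ln (real n) - x)))"
    by (simp add: cis_mult algebra_simps)
  then show ?thesis by simp
qed simp

lemma norm_nat_powr: "norm (of_nat n powr s :: complex) = real n powr Re s"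
  by (cases "n = 0") (auto simp: powr_def Ln_of_nat)

lemma summable_dirichlet_series:
  assumes "summable (\<lambda>n. \<bar>a n\<bar> * real n powr (- \<sigma>))" "Re s \<ge> \<sigma>"
  shows "summable (\<lambda>n. of_real (a n) * of_nat n powr (-s) :: complex)"
    and "summable (\<lambda>n. norm (of_real (a n) * of_nat n powr (-s) :: complex))"
proof -
  show *: "summable (\<lambda>n. norm (of_real (a n) * of_nat n powr (-s) :: complex))"
  proof (rule summable_comparison_test[OF _ assms(1)], intro exI[of _ 0] allI impI)
    fix n :: nat
    show "norm (norm (of_real (a n) * of_nat n powr (-s) :: complex)) \<le> \<bar>a n\<bar> * real n powr (- \<sigma>)"
      using assms(2) by (cases "n = 0") (auto simp: norm_mult norm_nat_powr intro!: mult_left_mono powr_mono)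
  qed
  show "summable (\<lambda>n. of_real (a n) * of_nat n powr (-s) :: complex)"
    by (rule summable_norm_cancel[OF *])
qed

text \<open>Absolute convergence at \<sigma> makes the series converge uniformly in t, so the
  integral against the tent may be taken term by term, and each term yields one value of the
  kernel.\<close>

lemma fejer_sums:
  assumes T: "T > 0" and sb: "summable (\<lambda>n. \<bar>b n\<bar> * real n powr (- \<sigma>))"
  shows "(\<lambda>n. b n * real n powr (-\<sigma>) * fejer T (ln (real n) - x)) sums
     integral {-T..T} (\<lambda>t. (1 - \<bar>t\<bar> / T) * Re (dirichlet_series b (Complex \<sigma> t) * cis (t * x)))"
proof -
  define f where "f = (\<lambda>n t. (1 - \<bar>t\<bar> / T) * (b n * (real n powr (-\<sigma>) * cos (t * (ln (real n) - x)))))"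
  define g where "g = (\<lambda>t. (1 - \<bar>t\<bar> / T) * Re (dirichlet_series b (Complex \<sigma> t) * cis (t * x)))"
  have fg: "(\<lambda>n. f n t) sums g t" for t
  proof -
    have "(\<lambda>n. of_real (b n) * of_nat n powr (- Complex \<sigma> t)) sums dirichlet_series b (Complex \<sigma> t)"
      unfolding dirichlet_series_def by (intro summable_sums summable_dirichlet_series[OF sb]) simp
    then have "(\<lambda>n. Re (of_real (b n) * of_nat n powr (- Complex \<sigma> t) * cis (t * x))) sums Re (dirichlet_series b (Complex \<sigma> t) * cis (t * x))"
      by (intro sums_Re sums_mult2)
    then have "(\<lambda>n. b n * (real n powr (-\<sigma>) * cos (t * (ln (real n) - x)))) sums Re (dirichlet_series b (Complex \<sigma> t) * cis (t * x))"
      by (simp only: mult.assoc Re_complex_of_real_mult Re_nat_powr_cis)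
    then show ?thesis unfolding f_def g_def by (rule sums_mult)
  qed
  have unif: "uniform_limit {-T..T} (\<lambda>N t. \<Sum>n<N. f n t) g sequentially"
  proof -
    have "uniform_limit {-T..T} (\<lambda>N t. \<Sum>n<N. f n t) (\<lambda>t. suminf (\<lambda>n. f n t)) sequentially"
    proof (rule Weierstrass_m_test[OF _ sb])
      fix n t assume "t \<in> {-T..T}"
      then have "\<bar>1 - \<bar>t\<bar> / T\<bar> \<le> 1" using T by (auto simp: abs_if field_simps)
      then have "\<bar>1 - \<bar>t\<bar> / T\<bar> * (\<bar>b n\<bar> * (real n powr (-\<sigma>) * \<bar>cos (t * (ln (real n) - x))\<bar>)) \<le> 1 * (\<bar>b n\<bar> * (real n powr (-\<sigma>) * 1))"
        by (intro mult_mono) auto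
      then show "norm (f n t) \<le> \<bar>b n\<bar> * real n powr (- \<sigma>)"
        unfolding f_def by (simp add: abs_mult)
    qed
    also have "(\<lambda>t. suminf (\<lambda>n. f n t)) = g" using fg by (auto simp: sums_iff)
    finally show ?thesis .
  qed
  have int: "((\<lambda>t. \<Sum>n<N. f n t) has_integral (\<Sum>n<N. b n * real n powr (-\<sigma>) * fejer T (ln (real n) - x))) {-T..T}" for N
  proof (intro has_integral_sum)
    fix n
    have "((\<lambda>t. (b n * real n powr (-\<sigma>)) * ((1 - \<bar>t\<bar> / T) * cos (t * (ln (real n) - x)))) has_integral (b n * real n powr (-\<sigma>)) * fejer T (ln (real n) - x)) {-T..T}"
      by (intro has_integral_mult_right fejer_has_integral T)
    then show "(f n has_integral b n * real n powr (-\<sigma>) * fejer T (ln (real n) - x)) {-T..T}"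
      unfolding f_def by (simp add: mult_ac)
  qed simp
  obtain I J where IJ: "\<And>N. ((\<lambda>t. \<Sum>n<N. f n t) has_integral I N) {-T..T}" "(g has_integral J) {-T..T}" "I \<longlonglongrightarrow> J"
  proof (rule uniform_limit_integral[OF unif])
    show "continuous_on {-T..T} (\<lambda>t. \<Sum>n<N. f n t)" for N
      unfolding f_def by (intro continuous_intros) (use T in auto)
  qed auto
  have "I = (\<lambda>N. \<Sum>n<N. b n * real n powr (-\<sigma>) * fejer T (ln (real n) - x))"
    by (intro ext has_integral_unique[OF IJ(1) int])
  moreover have "J = integral {-T..T} g" using IJ(2) by (simp add: integral_unique)
  ultimately show ?thesis using IJ(3) unfolding sums_def g_def by simp
qed

text \<open>Shifting the variable by \<open>\<pi>/x\<close> changes the sign of the exponential, so the integral is half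
  the integral of a difference of nearby values.\<close>

lemma Riemann_Lebesgue_tent:
  fixes g :: "real \<Rightarrow> complex"
  assumes T: "T > 0" and cont: "continuous_on {-T..T} g"
  shows "((\<lambda>x. integral {-T..T} (\<lambda>t. (1 - \<bar>t\<bar> / T) * Re (g t * cis (t * x)))) \<longlongrightarrow> 0) at_top"
proof -
  \<comment> \<open>The tent vanishes at both ends of [-T, T], so h is continuous on the whole line
    and zero outside the interval; \<open>c\<close> clamps the argument into the set where g is
    known to be continuous.\<close>
  define c where "c = (\<lambda>t::real. max (-T) (min T t))"
  define h where "h = (\<lambda>t. of_real (max 0 (1 - \<bar>t\<bar> / T)) * g (c t))"
  have cont_h: "continuous_on A h" for A
    unfolding h_def
  proof (intro continuous_intros)
    have "continuous_on A (g \<circ> c)"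
      unfolding c_def by (rule continuous_on_compose) (auto intro!: continuous_intros continuous_on_subset[OF cont] simp: T less_imp_le)
    then show "continuous_on A (\<lambda>t. g (c t))" by (simp add: o_def)
  qed (use T in auto)
  have h0: "h t = 0" if "t \<notin> {-T..T}" for t
  proof -
    have "1 - \<bar>t\<bar> / T \<le> 0" using T that by (auto simp: field_simps abs_if)
    then show ?thesis by (simp add: h_def)
  qed
  have hT: "h t = of_real (1 - \<bar>t\<bar> / T) * g t" if "t \<in> {-T..T}" for t
  proof -
    have "0 \<le> 1 - \<bar>t\<bar> / T" "c t = t" using T that by (auto simp: field_simps abs_if c_def)
    then show ?thesis by (simp add: h_def)
  qed
  define I where "I = (\<lambda>x. integral {-T..T} (\<lambda>t. h t * cis (t * x)))"
  have cis_cont: "continuous_on A (\<lambda>t. h t * cis (t * x))" for A x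
    by (intro continuous_intros cont_h)
  have I_int: "((\<lambda>t. h t * cis (t * x)) has_integral I x) {-T..T}" for x
    unfolding I_def by (intro integrable_integral integrable_continuous_real cis_cont)
  have Re_I: "integral {-T..T} (\<lambda>t. (1 - \<bar>t\<bar> / T) * Re (g t * cis (t * x))) = Re (I x)" for x
  proof (rule integral_unique)
    have "((Re \<circ> (\<lambda>t. h t * cis (t * x))) has_integral Re (I x)) {-T..T}"
      by (rule has_integral_linear[OF I_int bounded_linear_Re])
    then show "((\<lambda>t. (1 - \<bar>t\<bar> / T) * Re (g t * cis (t * x))) has_integral Re (I x)) {-T..T}"
      by (rule has_integral_eq[rotated]) (simp only: o_def hT mult.assoc Re_complex_of_real_mult)
  qed
  have "(I \<longlongrightarrow> 0) at_top"
  proof (rule tendstoI)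
    fix e :: real assume e: "e > 0"
    \<comment> \<open>2 T + 2 is the length of [-T-1, T+1], which contains the supports of h and of
      its shift, the shift being less than 1.\<close>
    define e' where "e' = e / (2 * T + 2)"
    have e': "e' > 0" using e T by (simp add: e'_def)
    have "uniformly_continuous_on {-T-2..T+2} h"
      by (intro compact_uniformly_continuous cont_h) simp
    then obtain d where d: "d > 0" "\<And>s t. s \<in> {-T-2..T+2} \<Longrightarrow> t \<in> {-T-2..T+2} \<Longrightarrow> dist t s < d \<Longrightarrow> dist (h t) (h s) < e'"
      using e' unfolding uniformly_continuous_on_def by metis
    have ev: "eventually (\<lambda>x::real. x > 0 \<and> pi / x < min 1 d) at_top"
    proof -
      have "((\<lambda>x::real. pi / x) \<longlongrightarrow> 0) at_top" by real_asymp
      then have "eventually (\<lambda>x::real. pi / x < min 1 d) at_top" using d(1) by (intro order_tendstoD) auto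
      then show ?thesis using eventually_gt_at_top[of 0] by eventually_elim auto
    qed
    then show "eventually (\<lambda>x. dist (I x) 0 < e) at_top"
    proof eventually_elim
      case (elim x)
      define \<tau> where "\<tau> = pi / x"
      have \<tau>: "0 < \<tau>" "\<tau> < 1" "\<tau> < d" using elim by (auto simp: \<tau>_def)
      let ?f = "\<lambda>t. h t * cis (t * x)"
      have big: "(?f has_integral I x) {a..b}" if "a \<le> -T" "T \<le> b" for a b
        by (rule has_integral_on_superset[OF I_int]) (use h0 that in auto)
      have "integral {-T-1..T+1} (?f \<circ> (\<lambda>t. t + \<tau>)) = integral {-T-1+\<tau>..T+1+\<tau>} ?f"
        by (rule integral_shift) (rule cis_cont)
      also have "\<dots> = I x" using \<tau> T by (intro integral_unique big) auto
      finally have 1: "integral {-T-1..T+1} (\<lambda>t. ?f (t + \<tau>)) = I x" by (simp add: o_def)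
      have neg: "?f (t + \<tau>) = - h (t + \<tau>) * cis (t * x)" for t
      proof -
        have "(t + \<tau>) * x = t * x + pi" using elim by (simp add: \<tau>_def field_simps)
        then show ?thesis by (simp flip: cis_mult)
      qed
      have sh: "continuous_on A (\<lambda>t. h (t + \<tau>))" for A
        by (intro continuous_on_compose2[OF cont_h[of UNIV]] continuous_intros) auto
      have "integral {-T-1..T+1} (\<lambda>t. (h t - h (t + \<tau>)) * cis (t * x)) = integral {-T-1..T+1} (\<lambda>t. ?f t + ?f (t + \<tau>))"
        unfolding neg by (simp add: algebra_simps)
      also have "\<dots> = integral {-T-1..T+1} ?f + integral {-T-1..T+1} (\<lambda>t. ?f (t + \<tau>))"
        unfolding neg by (intro integral_add integrable_continuous_real continuous_intros cont_h sh)
      also have "\<dots> = 2 * I x"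
        using 1 integral_unique[OF big[of "-T-1" "T+1"]] by simp
      finally have "2 * I x = integral {-T-1..T+1} (\<lambda>t. (h t - h (t + \<tau>)) * cis (t * x))" ..
      also have "norm \<dots> \<le> e' * (T + 1 - (-T-1))"
      proof (rule integral_bound)
        fix t assume t: "t \<in> {-T-1..T+1}"
        have "dist (h t) (h (t + \<tau>)) < e'" using t \<tau> by (intro d(2)) (auto simp: dist_norm)
        then show "norm ((h t - h (t + \<tau>)) * cis (t * x)) \<le> e'" by (simp add: norm_mult dist_norm)
      qed (use T in \<open>auto intro!: continuous_intros cont_h sh\<close>)
      also have "\<dots> = e" using T by (simp add: e'_def field_simps)
      finally show ?case using e by (simp add: norm_mult)
    qed
  qed
  then have "((\<lambda>x. Re (I x)) \<longlongrightarrow> 0) at_top" using tendsto_Re by fastforce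
  then show ?thesis unfolding Re_I .
qed

text \<open>For n \<ge> 1 the summand is compared with an increment of arctan (ln z - x), whose
  derivative is 1 / (z (1 + (ln z - x)^2)); the increments telescope to at most pi, uniformly in x
  and N. The factor 6 is 2 * 3: on [n, n + 1] one has z \<le> 2 n and 1 + (ln z - x)^2 \<le> 3 (1 +
  (ln n - x)^2).\<close>

lemma sum_log_lorentz_le:
  "(\<Sum>n<N. real n powr (-1) / (1 + (ln (real n) - x)\<^sup>2)) \<le> 6 * pi"
proof -
  have step: "real n powr (-1) / (1 + (ln (real n) - x)\<^sup>2)
      \<le> 6 * (arctan (ln (real n + 1) - x) - arctan (ln (real n) - x))" if n: "n \<ge> 1" for n :: nat
  proof -
    have der: "((\<lambda>z. arctan (ln z - x)) has_real_derivative 1 / (1 + (ln z - x)\<^sup>2) * (1 / z)) (at z)" if "z > 0" for z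
      using that by (auto intro!: derivative_eq_intros simp: field_simps)
    obtain z where z: "real n < z" "z < real n + 1"
      "arctan (ln (real n + 1) - x) - arctan (ln (real n) - x) = (real n + 1 - real n) * (1 / (1 + (ln z - x)\<^sup>2) * (1 / z))"
      using MVT2[of "real n" "real n + 1", OF _ der] n by force
    define v where "v = ln (real n) - x"
    define w where "w = ln z - ln (real n)"
    have "w = ln (z / real n)" using z n by (simp add: w_def ln_div)
    also have "\<dots> \<le> z / real n - 1" using z n by (intro ln_le_minus_one) auto
    also have "\<dots> \<le> 1" using z n by (simp add: field_simps)
    finally have w: "0 \<le> w" "w \<le> 1" using z n by (auto simp: w_def)
    then have "w\<^sup>2 \<le> 1" by (simp add: power_le_one)
    moreover have "2 * v * w \<le> v\<^sup>2 + w\<^sup>2" by (rule sum_squares_bound)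
    moreover have "0 \<le> v\<^sup>2" by simp
    moreover have "1 + (p + q + r) \<le> 3 * (1 + p)" if "q \<le> 1" "r \<le> p + q" "0 \<le> p" for p q r :: real
      using that by simp
    ultimately have 1: "1 + (v + w)\<^sup>2 \<le> 3 * (1 + v\<^sup>2)"
      unfolding power2_sum by blast
    have "z * (1 + (v + w)\<^sup>2) \<le> (2 * real n) * (3 * (1 + v\<^sup>2))"
      using z n 1 by (intro mult_mono) auto
    then have "1 / ((2 * real n) * (3 * (1 + v\<^sup>2))) \<le> 1 / (z * (1 + (v + w)\<^sup>2))"
      using z n by (intro divide_left_mono) (auto intro!: mult_pos_pos add_pos_nonneg)
    then have "6 * (1 / ((2 * real n) * (3 * (1 + v\<^sup>2)))) \<le> 6 * (1 / (z * (1 + (v + w)\<^sup>2)))"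
      by (rule mult_left_mono) simp
    moreover have "1 / (z * (1 + (v + w)\<^sup>2)) = 1 / (1 + (v + w)\<^sup>2) * (1 / z)" by simp
    moreover have "6 * (1 / ((2 * p) * (3 * q))) = 1 / p / q" for p q :: real by simp
    ultimately have "1 / real n / (1 + v\<^sup>2) \<le> 6 * (1 / (1 + (v + w)\<^sup>2) * (1 / z))" by metis
    moreover have "ln z - x = v + w" by (simp add: v_def w_def)
    ultimately show ?thesis using z n by (simp add: v_def[symmetric] powr_minus_divide)
  qed
  have "(\<Sum>n<N. real n powr (-1) / (1 + (ln (real n) - x)\<^sup>2))
      \<le> (\<Sum>n\<in>{1..<N}. 6 * (arctan (ln (real n + 1) - x) - arctan (ln (real n) - x)))"
  proof -
    have "(\<Sum>n<N. real n powr (-1) / (1 + (ln (real n) - x)\<^sup>2)) = (\<Sum>n\<in>{1..<N}. real n powr (-1) / (1 + (ln (real n) - x)\<^sup>2))"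
      by (rule sum.mono_neutral_right) (auto simp: not_le)
    also have "\<dots> \<le> (\<Sum>n\<in>{1..<N}. 6 * (arctan (ln (real n + 1) - x) - arctan (ln (real n) - x)))"
      by (intro sum_mono step) auto
    finally show ?thesis .
  qed
  also have "\<dots> \<le> 6 * pi"
  proof (cases "N \<ge> 1")
    case True
    have "(\<Sum>n\<in>{1..<N}. arctan (ln (real n + 1) - x) - arctan (ln (real n) - x)) = arctan (ln (real N) - x) - arctan (ln (real 1) - x)"
      using sum_Suc_diff'[OF True, of "\<lambda>n. arctan (ln (real n) - x)"] by (simp add: add.commute)
    also have "\<dots> \<le> pi" using arctan_bounded[of "ln (real N) - x"] arctan_bounded[of "ln (real 1) - x"] by linarith
    finally show ?thesis unfolding sum_distrib_left[symmetric] by simp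
  qed simp
  finally show ?thesis .
qed

text \<open>The integers between exp x and exp (x + 1/T) suffice: there are at least exp x / (2 T)
  of them, each with weight at least exp (- x - 3) and kernel value at least T / 4. Both x and T
  cancel in the product, so T may later be chosen after the lower bound is known.\<close>

lemma fejer_nat_sum_ge:
  assumes T: "T \<ge> 1" and x: "exp x \<ge> 2 * T" "x \<ge> 0" and \<sigma>: "1 < \<sigma>" "\<sigma> \<le> 2" "(\<sigma> - 1) * x \<le> 1"
    and sm: "summable (\<lambda>n. real n powr (-\<sigma>) * fejer T (ln (real n) - x))"
  shows "suminf (\<lambda>n. real n powr (-\<sigma>) * fejer T (ln (real n) - x)) \<ge> exp (-3) / 8"
proof -
  define l where "l = nat \<lceil>exp x\<rceil>"
  define u where "u = nat \<lfloor>exp (x + 1 / T)\<rfloor>"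
  have l: "real l \<ge> exp x" "real l < exp x + 1" unfolding l_def by (auto simp: real_nat_ceiling_ge) linarith
  have u: "real u \<le> exp (x + 1 / T)" "real u > exp (x + 1 / T) - 1"
    unfolding u_def by (auto simp: of_nat_nat)
  have "exp (x + 1 / T) \<ge> exp x * (1 + 1 / T)"
    unfolding exp_add by (intro mult_left_mono exp_ge_add_one_self) auto
  also have "exp x * (1 + 1 / T) = exp x + exp x / T" by (simp add: algebra_simps)
  finally have count: "real (card {l..u}) \<ge> exp x / (2 * T)"
  proof -
    assume *: "exp x + exp x / T \<le> exp (x + 1 / T)"
    have "real u + 1 - real l \<ge> exp x / T - 1" using * l u by linarith
    also have "exp x / T - 1 \<ge> exp x / (2 * T)" using x(1) T by (simp add: field_simps)
    finally show ?thesis by (cases "l \<le> Suc u") (auto simp: of_nat_diff)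
  qed
  have summand: "real n powr (-\<sigma>) * fejer T (ln (real n) - x) \<ge> exp (-x - 3) * (T / 4)" if n: "n \<in> {l..u}" for n
  proof (rule mult_mono)
    have n1: "exp x \<le> real n" "real n \<le> exp (x + 1 / T)" using n l(1) u(1) by (auto intro: order_trans)
    have n0: "real n > 0" using n1(1) exp_gt_zero[of x] by linarith
    have "ln (real n) \<le> ln (exp (x + 1 / T))" using n1(2) n0 by (subst ln_le_cancel_iff) auto
    then have ln: "x \<le> ln (real n)" "ln (real n) \<le> x + 1 / T"
      using n1 n0 by (auto simp: ln_ge_iff)
    then show "T / 4 \<le> fejer T (ln (real n) - x)"
      using T by (intro fejer_ge) (auto simp: abs_if field_simps)
    have "1 / T \<le> 1" using T by simp
    then have "\<sigma> * ln (real n) \<le> \<sigma> * (x + 1)" using ln \<sigma> by (intro mult_left_mono) auto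
    \<comment> \<open>\<sigma> (x + 1) = x + (\<sigma> - 1) x + \<sigma>, where the last two terms
      are at most 1 and 2.\<close>
    also have "\<dots> \<le> x + 3" using \<sigma> by (simp add: algebra_simps)
    finally have "exp (-x - 3) \<le> exp (- (\<sigma> * ln (real n)))" by simp
    then show "exp (-x - 3) \<le> real n powr (-\<sigma>)" using n0 by (simp add: powr_def)
  qed (use T in auto)
  have "exp (-3) / 8 = (exp x / (2 * T)) * (exp (-x - 3) * (T / 4))"
    using T by (simp add: exp_diff exp_minus field_simps)
  also have "\<dots> \<le> real (card {l..u}) * (exp (-x - 3) * (T / 4))"
    using count T by (intro mult_right_mono) auto
  also have "\<dots> \<le> (\<Sum>n\<in>{l..u}. real n powr (-\<sigma>) * fejer T (ln (real n) - x))"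
    using sum_bounded_below[of "{l..u}" "exp (-x - 3) * (T / 4)"] summand by simp
  also have "\<dots> \<le> suminf (\<lambda>n. real n powr (-\<sigma>) * fejer T (ln (real n) - x))"
    using T by (intro sum_le_suminf[OF sm]) (auto intro!: mult_nonneg_nonneg fejer_nonneg)
  finally show ?thesis .
qed

text \<open>A Wiener--Ikehara style argument: if \<open>a\<close> vanished on a window around \<open>x\<close>, the Fejer means
  of \<open>a\<close> around \<open>x\<close> would be \<open>O(1/T)\<close>, whereas those of the constant \<open>c\<close> are bounded below and the
  two differ by a Fourier integral which tends to 0.\<close>

theorem positive_coeff_in_log_window:
  fixes a :: "nat \<Rightarrow> real" and G :: "complex \<Rightarrow> complex"
  assumes a0: "\<And>n. a n \<ge> 0"
    and sum_a: "\<And>\<sigma>. \<sigma> > 1 \<Longrightarrow> summable (\<lambda>n. a n * real n powr (-\<sigma>))"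
    and c: "c > 0"
    and contG: "continuous_on {s. Re s \<ge> 1} G"
    and eqG: "\<And>s. Re s > 1 \<Longrightarrow> dirichlet_series a s - of_real c * dirichlet_series (\<lambda>_. 1) s = G s"
    and \<eta>: "\<eta> > 0"
  shows "eventually (\<lambda>x. \<exists>n. a n > 0 \<and> \<bar>ln (real n) - x\<bar> \<le> \<eta>) at_top"
proof -
  define J where "J = (\<lambda>T \<sigma> x. integral {-T..T} (\<lambda>t. (1 - \<bar>t\<bar> / T) * Re (G (Complex \<sigma> t) * cis (t * x))))"
  define SA where "SA = (\<lambda>T \<sigma> x. suminf (\<lambda>n. a n * real n powr (-\<sigma>) * fejer T (ln (real n) - x)))"
  define S1 where "S1 = (\<lambda>T \<sigma> x. suminf (\<lambda>n. real n powr (-\<sigma>) * fejer T (ln (real n) - x)))"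
  have sum_1: "summable (\<lambda>n. real n powr (-\<sigma>))" if "\<sigma> > 1" for \<sigma>
    using that by (simp add: summable_real_powr_iff)
  have abs_a: "summable (\<lambda>n. \<bar>a n\<bar> * real n powr (-\<sigma>))" if "\<sigma> > 1" for \<sigma>
    using sum_a[OF that] a0 by simp
  have sumF: "summable (\<lambda>n. b n * real n powr (-\<sigma>) * fejer T (ln (real n) - x))"
    if "summable (\<lambda>n. b n * real n powr (-\<sigma>))" "\<And>n. b n \<ge> 0" "T > 0" for b T \<sigma> x
  proof (rule summable_comparison_test')
    show "summable (\<lambda>n. b n * real n powr (-\<sigma>) * T)" using that by (intro summable_mult2)
    show "norm (b n * real n powr (-\<sigma>) * fejer T (ln (real n) - x)) \<le> b n * real n powr (-\<sigma>) * T" for n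
      using that fejer_nonneg[of T "ln (real n) - x"] fejer_le[of T "ln (real n) - x"]
      by (auto simp: abs_mult intro!: mult_left_mono mult_nonneg_nonneg)
  qed
  note sumFa = sumF[OF sum_a a0]
  have sumF1: "summable (\<lambda>n. real n powr (-\<sigma>) * fejer T (ln (real n) - x))" if "\<sigma> > 1" "T > 0" for \<sigma> T x
    using sumF[of "\<lambda>_. 1"] sum_1 that by simp
  have key: "SA T \<sigma> x = c * S1 T \<sigma> x + J T \<sigma> x" if "T > 0" "\<sigma> > 1" for T \<sigma> x
  proof -
    define b where "b = (\<lambda>n. a n - c)"
    have "summable (\<lambda>n. a n * real n powr (-\<sigma>) + c * real n powr (-\<sigma>))"
      using that by (intro summable_add summable_mult sum_a sum_1)
    then have sb: "summable (\<lambda>n. \<bar>b n\<bar> * real n powr (-\<sigma>))"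
    proof (rule summable_comparison_test'[where N = 0])
      fix n
      have "\<bar>b n\<bar> \<le> a n + c" using a0[of n] c by (auto simp: b_def)
      then have "\<bar>b n\<bar> * real n powr (-\<sigma>) \<le> (a n + c) * real n powr (-\<sigma>)" by (intro mult_right_mono) auto
      then show "norm (\<bar>b n\<bar> * real n powr (-\<sigma>)) \<le> a n * real n powr (-\<sigma>) + c * real n powr (-\<sigma>)"
        by (simp add: algebra_simps)
    qed
    have D: "dirichlet_series b (Complex \<sigma> t) = G (Complex \<sigma> t)" for t
    proof -
      have "dirichlet_series a (Complex \<sigma> t) - of_real c * dirichlet_series (\<lambda>_. 1) (Complex \<sigma> t) = dirichlet_series b (Complex \<sigma> t)"
      proof -
        have "(\<lambda>n. of_real (a n) * of_nat n powr (- Complex \<sigma> t) - of_real c * (of_real 1 * of_nat n powr (- Complex \<sigma> t)))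
           sums (dirichlet_series a (Complex \<sigma> t) - of_real c * dirichlet_series (\<lambda>_. 1) (Complex \<sigma> t))"
          unfolding dirichlet_series_def
          using that sum_1 by (intro sums_diff sums_mult summable_sums summable_dirichlet_series[OF abs_a] summable_dirichlet_series[where \<sigma> = \<sigma>]) auto
        then show ?thesis unfolding dirichlet_series_def[of b] unfolding b_def by (simp add: sums_iff algebra_simps)
      qed
      then show ?thesis using eqG[of "Complex \<sigma> t"] that by simp
    qed
    have "(\<lambda>n. b n * real n powr (-\<sigma>) * fejer T (ln (real n) - x)) sums J T \<sigma> x"
      using fejer_sums[OF that(1) sb, of x] unfolding D J_def .
    moreover have "(\<lambda>n. a n * real n powr (-\<sigma>) * fejer T (ln (real n) - x) - c * (real n powr (-\<sigma>) * fejer T (ln (real n) - x))) sums (SA T \<sigma> x - c * S1 T \<sigma> x)"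
      unfolding SA_def S1_def using that by (intro sums_diff sums_mult summable_sums sumFa sumF1)
    ultimately have "J T \<sigma> x = SA T \<sigma> x - c * S1 T \<sigma> x"
      by (intro sums_unique2) (auto simp: b_def algebra_simps)
    then show ?thesis by simp
  qed
  have contGl: "continuous_on {-T..T} (\<lambda>t. G (Complex \<sigma> t))" if "\<sigma> \<ge> 1" for T \<sigma>
    by (rule continuous_on_compose2[OF contG]) (use that in \<open>auto simp: Complex_eq intro!: continuous_intros\<close>)
  have contJ: "continuous_on {-T..T} (\<lambda>t. (1 - \<bar>t\<bar> / T) * Re (G (Complex \<sigma> t) * cis (t * x)))" if "\<sigma> \<ge> 1" "T > 0" for T \<sigma> x
    using that by (intro continuous_intros contGl) auto
  have compK: "compact ((\<lambda>(\<sigma>, t). Complex \<sigma> t) ` ({1..2} \<times> {-T..T}))" for T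
    by (intro compact_continuous_image compact_Times) (auto simp: Complex_eq split_beta intro!: continuous_intros)
  have tent: "\<bar>1 - \<bar>t\<bar> / T\<bar> \<le> 1" if "t \<in> {-T..T}" "T > 0" for t T :: real
    using that by (auto simp: abs_if field_simps)

  obtain B where B: "B > 0" "\<And>\<sigma> x. 1 < \<sigma> \<Longrightarrow> \<sigma> \<le> 2 \<Longrightarrow> \<bar>J 1 \<sigma> x\<bar> \<le> B"
  proof -
    define K where "K = (\<lambda>(\<sigma>, t). Complex \<sigma> t) ` ({1..2} \<times> {-1..1})"
    have "bounded (G ` K)"
      unfolding K_def by (intro compact_imp_bounded compact_continuous_image compK continuous_on_subset[OF contG]) auto
    then obtain B' where "B' > 0" and B': "\<And>s. s \<in> K \<Longrightarrow> norm (G s) \<le> B'"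
      unfolding bounded_pos by auto
    have "\<bar>J 1 \<sigma> x\<bar> \<le> B' * 2" if "1 < \<sigma>" "\<sigma> \<le> 2" for \<sigma> x
    proof -
      have "norm (J 1 \<sigma> x) \<le> B' * (1 - (-1))"
        unfolding J_def
      proof (rule integral_bound)
        fix t :: real assume t: "t \<in> {-1..1}"
        have "norm (G (Complex \<sigma> t)) \<le> B'" using t that by (intro B') (force simp: K_def)
        then have "\<bar>Re (G (Complex \<sigma> t) * cis (t * x))\<bar> \<le> B'"
          using abs_Re_le_cmod[of "G (Complex \<sigma> t) * cis (t * x)"] by (simp add: norm_mult)
        then have "\<bar>1 - \<bar>t\<bar> / 1\<bar> * \<bar>Re (G (Complex \<sigma> t) * cis (t * x))\<bar> \<le> 1 * B'"
          using t by (intro mult_mono tent) auto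
        then show "norm ((1 - \<bar>t\<bar> / 1) * Re (G (Complex \<sigma> t) * cis (t * x))) \<le> B'"
          by (simp only: real_norm_def abs_mult)
      next
        show "continuous_on {-1..1} (\<lambda>t. (1 - \<bar>t\<bar> / 1) * Re (G (Complex \<sigma> t) * cis (t * x)))"
          by (rule contJ) (use that in auto)
      qed simp
      then show ?thesis by simp
    qed
    with \<open>B' > 0\<close> show ?thesis by (intro that[of "B' * 2"]) auto
  qed
  have close: "\<exists>d>0. \<forall>\<sigma> x. 1 < \<sigma> \<longrightarrow> \<sigma> < 1 + d \<longrightarrow> \<bar>J T \<sigma> x - J T 1 x\<bar> \<le> e" if "T > 0" "e > 0" for T e
  proof -
    define K where "K = (\<lambda>(\<sigma>, t). Complex \<sigma> t) ` ({1..2} \<times> {-T..T})"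
    have "uniformly_continuous_on K G"
      unfolding K_def by (intro compact_uniformly_continuous compK continuous_on_subset[OF contG]) auto
    moreover have "e / (2 * T) > 0" using that by simp
    ultimately obtain d where d: "d > 0" "\<And>s s'. s \<in> K \<Longrightarrow> s' \<in> K \<Longrightarrow> dist s' s < d \<Longrightarrow> dist (G s') (G s) < e / (2 * T)"
      unfolding uniformly_continuous_on_def by metis
    have "\<bar>J T \<sigma> x - J T 1 x\<bar> \<le> e" if \<sigma>: "1 < \<sigma>" "\<sigma> < 1 + min 1 d" for \<sigma> x
    proof -
      have "J T \<sigma> x - J T 1 x = integral {-T..T} (\<lambda>t. (1 - \<bar>t\<bar> / T) * Re (G (Complex \<sigma> t) * cis (t * x)) - (1 - \<bar>t\<bar> / T) * Re (G (Complex 1 t) * cis (t * x)))"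
        unfolding J_def using \<sigma> \<open>T > 0\<close> by (intro integral_diff[symmetric] integrable_continuous_real contJ) auto
      also have "norm \<dots> \<le> e / (2 * T) * (T - (-T))"
      proof (rule integral_bound)
        fix t assume t: "t \<in> {-T..T}"
        have "dist (G (Complex \<sigma> t)) (G (Complex 1 t)) < e / (2 * T)"
        proof (rule d(2))
          show "Complex 1 t \<in> K" "Complex \<sigma> t \<in> K" using t \<sigma> unfolding K_def by force+
          have "Complex \<sigma> t - Complex 1 t = of_real (\<sigma> - 1)" by (simp add: complex_eq_iff)
          then show "dist (Complex \<sigma> t) (Complex 1 t) < d" using \<sigma> by (simp add: dist_norm del: of_real_diff)
        qed
        then have "norm ((G (Complex \<sigma> t) - G (Complex 1 t)) * cis (t * x)) \<le> e / (2 * T)"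
          by (simp add: dist_norm norm_mult)
        then have "\<bar>Re ((G (Complex \<sigma> t) - G (Complex 1 t)) * cis (t * x))\<bar> \<le> e / (2 * T)"
          using abs_Re_le_cmod order_trans by blast
        then have "\<bar>1 - \<bar>t\<bar> / T\<bar> * \<bar>Re ((G (Complex \<sigma> t) - G (Complex 1 t)) * cis (t * x))\<bar> \<le> 1 * (e / (2 * T))"
          using t \<open>T > 0\<close> by (intro mult_mono tent) auto
        then have "\<bar>(1 - \<bar>t\<bar> / T) * Re ((G (Complex \<sigma> t) - G (Complex 1 t)) * cis (t * x))\<bar> \<le> e / (2 * T)"
          by (simp only: abs_mult mult_1)
        then show "norm ((1 - \<bar>t\<bar> / T) * Re (G (Complex \<sigma> t) * cis (t * x)) - (1 - \<bar>t\<bar> / T) * Re (G (Complex 1 t) * cis (t * x))) \<le> e / (2 * T)"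
          by (simp only: real_norm_def left_diff_distrib minus_complex.simps right_diff_distrib)
      next
        show "continuous_on {-T..T} (\<lambda>t. (1 - \<bar>t\<bar> / T) * Re (G (Complex \<sigma> t) * cis (t * x)) - (1 - \<bar>t\<bar> / T) * Re (G (Complex 1 t) * cis (t * x)))"
          by (intro continuous_on_diff contJ) (use \<sigma> \<open>T > 0\<close> in auto)
      qed (use \<open>T > 0\<close> in simp)
      finally show ?thesis using \<open>T > 0\<close> by simp
    qed
    then show ?thesis using d(1) by (intro exI[of _ "min 1 d"]) auto
  qed
  have RL: "eventually (\<lambda>x. \<bar>J T 1 x\<bar> < e) at_top" if "T > 0" "e > 0" for T e
    using tendstoD[OF Riemann_Lebesgue_tent[OF that(1) contGl[of 1 T]] that(2)] unfolding J_def by simp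

  define S where "S = 5 * (6 * pi)"
  have S1_le: "S1 1 \<sigma> x \<le> S" if "\<sigma> > 1" for \<sigma> x
    unfolding S1_def
  proof (rule suminf_le_const[OF sumF1])
    fix N
    have "(\<Sum>n<N. real n powr (-\<sigma>) * fejer 1 (ln (real n) - x)) \<le> (\<Sum>n<N. real n powr (-1) * (5 / (1 + (ln (real n) - x)\<^sup>2)))"
    proof (intro sum_mono mult_mono fejer_one_le fejer_nonneg)
      fix n :: nat
      show "real n powr (-\<sigma>) \<le> real n powr (-1)" by (cases "n = 0") (simp, rule powr_mono, use that in auto)
    qed auto
    also have "\<dots> = 5 * (\<Sum>n<N. real n powr (-1) / (1 + (ln (real n) - x)\<^sup>2))"
      by (simp add: sum_distrib_left mult.commute)
    also have "\<dots> \<le> S" unfolding S_def by (intro mult_left_mono sum_log_lorentz_le) auto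
    finally show "(\<Sum>n<N. real n powr (-\<sigma>) * fejer 1 (ln (real n) - x)) \<le> S" .
  qed (use that in auto)
  \<comment> \<open>A Chebyshev-type bound: the means of a for T = 1 are bounded uniformly in x and
    \<sigma>, because those of the constant c are and because \<open>G\<close> is bounded on a
    compact set.\<close>
  define C where "C = c * S + B"
  have C: "C > 0" unfolding C_def S_def using c B(1) by (intro add_nonneg_pos) auto
  have SA_le: "SA 1 \<sigma> x \<le> C" if "1 < \<sigma>" "\<sigma> \<le> 2" for \<sigma> x
  proof -
    have "c * S1 1 \<sigma> x \<le> c * S" using S1_le[OF that(1)] c by (intro mult_left_mono) auto
    then show ?thesis using key[of 1 \<sigma> x] B(2)[OF that, of x] that unfolding C_def by linarith
  qed
  define \<delta> where "\<delta> = 4 / 3 * (1 - cos (1/2) :: real)"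
  have \<delta>: "\<delta> > 0"
  proof -
    have "cos (1/2) < cos (0::real)" using pi_gt3 by (intro cos_monotone_0_pi) auto
    then show ?thesis by (simp add: \<delta>_def)
  qed
  \<comment> \<open>For \<bar>u\<bar> > \<eta> one has 1 / u^2 \<le> (1 + 1/\<eta>^2) / (1 + u^2),
    and \<delta> / (1 + u^2) is dominated by two shifted kernels for T = 1. So the tail of the
    kernel for T is at most E / T times quantities whose means are bounded by C.\<close>
  define E where "E = 4 * (1 + 1 / \<eta>\<^sup>2) / \<delta>"
  have E: "E > 0" using \<eta> \<delta> by (simp add: E_def add_pos_pos)
  have tail: "SA T \<sigma> x \<le> E / T * (2 * C)"
    if "T > 0" "1 < \<sigma>" "\<sigma> \<le> 2" and gap: "\<And>n. \<bar>ln (real n) - x\<bar> \<le> \<eta> \<Longrightarrow> a n = 0" for T \<sigma> x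
  proof -
    have fej: "fejer T u \<le> E / T * (fejer 1 u + fejer 1 (u + 1))" if u: "\<bar>u\<bar> > \<eta>" for u
    proof -
      have u0: "u \<noteq> 0" using u \<eta> by auto
      have "\<eta>\<^sup>2 \<le> u\<^sup>2" using u \<eta> by (metis abs_le_square_iff abs_of_pos less_imp_le)
      then have "1 / u\<^sup>2 \<le> 1 / \<eta>\<^sup>2" using \<eta> u0 by (intro divide_left_mono) auto
      then have "(1 + u\<^sup>2) / u\<^sup>2 \<le> 1 + 1 / \<eta>\<^sup>2" using u0 by (simp add: add_divide_distrib)
      then have A: "1 / u\<^sup>2 \<le> (1 + 1 / \<eta>\<^sup>2) / (1 + u\<^sup>2)"
        using u0 by (simp add: pos_le_divide_eq add_pos_nonneg)
      have "fejer T u \<le> 4 / T * (1 / u\<^sup>2)" using fejer_le_inverse_square[OF \<open>T > 0\<close> u0] by simp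
      also have "\<dots> \<le> 4 / T * ((1 + 1 / \<eta>\<^sup>2) / (1 + u\<^sup>2))" using A \<open>T > 0\<close> by (intro mult_left_mono) auto
      also have "\<dots> = E / T * (\<delta> / (1 + u\<^sup>2))" using \<delta> by (simp add: E_def)
      also have "\<dots> \<le> E / T * (fejer 1 u + fejer 1 (u + 1))"
        using fejer_one_shift_ge[of u] E \<open>T > 0\<close> unfolding \<delta>_def by (intro mult_left_mono) auto
      finally show ?thesis .
    qed
    have "SA T \<sigma> x \<le> suminf (\<lambda>n. E / T * (a n * real n powr (-\<sigma>) * fejer 1 (ln (real n) - x) + a n * real n powr (-\<sigma>) * fejer 1 (ln (real n) - (x - 1))))"
      unfolding SA_def
    proof (rule suminf_le)
      fix n
      show "a n * real n powr (-\<sigma>) * fejer T (ln (real n) - x) \<le> E / T * (a n * real n powr (-\<sigma>) * fejer 1 (ln (real n) - x) + a n * real n powr (-\<sigma>) * fejer 1 (ln (real n) - (x - 1)))"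
      proof (cases "\<bar>ln (real n) - x\<bar> \<le> \<eta>")
        case False
        have "a n * real n powr (-\<sigma>) * fejer T (ln (real n) - x) \<le> a n * real n powr (-\<sigma>) * (E / T * (fejer 1 (ln (real n) - x) + fejer 1 (ln (real n) - x + 1)))"
          using False a0[of n] by (intro mult_left_mono fej) auto
        then show ?thesis by (simp add: algebra_simps)
      qed (use gap in auto)
    qed (use that in \<open>auto intro!: summable_mult summable_add sumFa\<close>)
    also have "\<dots> = E / T * (SA 1 \<sigma> x + SA 1 \<sigma> (x - 1))"
      unfolding SA_def using that
      by (subst suminf_mult suminf_add[symmetric]; (intro summable_add sumFa)?; simp?)+
    also have "\<dots> \<le> E / T * (2 * C)"
      using SA_le[OF that(2,3), of x] SA_le[OF that(2,3), of "x - 1"] E \<open>T > 0\<close> by (intro mult_left_mono) auto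
    finally show ?thesis .
  qed

  define \<kappa> where "\<kappa> = c * (exp (-3) / 8 :: real)"
  have \<kappa>: "\<kappa> > 0" using c by (simp add: \<kappa>_def)
  \<comment> \<open>This makes the tail at most \<kappa> / 4. The Fourier integral costs less than
    \<kappa> / 4 at \<sigma> = 1 and at most \<kappa> / 4 more in passing to \<sigma> > 1, so the
    total stays below \<kappa>.\<close>
  define T where "T = max 1 (E * (2 * C) * 4 / \<kappa>)"
  have T: "T \<ge> 1" "E / T * (2 * C) \<le> \<kappa> / 4"
  proof -
    show "T \<ge> 1" by (simp add: T_def)
    have "E * (2 * C) * 4 / \<kappa> \<le> T" by (simp add: T_def)
    then show "E / T * (2 * C) \<le> \<kappa> / 4" using \<kappa> \<open>T \<ge> 1\<close> by (simp add: field_simps)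
  qed
  have "eventually (\<lambda>x. \<bar>J T 1 x\<bar> < \<kappa> / 4 \<and> x \<ge> max 1 (ln (2 * T))) at_top"
    using T \<kappa> by (intro eventually_conj RL eventually_ge_at_top) auto
  then show ?thesis
  proof eventually_elim
    case (elim x)
    show ?case
    proof (rule ccontr)
      assume "\<not> (\<exists>n. a n > 0 \<and> \<bar>ln (real n) - x\<bar> \<le> \<eta>)"
      then have gap: "a n = 0" if "\<bar>ln (real n) - x\<bar> \<le> \<eta>" for n
        using a0[of n] that by (metis less_eq_real_def)
      obtain d where d: "d > 0" "\<And>\<sigma> x. 1 < \<sigma> \<Longrightarrow> \<sigma> < 1 + d \<Longrightarrow> \<bar>J T \<sigma> x - J T 1 x\<bar> \<le> \<kappa> / 4"
        using close[of T "\<kappa> / 4"] T \<kappa> by auto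
      \<comment> \<open>The term 1 / x keeps (\<sigma> - 1) x \<le> 1, as
        \<open>fejer_nat_sum_ge\<close> demands; d / 2 keeps the Fourier integral close to its value
        at \<sigma> = 1.\<close>
      define \<sigma> where "\<sigma> = 1 + min (d / 2) (1 / x)"
      have x: "x \<ge> 1" "2 * T \<le> exp x" using elim T(1) by (auto simp: ln_ge_iff) (metis T(1) exp_le_cancel_iff exp_ln less_le_trans mult_pos_pos zero_less_numeral zero_less_one)
      have \<sigma>: "1 < \<sigma>" "\<sigma> < 1 + d" "\<sigma> \<le> 2" "(\<sigma> - 1) * x \<le> 1"
      proof -
        show "1 < \<sigma>" "\<sigma> < 1 + d" using d(1) x by (auto simp: \<sigma>_def)
        have "1 / x \<le> 1" using x by simp
        then show "\<sigma> \<le> 2" by (simp add: \<sigma>_def min_le_iff_disj)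
        have "(\<sigma> - 1) * x \<le> 1 / x * x" using x by (intro mult_right_mono) (auto simp: \<sigma>_def)
        then show "(\<sigma> - 1) * x \<le> 1" using x by simp
      qed
      have "S1 T \<sigma> x \<ge> exp (-3) / 8"
        unfolding S1_def using T x \<sigma> by (intro fejer_nat_sum_ge sumF1) auto
      then have "\<kappa> \<le> c * S1 T \<sigma> x" unfolding \<kappa>_def using c by (intro mult_left_mono) auto
      also have "\<dots> = SA T \<sigma> x - J T \<sigma> x" using key[of T \<sigma> x] T \<sigma> by simp
      also have "SA T \<sigma> x \<le> \<kappa> / 4" using tail[of T \<sigma> x] gap T \<sigma> by fastforce
      finally have "\<kappa> \<le> \<kappa> / 4 - J T \<sigma> x" by simp
      with d(2)[of \<sigma> x] \<sigma> elim \<kappa> show False by linarith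
    qed
  qed
qed

section \<open>Dirichlet series of real characters\<close>

text \<open>Pairs (m, n) with product k correspond to divisors m of k. The regrouping serves both
  the product of Dirichlet series and the expansion of a Lambert series.\<close>

lemma has_sum_group_divisors:
  fixes F :: "nat \<Rightarrow> nat \<Rightarrow> 'a :: banach"
  assumes "((\<lambda>(m, n). F m n) has_sum S) ({0<..} \<times> {0<..})"
  shows "((\<lambda>k. \<Sum>d | d dvd k. F d (k div d)) has_sum S) {0<..}"
proof -
  have "((\<lambda>(k, d). F d (k div d)) has_sum S) (Sigma {0<..} (\<lambda>k. {d. d dvd k}))
      \<longleftrightarrow> ((\<lambda>(m, n). F m n) has_sum S) ({0<..} \<times> {0<..})"
    by (rule has_sum_reindex_bij_witness[of _ "\<lambda>(m, n). (m * n, m)" "\<lambda>(k, d). (d, k div d)"])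
       (auto simp: dvd_pos_nat elim!: dvdE)
  then have "((\<lambda>(k, d). F d (k div d)) has_sum S) (Sigma {0<..} (\<lambda>k. {d. d dvd k}))"
    using assms by simp
  then show ?thesis
    by (rule has_sum_SigmaD) (auto intro!: has_sum_finite)
qed

lemma has_sum_prod_mult:
  fixes u :: "'b \<Rightarrow> 'a :: {real_normed_field, banach, second_countable_topology}" and v :: "'c \<Rightarrow> 'a"
  assumes "(\<lambda>m. norm (u m)) summable_on A" "(\<lambda>n. norm (v n)) summable_on B" "(u has_sum U) A" "(v has_sum V) B"
  shows "((\<lambda>(m, n). u m * v n) has_sum (U * V)) (A \<times> B)"
proof (rule has_sum_SigmaI)
  show "((\<lambda>y. case (x, y) of (m, n) \<Rightarrow> u m * v n) has_sum (u x * V)) B" for x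
    by (simp add: has_sum_cmult_right assms)
  show "((\<lambda>x. u x * V) has_sum U * V) A" by (intro has_sum_cmult_left assms)
  have "(\<lambda>x. norm (case x of (m, n) \<Rightarrow> u m * v n)) summable_on A \<times> B"
  proof (rule Infinite_Sum.abs_summable_on_Sigma_iff[THEN iffD2], intro conjI ballI)
    show "(\<lambda>n. norm (case (m, n) of (m, n) \<Rightarrow> u m * v n)) summable_on B" for m
      using assms(2) by (auto simp: norm_mult intro!: summable_on_cmult_right)
    have "(\<lambda>m. norm (u m) * infsum (\<lambda>n. norm (v n)) B) summable_on A"
      using assms(1) by (rule summable_on_cmult_left)
    moreover have "infsum (\<lambda>n. norm (case (m, n) of (m, n) \<Rightarrow> u m * v n)) B = norm (u m) * infsum (\<lambda>n. norm (v n)) B" for m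
      using assms(2) by (simp add: norm_mult infsum_cmult_right)
    ultimately show "(\<lambda>m. norm (infsum (\<lambda>n. norm (case (m, n) of (m, n) \<Rightarrow> u m * v n)) B)) summable_on A"
      by (simp add: infsum_nonneg abs_mult)
  qed
  then show "(\<lambda>(m, n). u m * v n) summable_on A \<times> B" by (rule Infinite_Sum.abs_summable_summable)
qed

definition dirichlet_abs_conv :: "(nat \<Rightarrow> real) \<Rightarrow> bool" where
  "dirichlet_abs_conv a \<longleftrightarrow> (\<forall>\<sigma>>1. summable (\<lambda>n. \<bar>a n\<bar> * real n powr (-\<sigma>)))"

lemma dirichlet_abs_convI:
  assumes "\<And>n. n > 0 \<Longrightarrow> \<bar>a n\<bar> \<le> C * (1 + ln (real n))"
  shows "dirichlet_abs_conv a"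
  unfolding dirichlet_abs_conv_def
proof (intro allI impI)
  fix \<sigma> :: real assume \<sigma>: "\<sigma> > 1"
  \<comment> \<open>Half of the excess \<sigma> - 1 absorbs the logarithm, the other half leaves a
    convergent series.\<close>
  define e where "e = (\<sigma> - 1) / 2"
  have e: "e > 0" using \<sigma> by (simp add: e_def)
  have C: "C \<ge> 0" using assms[of 1] by simp
  show "summable (\<lambda>n. \<bar>a n\<bar> * real n powr (-\<sigma>))"
  proof (rule summable_comparison_test'[where N = 1])
    show "summable (\<lambda>n. C * (1 + 1 / e) * real n powr (-(1 + e)))"
      using e by (intro summable_mult) (simp add: summable_real_powr_iff)
    fix n :: nat assume n: "n \<ge> 1"
    have "ln (real n) \<le> real n powr e / e" using n e by (intro ln_powr_bound) auto
    moreover have "1 \<le> real n powr e" using n e by (simp add: ge_one_powr_ge_zero)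
    ultimately have "1 + ln (real n) \<le> (1 + 1 / e) * real n powr e" by (simp add: algebra_simps)
    then have "\<bar>a n\<bar> * real n powr (-\<sigma>) \<le> C * ((1 + 1 / e) * real n powr e) * real n powr (-\<sigma>)"
      using assms[of n] n C by (intro mult_right_mono) (auto intro: order_trans mult_left_mono)
    also have "\<dots> = C * (1 + 1 / e) * real n powr (e + -\<sigma>)"
      using n by (subst powr_add) simp
    also have "e + -\<sigma> = -(1 + e)" by (simp add: e_def field_simps)
    finally show "norm (\<bar>a n\<bar> * real n powr (-\<sigma>)) \<le> C * (1 + 1 / e) * real n powr (-(1 + e))" by simp
  qed
qed

lemma dirichlet_series_sums:
  assumes "dirichlet_abs_conv a" "Re s > 1"
  shows "(\<lambda>n. of_real (a n) * of_nat n powr (-s)) sums dirichlet_series a s"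
  unfolding dirichlet_series_def
  using assms by (intro summable_sums summable_dirichlet_series[of a "Re s"]) (auto simp: dirichlet_abs_conv_def)

lemma dirichlet_series_abs_summable:
  assumes "dirichlet_abs_conv a" "Re s > 1"
  shows "summable (\<lambda>n. norm (of_real (a n) * of_nat n powr (-s) :: complex))"
  using assms by (intro summable_dirichlet_series[of a "Re s"]) (auto simp: dirichlet_abs_conv_def)

lemma has_field_derivative_nat_powr_minus:
  fixes s :: complex
  shows "((\<lambda>s. of_nat n powr (-s)) has_field_derivative - (of_real (ln (real n)) * of_nat n powr (-s))) (at s)"
proof (cases "n = 0")
  case False
  have "((\<lambda>s. exp (- s * of_real (ln (real n)))) has_field_derivative - (of_real (ln (real n)) * exp (- s * of_real (ln (real n))))) (at s)"
    by (auto intro!: derivative_eq_intros)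
  with False show ?thesis by (simp add: powr_def Ln_of_nat)
qed simp

lemma dirichlet_series_has_field_derivative:
  assumes "dirichlet_abs_conv a" "Re s > 1"
  shows "(dirichlet_series a has_field_derivative - dirichlet_series (\<lambda>n. a n * ln (real n)) s) (at s)"
proof -
  define S where "S = {s. Re s > 1}"
  have S: "open S" unfolding S_def by (rule open_halfspace_Re_gt)
  have "\<exists>g g'. \<forall>s\<in>S. ((\<lambda>n. of_real (a n) * of_nat n powr (-s)) sums g s)
      \<and> ((\<lambda>n. of_real (a n) * - (of_real (ln (real n)) * of_nat n powr (-s))) sums g' s)
      \<and> (g has_field_derivative g' s) (at s)"
  proof (rule series_and_derivative_comparison_local[OF S])
    fix n :: nat and s :: complex
    show "((\<lambda>s. of_real (a n) * of_nat n powr (-s)) has_field_derivative of_real (a n) * - (of_real (ln (real n)) * of_nat n powr (-s))) (at s)"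
      by (intro DERIV_cmult has_field_derivative_nat_powr_minus)
  next
    fix s assume s: "s \<in> S"
    define d where "d = (Re s - 1) / 2"
    have d: "d > 0" using s by (simp add: d_def S_def)
    have "norm (of_real (a n) * of_nat n powr (-y) :: complex) \<le> \<bar>a n\<bar> * real n powr (-(1 + d))" if "y \<in> ball s d" for y n
    proof -
      have "\<bar>Re s - Re y\<bar> < d" using that abs_Re_le_cmod[of "s - y"] by (simp add: dist_norm)
      then have "Re y \<ge> 1 + d" by (simp add: d_def field_simps abs_if split: if_splits)
      then show ?thesis
        by (cases "n = 0") (auto simp: norm_mult norm_nat_powr intro!: mult_left_mono powr_mono)
    qed
    moreover have "summable (\<lambda>n. \<bar>a n\<bar> * real n powr (-(1 + d)))"
      using d assms(1) unfolding dirichlet_abs_conv_def by (metis less_add_same_cancel1)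
    ultimately show "\<exists>d h. 0 < d \<and> summable h \<and> (\<forall>\<^sub>F n in sequentially. \<forall>y\<in>ball s d \<inter> S. norm (of_real (a n) * of_nat n powr (-y) :: complex) \<le> h n)"
      using d by (intro exI[of _ d] exI[of _ "\<lambda>n. \<bar>a n\<bar> * real n powr (-(1 + d))"]) auto
  qed
  then obtain g g' where g: "\<And>s. s \<in> S \<Longrightarrow> (\<lambda>n. of_real (a n) * of_nat n powr (-s)) sums g s"
      "\<And>s. s \<in> S \<Longrightarrow> (\<lambda>n. of_real (a n) * - (of_real (ln (real n)) * of_nat n powr (-s))) sums g' s"
      "\<And>s. s \<in> S \<Longrightarrow> (g has_field_derivative g' s) (at s)" by blast
  have s: "s \<in> S" using assms by (simp add: S_def)
  have "g' s = - dirichlet_series (\<lambda>n. a n * ln (real n)) s"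
    using sums_minus[OF g(2)[OF s]] by (simp add: dirichlet_series_def sums_iff mult.assoc)
  moreover have "(dirichlet_series a has_field_derivative g' s) (at s)"
    by (rule has_field_derivative_transform_within_open[OF g(3)[OF s] S s])
       (use g(1) in \<open>auto simp: dirichlet_series_def sums_iff\<close>)
  ultimately show ?thesis by simp
qed

lemma dirichlet_series_mult:
  assumes a: "dirichlet_abs_conv a" and b: "dirichlet_abs_conv b" and s: "Re s > 1"
  shows "dirichlet_series a s * dirichlet_series b s = dirichlet_series (\<lambda>n. \<Sum>d | d dvd n. a d * b (n div d)) s"
proof -
  define u where "u = (\<lambda>a n. of_real (a n) * of_nat n powr (-s) :: complex)"
  have hs: "(u a has_sum dirichlet_series a s) {0<..} \<and> (\<lambda>n. norm (u a n)) summable_on {0<..}" if "dirichlet_abs_conv a" for a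
  proof
    have "(u a has_sum dirichlet_series a s) UNIV"
      unfolding u_def using dirichlet_series_abs_summable[OF that s] dirichlet_series_sums[OF that s]
      by (rule norm_summable_imp_has_sum)
    also have "?this \<longleftrightarrow> (u a has_sum dirichlet_series a s) {0<..}"
      by (rule has_sum_cong_neutral) (auto simp: u_def)
    finally show "(u a has_sum dirichlet_series a s) {0<..}" .
    have "(\<lambda>n. norm (u a n)) summable_on UNIV"
      unfolding u_def using dirichlet_series_abs_summable[OF that s] by (subst summable_on_UNIV_nonneg_real_iff) auto
    then show "(\<lambda>n. norm (u a n)) summable_on {0<..}" by (rule summable_on_subset) auto
  qed
  have "((\<lambda>(m, n). u a m * u b n) has_sum (dirichlet_series a s * dirichlet_series b s)) ({0<..} \<times> {0<..})"
    using hs[OF a] hs[OF b] by (intro has_sum_prod_mult) auto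
  then have "((\<lambda>k. \<Sum>d | d dvd k. u a d * u b (k div d)) has_sum (dirichlet_series a s * dirichlet_series b s)) {0<..}"
    by (rule has_sum_group_divisors)
  also have "?this \<longleftrightarrow> (u (\<lambda>n. \<Sum>d | d dvd n. a d * b (n div d)) has_sum (dirichlet_series a s * dirichlet_series b s)) UNIV"
  proof (rule has_sum_cong_neutral)
    fix k :: nat assume k: "k \<in> {0<..} \<inter> UNIV"
    have "u a d * u b (k div d) = of_real (a d * b (k div d)) * of_nat k powr (-s)" if "d dvd k" for d
    proof -
      obtain e where e: "k = d * e" using \<open>d dvd k\<close> by (elim dvdE)
      with k have de: "d > 0" "e > 0" by auto
      have Ln_de: "Ln (of_nat (d * e)) = of_real (ln (real d)) + of_real (ln (real e))"
        using de by (subst Ln_of_nat) (auto simp: ln_mult)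
      then have "of_nat d powr (-s) * of_nat e powr (-s) = (of_nat (d * e) powr (-s) :: complex)"
        by (simp add: powr_def Ln_of_nat Ln_de ring_distribs exp_diff exp_minus field_simps del: of_nat_mult)
      with e de show ?thesis by (simp add: u_def mult_ac)
    qed
    then have "(\<Sum>d | d dvd k. u a d * u b (k div d)) = (\<Sum>d | d dvd k. of_real (a d * b (k div d)) * of_nat k powr (-s))"
      by (intro sum.cong) auto
    then show "(\<Sum>d | d dvd k. u a d * u b (k div d)) = u (\<lambda>n. \<Sum>d | d dvd n. a d * b (n div d)) k"
      by (simp add: u_def sum_distrib_right)
  qed (auto simp: u_def)
  finally have "u (\<lambda>n. \<Sum>d | d dvd n. a d * b (n div d)) sums (dirichlet_series a s * dirichlet_series b s)"
    by (rule has_sum_imp_sums)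
  then show ?thesis by (simp add: dirichlet_series_def u_def sums_iff)
qed

section \<open>Real characters and the logarithms of their L-series\<close>

lemma mangoldt_le_ln:
  assumes "n > 0"
  shows "mangoldt n \<le> ln (real n)"
proof -
  have "mangoldt n \<le> (\<Sum>d | d dvd n. mangoldt d :: real)"
    using assms by (intro member_le_sum) (auto simp: mangoldt_nonneg)
  then show ?thesis using mangoldt_sum[of n, where ?'a = real] assms by simp
qed

text \<open>These are the real Dirichlet characters modulo M, the principal one included and
  imprimitive ones allowed, so that products of characters with a common modulus stay in the class.
  M > 1 keeps 0 from being coprime to M, hence f 0 = 0.\<close>

definition real_char :: "nat \<Rightarrow> (nat \<Rightarrow> real) \<Rightarrow> bool" where
  "real_char M f \<longleftrightarrow> M > 1 \<and> (\<forall>m n. f (m * n) = f m * f n) \<and> (\<forall>n. f (n + M) = f n) \<and>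
     (\<forall>n. coprime n M \<longrightarrow> f n = 1 \<or> f n = -1) \<and> (\<forall>n. \<not> coprime n M \<longrightarrow> f n = 0)"

lemma real_char_cases:
  assumes "real_char M f"
  shows "f n = 1 \<or> f n = -1 \<or> f n = 0"
  using assms unfolding real_char_def by blast

lemma real_char_abs_le: "real_char M f \<Longrightarrow> \<bar>f n\<bar> \<le> 1"
  using real_char_cases[of M f n] by auto

lemma real_char_0: "real_char M f \<Longrightarrow> f 0 = 0"
  unfolding real_char_def by (metis coprime_0_left_iff less_irrefl nat_dvd_1_iff_1)

lemma real_char_1: "real_char M f \<Longrightarrow> f 1 = 1"
  unfolding real_char_def by (metis coprime_1_left mult_1 mult_cancel_right2 zero_neq_neg_one)

lemma real_char_mult: "real_char M f \<Longrightarrow> f (m * n) = f m * f n"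
  unfolding real_char_def by blast

lemma real_char_times:
  assumes "real_char M f" "real_char M g"
  shows "real_char M (\<lambda>n. f n * g n)"
  unfolding real_char_def
proof (intro conjI allI impI)
  fix n
  show "f n * g n = 1 \<or> f n * g n = -1" if "coprime n M"
  proof -
    have "f n = 1 \<or> f n = -1" "g n = 1 \<or> g n = -1"
      using assms that unfolding real_char_def by blast+
    then show ?thesis by auto
  qed
qed (use assms in \<open>auto simp: real_char_def\<close>)

lemma real_char_abs_conv:
  assumes "real_char M f"
  shows "dirichlet_abs_conv f" "dirichlet_abs_conv (\<lambda>n. f n * mangoldt n)"
    and "dirichlet_abs_conv (\<lambda>n. f n * mangoldt n / ln (real n))"
proof -
  have f: "\<bar>f n\<bar> \<le> 1" for n by (rule real_char_abs_le[OF assms])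
  show "dirichlet_abs_conv f"
  proof (rule dirichlet_abs_convI[of _ 1])
    fix n :: nat assume "n > 0"
    then show "\<bar>f n\<bar> \<le> 1 * (1 + ln (real n))" by (intro order_trans[OF f]) simp
  qed
  have *: "\<bar>f n\<bar> * mangoldt n \<le> 1 * ln (real n)" if "n > 0" for n
    using f mangoldt_le_ln[OF that] by (intro mult_mono) (auto simp: mangoldt_nonneg)
  show "dirichlet_abs_conv (\<lambda>n. f n * mangoldt n)"
  proof (rule dirichlet_abs_convI[of _ 1])
    fix n :: nat assume "n > 0"
    then show "\<bar>f n * mangoldt n\<bar> \<le> 1 * (1 + ln (real n))" using *[of n] by (simp add: abs_mult)
  qed
  show "dirichlet_abs_conv (\<lambda>n. f n * mangoldt n / ln (real n))"
  proof (rule dirichlet_abs_convI[of _ 1])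
    fix n :: nat assume n: "n > 0"
    show "\<bar>f n * mangoldt n / ln (real n)\<bar> \<le> 1 * (1 + ln (real n))"
    proof (cases "n = 1")
      case False
      then have "ln (real n) > 0" using n by simp
      then have "\<bar>f n * mangoldt n / ln (real n)\<bar> \<le> 1"
        using *[OF n] by (simp add: abs_mult)
      then show ?thesis by (rule order_trans) (use \<open>ln (real n) > 0\<close> in simp)
    qed simp
  qed
qed

text \<open>Complete multiplicativity pulls f out of the convolution identity \<Sum>
  \<open>mangoldt\<close> d = ln n over the divisors d of n. The result is -L' / L without the
  quotient, so nothing has to be known about zeros yet.\<close>

lemma real_char_log_deriv:
  assumes "real_char M f" "Re s > 1"
  shows "dirichlet_series (\<lambda>n. f n * ln (real n)) s = dirichlet_series (\<lambda>n. f n * mangoldt n) s * dirichlet_series f s"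
proof -
  have "(\<Sum>d | d dvd n. f d * mangoldt d * f (n div d)) = f n * ln (real n)" for n
  proof (cases "n = 0")
    case False
    have "(\<Sum>d | d dvd n. f d * mangoldt d * f (n div d)) = (\<Sum>d | d dvd n. f n * mangoldt d)"
    proof (rule sum.cong)
      fix d assume "d \<in> {d. d dvd n}"
      then have "f d * f (n div d) = f n" using real_char_mult[OF assms(1), of d "n div d"] by simp
      then show "f d * mangoldt d * f (n div d) = f n * mangoldt d" by (simp add: mult_ac)
    qed simp
    also have "\<dots> = f n * ln (real n)"
      using mangoldt_sum[of n, where ?'a = real] False by (simp flip: sum_distrib_left)
    finally show ?thesis .
  qed simp
  then show ?thesis
    using dirichlet_series_mult[OF real_char_abs_conv(2,1)[OF assms(1)] assms(2)] assms(1) by simp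
qed

text \<open>One point of nonvanishing is enough to start from, and at 3 the tail beyond the leading
  term 1 is at most 1/2, by comparison with a telescoping series.\<close>

lemma real_char_series_3_nz:
  assumes "real_char M f"
  shows "dirichlet_series f 3 \<noteq> 0"
proof -
  let ?u = "\<lambda>n. of_real (f n) * of_nat n powr (-3) :: complex"
  have "?u sums dirichlet_series f 3"
    by (rule dirichlet_series_sums) (use assms real_char_abs_conv in auto)
  then have "(\<lambda>n. ?u (n + 2)) sums (dirichlet_series f 3 - (\<Sum>n<2. ?u n))"
    by (rule sums_split_initial_segment)
  moreover have "(\<Sum>n<2. ?u n) = 1"
    using real_char_1[OF assms] by (simp add: numeral_2_eq_2)
  ultimately have S: "(\<lambda>n. ?u (n + 2)) sums (dirichlet_series f 3 - 1)" by simp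
  have T: "(\<lambda>n. 1/2 * (1 / real (n + 1) - 1 / real (n + 2))) sums (1/2 * (1 - 0))"
  proof (rule sums_mult)
    have "(\<lambda>n. 1 / real (n + 1)) \<longlonglongrightarrow> 0" by real_asymp
    from telescope_sums'[OF this] show "(\<lambda>n. 1 / real (n + 1) - 1 / real (n + 2)) sums (1 - 0)" by simp
  qed
  have "norm (?u (n + 2)) \<le> 1/2 * (1 / real (n + 1) - 1 / real (n + 2))" for n
  proof -
    have "norm (?u (n + 2)) \<le> 1 * real (n + 2) powr (-3)"
      unfolding norm_mult norm_nat_powr using real_char_abs_le[OF assms] by (intro mult_mono) auto
    also have "\<dots> = 1 / (real n + 2) ^ 3" by (simp add: powr_minus powr_numeral field_simps)
    also have "\<dots> \<le> 1 / (2 * ((real n + 1) * (real n + 2)))"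
    proof (rule divide_left_mono)
      have "2 * ((real n + 1) * (real n + 2)) \<le> (real n + 2) * ((real n + 2) * (real n + 2))"
        by (simp add: algebra_simps)
      then show "2 * ((real n + 1) * (real n + 2)) \<le> (real n + 2) ^ 3" by (simp add: power3_eq_cube mult_ac)
    qed auto
    also have "\<dots> = 1/2 * (1 / real (n + 1) - 1 / real (n + 2))" by (simp add: field_simps)
    finally show ?thesis .
  qed
  then have "norm (suminf (\<lambda>n. ?u (n + 2))) \<le> suminf (\<lambda>n. 1/2 * (1 / real (n + 1) - 1 / real (n + 2)))"
    by (intro norm_suminf_le sums_summable[OF T])
  then have "norm (dirichlet_series f 3 - 1) \<le> 1 / 2"
    unfolding sums_unique[OF S, symmetric] sums_unique[OF T, symmetric] by simp
  then show ?thesis by auto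
qed

text \<open>This takes the place of the Euler product: L exp (-P) has derivative 0 on the half plane
  Re s > 1, so it is a constant C, and the point 3 shows C \<noteq> 0. The value of C is immaterial
  for nonvanishing and for lower bounds.\<close>

lemma real_char_series_exp:
  assumes "real_char M f"
  obtains C where "C \<noteq> 0"
    and "\<And>s. Re s > 1 \<Longrightarrow> dirichlet_series f s = C * exp (dirichlet_series (\<lambda>n. f n * mangoldt n / ln (real n)) s)"
proof -
  define S where "S = {s. Re s > 1}"
  define P where "P = dirichlet_series (\<lambda>n. f n * mangoldt n / ln (real n))"
  have Pd: "(P has_field_derivative - dirichlet_series (\<lambda>n. f n * mangoldt n) s) (at s)" if "s \<in> S" for s
  proof -
    \<comment> \<open>For n \<le> 1 both sides are 0, since \<open>mangoldt\<close> vanishes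
      there.\<close>
    have "f n * mangoldt n / ln (real n) * ln (real n) = f n * mangoldt n" for n
      by (cases "n \<le> 1") (auto simp: le_Suc_eq)
    then show ?thesis
      using dirichlet_series_has_field_derivative[OF real_char_abs_conv(3)[OF assms], of s] that
      by (simp add: P_def S_def)
  qed
  have Fd: "(dirichlet_series f has_field_derivative - (dirichlet_series (\<lambda>n. f n * mangoldt n) s * dirichlet_series f s)) (at s)" if "s \<in> S" for s
    using dirichlet_series_has_field_derivative[OF real_char_abs_conv(1)[OF assms], of s] that
      real_char_log_deriv[OF assms, of s] by (simp add: S_def)
  have "\<exists>C. \<forall>s\<in>S. dirichlet_series f s * exp (- P s) = C"
  proof (rule has_field_derivative_zero_constant)
    show "convex S" unfolding S_def by (rule convex_halfspace_Re_gt)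
    fix s assume s: "s \<in> S"
    have "((\<lambda>s. dirichlet_series f s * exp (- P s)) has_field_derivative 0) (at s)"
      by (auto intro!: derivative_eq_intros Pd Fd s)
    then show "((\<lambda>s. dirichlet_series f s * exp (- P s)) has_field_derivative 0) (at s within S)"
      by (rule has_field_derivative_at_within)
  qed
  then obtain C where C: "\<And>s. s \<in> S \<Longrightarrow> dirichlet_series f s * exp (- P s) = C" by blast
  show ?thesis
  proof (rule that[of C])
    show "C \<noteq> 0" using C[of 3] real_char_series_3_nz[OF assms] by (auto simp: S_def)
    show "dirichlet_series f s = C * exp (dirichlet_series (\<lambda>n. f n * mangoldt n / ln (real n)) s)" if "Re s > 1" for s
      using C[of s] that by (auto simp: S_def P_def exp_minus field_simps)
  qed
qed

lemma Re_dirichlet_series_sums: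
  assumes "dirichlet_abs_conv a" "\<sigma> > 1"
  shows "(\<lambda>n. a n * real n powr (-\<sigma>) * cos (t * ln (real n))) sums Re (dirichlet_series a (Complex \<sigma> t))"
proof -
  have "(\<lambda>n. Re (of_real (a n) * (of_nat n powr (- Complex \<sigma> t) * cis (t * 0)))) sums Re (dirichlet_series a (Complex \<sigma> t))"
    using dirichlet_series_sums[OF assms(1), of "Complex \<sigma> t"] assms(2) by (intro sums_Re) simp
  then show ?thesis by (simp only: Re_complex_of_real_mult Re_nat_powr_cis mult.assoc diff_zero)
qed

text \<open>The inequality \<open>3 + 4 cos \<theta> + cos 2\<theta> \<ge> 0\<close> of Mertens.\<close>

lemma real_char_341:
  assumes f: "real_char M f"
  obtains K where "K > 0" and "\<And>\<sigma> t. \<sigma> > 1 \<Longrightarrow>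
     norm (dirichlet_series (\<lambda>n. f n * f n) (Complex \<sigma> 0)) ^ 3 * norm (dirichlet_series f (Complex \<sigma> t)) ^ 4 *
     norm (dirichlet_series (\<lambda>n. f n * f n) (Complex \<sigma> (2 * t))) \<ge> K"
proof -
  define g where "g = (\<lambda>n. f n * f n)"
  have g: "real_char M g" unfolding g_def by (rule real_char_times[OF f f])
  define Pf where "Pf = (\<lambda>n. f n * mangoldt n / ln (real n))"
  define Pg where "Pg = (\<lambda>n. g n * mangoldt n / ln (real n))"
  obtain C where C: "C \<noteq> 0" "\<And>s. Re s > 1 \<Longrightarrow> dirichlet_series f s = C * exp (dirichlet_series Pf s)"
    using real_char_series_exp[OF f] unfolding Pf_def by blast
  obtain D where D: "D \<noteq> 0" "\<And>s. Re s > 1 \<Longrightarrow> dirichlet_series g s = D * exp (dirichlet_series Pg s)"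
    using real_char_series_exp[OF g] unfolding Pg_def by blast
  have "norm D ^ 3 * norm C ^ 4 * norm D \<le> norm (dirichlet_series g (Complex \<sigma> 0)) ^ 3 * norm (dirichlet_series f (Complex \<sigma> t)) ^ 4 *
     norm (dirichlet_series g (Complex \<sigma> (2 * t)))" if \<sigma>: "\<sigma> > 1" for \<sigma> t
  proof -
    define E where "E = 3 * Re (dirichlet_series Pg (Complex \<sigma> 0)) + 4 * Re (dirichlet_series Pf (Complex \<sigma> t)) + Re (dirichlet_series Pg (Complex \<sigma> (2 * t)))"
    have "(\<lambda>n. 3 * (Pg n * real n powr (-\<sigma>) * cos (0 * ln (real n))) + 4 * (Pf n * real n powr (-\<sigma>) * cos (t * ln (real n)))
         + Pg n * real n powr (-\<sigma>) * cos ((2 * t) * ln (real n))) sums E"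
      unfolding E_def Pf_def Pg_def
      by (intro sums_add sums_mult Re_dirichlet_series_sums real_char_abs_conv(3)[OF f] real_char_abs_conv(3)[OF g] \<sigma>)
    moreover have "3 * (Pg n * real n powr (-\<sigma>) * cos (0 * ln (real n))) + 4 * (Pf n * real n powr (-\<sigma>) * cos (t * ln (real n)))
         + Pg n * real n powr (-\<sigma>) * cos ((2 * t) * ln (real n)) \<ge> 0" for n
    proof -
      define c where "c = cos (t * ln (real n))"
      have ln0: "0 \<le> ln (real n)" by (cases "n = 0") simp_all
      have c2: "cos ((2 * t) * ln (real n)) = 2 * c\<^sup>2 - 1"
        unfolding c_def by (simp add: cos_double_cos[symmetric] mult.assoc)
      have "3 * g n + 4 * f n * c + g n * (2 * c\<^sup>2 - 1) \<ge> 0"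
      proof -
        \<comment> \<open>For f n = 1 or -1 the expression is 2 (f n + c)^2; the inner factor f n
          makes the square vanish together with it when f n = 0.\<close>
        have "0 \<le> 2 * (f n * (f n + c))\<^sup>2" by simp
        also have "2 * (f n * (f n + c))\<^sup>2 = 3 * g n + 4 * f n * c + g n * (2 * c\<^sup>2 - 1)"
          using real_char_cases[OF f, of n] by (auto simp: g_def power2_eq_square algebra_simps)
        finally show ?thesis .
      qed
      moreover define k where "k = mangoldt n / ln (real n)"
      ultimately have "0 \<le> (3 * g n + 4 * f n * c + g n * (2 * c\<^sup>2 - 1)) * (k * real n powr (-\<sigma>))"
        using ln0 by (auto intro!: mult_nonneg_nonneg divide_nonneg_nonneg simp: mangoldt_nonneg)
      moreover have "Pf n = f n * k" "Pg n = g n * k" by (simp_all add: Pf_def Pg_def k_def)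
      ultimately show ?thesis unfolding c2 c_def[symmetric] by (simp add: algebra_simps)
    qed
    ultimately have E: "E \<ge> 0" by (auto simp: sums_iff suminf_nonneg)
    have "norm (dirichlet_series g (Complex \<sigma> 0)) ^ 3 * norm (dirichlet_series f (Complex \<sigma> t)) ^ 4 * norm (dirichlet_series g (Complex \<sigma> (2 * t)))
       = norm D ^ 3 * norm C ^ 4 * norm D * exp E"
      using \<sigma> by (simp add: C(2) D(2) norm_mult E_def exp_add power_mult_distrib exp_of_nat_mult[symmetric])
    also have "\<dots> \<ge> norm D ^ 3 * norm C ^ 4 * norm D * 1"
      using E by (intro mult_left_mono) auto
    finally show ?thesis by simp
  qed
  moreover have "norm D ^ 3 * norm C ^ 4 * norm D > 0" using C D by simp
  ultimately show ?thesis using that unfolding g_def by blast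
qed

section \<open>Continuation of L-series to Re s > 0\<close>

lemma norm_powr_diff_le:
  fixes s :: complex and x y :: real
  assumes x: "0 < x" "x \<le> y" and s: "Re s > -1"
  shows "norm (of_real x powr (-s) - of_real y powr (-s)) \<le> norm s * (y - x) * x powr (- Re s - 1)"
proof -
  have "norm (of_real x powr (-s) - of_real y powr (-s)) \<le> (norm s * x powr (- Re s - 1)) * norm (of_real x - of_real y :: complex)"
  proof (rule field_differentiable_bound[where f = "\<lambda>z. z powr (-s)" and f' = "\<lambda>z. (-s) * z powr (-s - 1)"
        and S = "closed_segment (of_real x) (of_real y)"])
    show "convex (closed_segment (of_real x) (of_real y) :: complex set)" by simp
    fix z :: complex assume "z \<in> closed_segment (of_real x) (of_real y)"
    then obtain u where u: "z = of_real u" "u \<in> {x..y}"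
      using x unfolding closed_segment_of_real closed_segment_eq_real_ivl by auto
    have "z \<notin> \<real>\<^sub>\<le>\<^sub>0" using u x by (auto simp: complex_nonpos_Reals_iff)
    then show "((\<lambda>z. z powr (-s)) has_field_derivative (-s) * z powr (-s - 1)) (at z within closed_segment (of_real x) (of_real y))"
      by (rule has_field_derivative_at_within[OF has_field_derivative_powr])
    have "norm ((-s) * z powr (-s - 1)) = norm s * u powr (- Re s - 1)"
      unfolding norm_mult norm_minus_cancel u(1) using u(2) x by (simp add: powr_def Ln_of_real)
    also have "\<dots> \<le> norm s * x powr (- Re s - 1)"
      using u(2) x s by (intro mult_left_mono powr_mono2') auto
    finally show "norm ((-s) * z powr (-s - 1)) \<le> norm s * x powr (- Re s - 1)" .
  qed auto
  also have "norm (of_real x - of_real y :: complex) = y - x"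
    using x unfolding of_real_diff[symmetric] norm_of_real by simp
  finally show ?thesis by (simp only: mult_ac)
qed

lemma nat_powr_minus_holomorphic: "(\<lambda>s. of_nat n powr (-s)) holomorphic_on A"
  unfolding holomorphic_on_def field_differentiable_def
  by (intro ballI exI) (rule has_field_derivative_at_within[OF has_field_derivative_nat_powr_minus])

text \<open>On a small disc the polynomial factor in s is bounded, so k^(- Re s - 1) alone decides
  and convergence is locally uniform. The exponent 2 is large enough for both continuations built on
  this.\<close>

lemma holomorphic_series_half_plane:
  fixes B :: "nat \<Rightarrow> complex \<Rightarrow> complex"
  assumes hol: "\<And>k. B k holomorphic_on UNIV"
    and bound: "\<And>k s. k \<ge> 1 \<Longrightarrow> Re s > 0 \<Longrightarrow> norm (B k s) \<le> C * (norm s + 1) ^ 2 * real k powr (- Re s - 1)"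
    and C: "C \<ge> 0"
  obtains K where "K holomorphic_on {s. Re s > 0}" "\<And>s. Re s > 0 \<Longrightarrow> (\<lambda>k. B k s) sums K s"
proof -
  define S where "S = {s. Re s > 0}"
  have S: "open S" unfolding S_def by (rule open_halfspace_Re_gt)
  have "\<exists>g g'. \<forall>s\<in>S. ((\<lambda>k. B k s) sums g s) \<and> ((\<lambda>k. deriv (B k) s) sums g' s) \<and> (g has_field_derivative g' s) (at s)"
  proof (rule series_and_derivative_comparison_local[OF S])
    show "(B k has_field_derivative deriv (B k) s) (at s)" for k s
      using hol[of k] by (intro holomorphic_derivI[where S = UNIV]) auto
    fix s assume s: "s \<in> S"
    define d where "d = Re s / 2"
    have d: "d > 0" using s by (simp add: d_def S_def)
    have "norm (B k y) \<le> C * (norm s + d + 1) ^ 2 * real k powr (- d - 1)" if y: "y \<in> ball s d" and k: "k \<ge> 1" for y k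
    proof -
      have "\<bar>Re s - Re y\<bar> < d" using y abs_Re_le_cmod[of "s - y"] by (simp add: dist_norm)
      then have Re: "Re y > d" by (simp add: d_def abs_if split: if_splits)
      have "norm y \<le> norm s + d" using y norm_triangle_ineq2[of y s] by (simp add: dist_norm norm_minus_commute)
      then have "(norm y + 1) ^ 2 \<le> (norm s + d + 1) ^ 2" by (intro power_mono) auto
      moreover have "real k powr (- Re y - 1) \<le> real k powr (- d - 1)" using k Re by (intro powr_mono) auto
      ultimately have "C * (norm y + 1) ^ 2 * real k powr (- Re y - 1) \<le> C * (norm s + d + 1) ^ 2 * real k powr (- d - 1)"
        using C by (intro mult_mono mult_nonneg_nonneg) auto
      then show ?thesis using bound[OF k, of y] Re d by linarith
    qed
    then have "\<forall>\<^sub>F k in sequentially. \<forall>y\<in>ball s d \<inter> S. norm (B k y) \<le> C * (norm s + d + 1) ^ 2 * real k powr (- d - 1)"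
      by (intro eventually_sequentiallyI[of 1]) auto
    moreover have "summable (\<lambda>k. C * (norm s + d + 1) ^ 2 * real k powr (- d - 1))"
      using d by (intro summable_mult) (simp add: summable_real_powr_iff)
    ultimately show "\<exists>d h. 0 < d \<and> summable h \<and> (\<forall>\<^sub>F k in sequentially. \<forall>y\<in>ball s d \<inter> S. norm (B k y) \<le> h k)"
      using d by blast
  qed
  then obtain K K' where K: "\<And>s. s \<in> S \<Longrightarrow> (\<lambda>k. B k s) sums K s" "\<And>s. s \<in> S \<Longrightarrow> (K has_field_derivative K' s) (at s)"
    by blast
  show ?thesis
  proof (rule that[of K])
    show "K holomorphic_on {s. Re s > 0}"
      using K(2) S by (auto simp: S_def holomorphic_on_open)
  qed (use K(1) in \<open>auto simp: S_def\<close>)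
qed

lemma periodic_bounded:
  fixes g :: "nat \<Rightarrow> real"
  assumes M: "M > 0" and per: "\<And>n. g (n + M) = g n"
  shows "g (k * M + n) = g n" and "\<bar>g n\<bar> \<le> (\<Sum>j<M. \<bar>g j\<bar>)"
proof -
  show *: "g (k * M + n) = g n" for k n
  proof (induction k)
    case (Suc k)
    have "Suc k * M + n = (k * M + n) + M" by simp
    then show ?case using per Suc by metis
  qed simp
  have "g n = g (n mod M)" using *[of "n div M" "n mod M"] by simp
  then show "\<bar>g n\<bar> \<le> (\<Sum>j<M. \<bar>g j\<bar>)"
    using M by (simp add: member_le_sum[of "n mod M" "{..<M}" "\<lambda>j. \<bar>g j\<bar>"])
qed

text \<open>The terms are grouped into blocks of one period. As g sums to 0 over a block, the power
  at the end of the block can be subtracted from each term, and a difference of powers gains a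
  factor 1/k, which yields convergence down to Re s > 0. The limit is accordingly taken along
  multiples of M.\<close>

lemma mean_zero_continuation:
  fixes g :: "nat \<Rightarrow> real"
  assumes M: "M > 0" and per: "\<And>n. g (n + M) = g n" and zero: "(\<Sum>n<M. g n) = 0"
  obtains K where "K holomorphic_on {s. Re s > 0}"
    and "\<And>s. Re s > 0 \<Longrightarrow> (\<lambda>N. \<Sum>n<N * M. of_real (g n) * of_nat n powr (-s)) \<longlonglongrightarrow> K s"
proof -
  define B where "B = (\<lambda>k s. \<Sum>n\<in>{k * M..<k * M + M}. of_real (g n) * (of_nat n powr (-s) - of_nat (k * M + M) powr (-s)) :: complex)"
  define G where "G = (\<Sum>j<M. \<bar>g j\<bar>)"
  have G: "\<bar>g n\<bar> \<le> G" "G \<ge> 0" for n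
    using periodic_bounded(2)[of M g, OF M per] by (auto simp: G_def sum_nonneg)
  have Bhol: "B k holomorphic_on UNIV" for k
    unfolding B_def by (intro holomorphic_intros nat_powr_minus_holomorphic)
  have Bb: "norm (B k s) \<le> (real M * (G * real M)) * (norm s + 1) ^ 2 * real k powr (- Re s - 1)" if k: "k \<ge> 1" and s: "Re s > 0" for k s
  proof -
    have "norm (B k s) \<le> real (card {k * M..<k * M + M}) * (G * (norm s * real M * real k powr (- Re s - 1)))"
      unfolding B_def
    proof (rule sum_norm_bound)
      fix n assume n: "n \<in> {k * M..<k * M + M}"
      have "k \<le> k * M" using M by simp
      then have "k \<le> n" using n by (meson atLeastLessThan_iff order_trans)
      then have kn: "real k \<le> real n" "n > 0" using k by auto
      have "norm (of_real (real n) powr (-s) - of_real (real (k * M + M)) powr (-s) :: complex) \<le> norm s * (real (k * M + M) - real n) * real n powr (- Re s - 1)"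
        using n kn s by (intro norm_powr_diff_le) (auto simp flip: of_nat_mult of_nat_add)
      also have "\<dots> \<le> norm s * real M * real k powr (- Re s - 1)"
        using n kn k s by (intro mult_mono powr_mono2') (auto simp flip: of_nat_mult of_nat_add)
      finally have "norm (of_nat n powr (-s) - of_nat (k * M + M) powr (-s) :: complex) \<le> norm s * real M * real k powr (- Re s - 1)"
        by (simp only: of_real_of_nat_eq)
      then show "norm (of_real (g n) * (of_nat n powr (-s) - of_nat (k * M + M) powr (-s)) :: complex) \<le> G * (norm s * real M * real k powr (- Re s - 1))"
        unfolding norm_mult using G by (intro mult_mono) auto
    qed
    also have "\<dots> = (real M * (G * real M)) * norm s * real k powr (- Re s - 1)" by simp
    also have "\<dots> \<le> (real M * (G * real M)) * (norm s + 1) ^ 2 * real k powr (- Re s - 1)"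
    proof (intro mult_right_mono mult_left_mono)
      show "norm s \<le> (norm s + 1) ^ 2" by (simp add: power2_eq_square algebra_simps)
    qed (use G in auto)
    finally show ?thesis .
  qed
  obtain K where K: "K holomorphic_on {s. Re s > 0}" "\<And>s. Re s > 0 \<Longrightarrow> (\<lambda>k. B k s) sums K s"
    using holomorphic_series_half_plane[OF Bhol Bb] G(2) by auto
  show ?thesis
  proof (rule that[OF K(1)])
    fix s assume s: "Re s > 0"
    have "(\<Sum>k<N. B k s) = (\<Sum>n<N * M. of_real (g n) * of_nat n powr (-s))" for N
    proof -
      have "B k s = (\<Sum>n\<in>{k * M..<k * M + M}. of_real (g n) * of_nat n powr (-s))" for k
      proof -
        have "(\<Sum>n\<in>{k * M..<k * M + M}. g n) = (\<Sum>n<M. g (k * M + n))"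
          by (rule sum.reindex_bij_witness[of _ "\<lambda>n. k * M + n" "\<lambda>n. n - k * M"]) auto
        also have "\<dots> = 0" using zero periodic_bounded(1)[of M g, OF M per] by simp
        finally have "(\<Sum>n\<in>{k * M..<k * M + M}. of_real (g n) :: complex) = 0" by (metis of_real_0 of_real_sum)
        then show ?thesis
          unfolding B_def by (simp add: right_diff_distrib sum_subtractf flip: sum_distrib_right)
      qed
      then show ?thesis by (simp add: sum.nat_group)
    qed
    then show "(\<lambda>N. \<Sum>n<N * M. of_real (g n) * of_nat n powr (-s)) \<longlonglongrightarrow> K s"
      using K(2)[OF s] by (simp add: sums_def)
  qed
qed

lemma mean_zero_continuation_eq:
  assumes M: "M > 0" and a: "dirichlet_abs_conv g" and s: "Re s > 1"
    and lim: "(\<lambda>N. \<Sum>n<N * M. of_real (g n) * of_nat n powr (-s)) \<longlonglongrightarrow> L"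
  shows "dirichlet_series g s = L"
proof -
  have "(\<lambda>N. \<Sum>n<N. of_real (g n) * of_nat n powr (-s)) \<longlonglongrightarrow> dirichlet_series g s"
    using dirichlet_series_sums[OF a s] by (simp add: sums_def)
  moreover have "filterlim (\<lambda>N. N * M) at_top sequentially"
    using M by (intro filterlim_at_top_mono[OF filterlim_ident]) auto
  ultimately have "(\<lambda>N. \<Sum>n<N * M. of_real (g n) * of_nat n powr (-s)) \<longlonglongrightarrow> dirichlet_series g s"
    by (rule filterlim_compose)
  then show ?thesis using lim by (rule LIMSEQ_unique)
qed

text \<open>(s - 1) k^(-s) is compared with (s - 1) times the integral of x^(-s) over [k, k + 1],
  that is with k^(1 - s) - (k + 1)^(1 - s), which telescopes to 1. The factor s - 1 cancels the pole
  of zeta, and at s = 1 every correction term vanishes, so W 1 = 1.\<close>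

lemma zeta_continuation:
  obtains W where "W holomorphic_on {s. Re s > 0}" "W 1 = 1"
    and "\<And>s. Re s > 1 \<Longrightarrow> (s - 1) * dirichlet_series (\<lambda>_. 1) s = W s"
proof -
  \<comment> \<open>The formula read at k = 0 would contribute 1; that 1 is kept apart in
    \<open>1 + K s\<close>.\<close>
  define B where "B = (\<lambda>k s. if k = 0 then 0 else (s - 1) * of_nat k powr (-s) - of_nat k powr (- (s - 1)) + of_nat (k + 1) powr (- (s - 1)) :: complex)"
  have shift: "(\<lambda>s. of_nat n powr (- (s - 1))) holomorphic_on UNIV" for n
    using holomorphic_on_compose[of "\<lambda>s. s - 1" UNIV "\<lambda>s. of_nat n powr (- s)"] nat_powr_minus_holomorphic[of n]
    by (auto simp: o_def intro!: holomorphic_intros)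
  have Bhol: "B k holomorphic_on UNIV" for k
    unfolding B_def by (cases "k = 0") (auto intro!: holomorphic_intros nat_powr_minus_holomorphic shift[unfolded minus_diff_eq])
  have Bb: "norm (B k s) \<le> 1 * (norm s + 1) ^ 2 * real k powr (- Re s - 1)" if k: "k \<ge> 1" and s: "Re s > 0" for k s
  proof -
    define x where "x = real k"
    have x: "x > 0" using k by (simp add: x_def)
    \<comment> \<open>The increment of \<phi> from x to x + 1 is B k s, and its derivative (s - 1)
      (x^(-s) - z^(-s)) is small on that segment because it vanishes at z = x.\<close>
    define \<phi> where "\<phi> = (\<lambda>z. (s - 1) * z * of_real x powr (-s) + z powr (1 - s))"
    have "norm (\<phi> (of_real (x + 1)) - \<phi> (of_real x)) \<le> (norm (s - 1) * (norm s * x powr (- Re s - 1))) * norm (of_real (x + 1) - of_real x :: complex)"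
    proof (rule field_differentiable_bound[where f = \<phi> and f' = "\<lambda>z. (s - 1) * (of_real x powr (-s) - z powr (-s))"
          and S = "closed_segment (of_real x) (of_real (x + 1))"])
      show "convex (closed_segment (of_real x) (of_real (x + 1)) :: complex set)" by simp
      fix z :: complex assume "z \<in> closed_segment (of_real x) (of_real (x + 1))"
      then obtain u where u: "z = of_real u" "u \<in> {x..x + 1}"
        unfolding closed_segment_of_real closed_segment_eq_real_ivl by auto
      have z: "z \<notin> \<real>\<^sub>\<le>\<^sub>0" using u x by (auto simp: complex_nonpos_Reals_iff)
      have "((\<lambda>z. z powr (1 - s)) has_field_derivative (1 - s) * z powr (1 - s - 1)) (at z)"
        by (rule has_field_derivative_powr[OF z])
      moreover have "1 - s - 1 = -s" by simp
      ultimately have "((\<lambda>z. z powr (1 - s)) has_field_derivative (1 - s) * z powr (- s)) (at z)" by metis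
      then have "(\<phi> has_field_derivative ((s - 1) * of_real x powr (-s) + (1 - s) * z powr (- s))) (at z)"
        unfolding \<phi>_def by (rule DERIV_add[rotated]) (auto intro!: derivative_eq_intros)
      moreover have "(s - 1) * of_real x powr (-s) + (1 - s) * z powr (- s) = (s - 1) * (of_real x powr (-s) - z powr (-s))"
        by (simp add: algebra_simps)
      ultimately show "(\<phi> has_field_derivative ((s - 1) * (of_real x powr (-s) - z powr (-s)))) (at z within closed_segment (of_real x) (of_real (x + 1)))"
        by (metis has_field_derivative_at_within)
      have "norm (of_real x powr (-s) - z powr (-s)) \<le> norm s * (u - x) * x powr (- Re s - 1)"
        unfolding u using u x s by (intro norm_powr_diff_le) auto
      also have "\<dots> \<le> norm s * 1 * x powr (- Re s - 1)"
        using u by (intro mult_right_mono mult_left_mono) auto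
      finally show "norm ((s - 1) * (of_real x powr (-s) - z powr (-s))) \<le> norm (s - 1) * (norm s * x powr (- Re s - 1))"
        by (simp add: norm_mult mult_left_mono)
    qed auto
    moreover have "\<phi> (of_real (x + 1)) - \<phi> (of_real x) = B k s"
      using k by (simp add: \<phi>_def B_def x_def algebra_simps)
    ultimately have "norm (B k s) \<le> norm (s - 1) * norm s * real k powr (- Re s - 1)" by (simp add: x_def mult.assoc)
    also have "\<dots> \<le> ((norm s + 1) * (norm s + 1)) * real k powr (- Re s - 1)"
      using norm_triangle_ineq4[of s 1] by (intro mult_right_mono mult_mono) auto
    finally show ?thesis by (simp add: power2_eq_square)
  qed
  obtain K where K: "K holomorphic_on {s. Re s > 0}" "\<And>s. Re s > 0 \<Longrightarrow> (\<lambda>k. B k s) sums K s"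
    using holomorphic_series_half_plane[OF Bhol Bb] by auto
  show ?thesis
  proof (rule that[of "\<lambda>s. 1 + K s"])
    show "(\<lambda>s. 1 + K s) holomorphic_on {s. Re s > 0}" by (intro holomorphic_intros K)
    have "B k 1 = 0" for k
      by (auto simp: B_def powr_def simp del: of_nat_add of_nat_Suc)
    then have "(\<lambda>k. B k 1) sums 0" by simp
    then show "1 + K 1 = 1" using K(2)[of 1] sums_unique2 by fastforce
    fix s assume s: "Re s > 1"
    have ac: "dirichlet_abs_conv (\<lambda>_. 1)" by (rule dirichlet_abs_convI[of _ 1]) auto
    have "(\<lambda>k. of_nat k powr (-s)) sums dirichlet_series (\<lambda>_. 1) s"
      using dirichlet_series_sums[OF ac s] by simp
    from sums_split_initial_segment[OF this, of 1]
    have 1: "(\<lambda>k. of_nat (k + 1) powr (-s)) sums dirichlet_series (\<lambda>_. 1) s" by simp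
    have "(\<lambda>k. of_nat (k + 1) powr (- (s - 1)) :: complex) \<longlonglongrightarrow> 0"
    proof (rule tendsto_norm_zero_cancel)
      have "(\<lambda>k. real (k + 1) powr (- (Re s - 1))) \<longlonglongrightarrow> 0"
        using s by (intro tendsto_neg_powr filterlim_compose[OF filterlim_real_sequentially] filterlim_add_const_nat_at_top) simp
      then show "(\<lambda>k. norm (of_nat (k + 1) powr (- (s - 1)) :: complex)) \<longlonglongrightarrow> 0"
        unfolding norm_nat_powr by simp
    qed
    from telescope_sums'[OF this]
    have 2: "(\<lambda>k. of_nat (k + 1) powr (- (s - 1)) - of_nat (Suc k + 1) powr (- (s - 1)) :: complex) sums 1" by simp
    have "(\<lambda>k. B (k + 1) s) sums ((s - 1) * dirichlet_series (\<lambda>_. 1) s - 1)"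
      using sums_diff[OF sums_mult[OF 1, of "s - 1"] 2] by (simp add: B_def algebra_simps)
    moreover have "(\<lambda>k. B (k + 1) s) sums K s"
      using sums_split_initial_segment[OF K(2), of s 1] s by (simp add: B_def)
    ultimately have "(s - 1) * dirichlet_series (\<lambda>_. 1) s - 1 = K s" by (rule sums_unique2)
    then show "(s - 1) * dirichlet_series (\<lambda>_. 1) s = 1 + K s" by (simp add: algebra_simps)
  qed
qed

lemma real_char_mod:
  assumes "real_char M f"
  shows "f (n mod M) = f n"
proof -
  have "M > 0" "\<And>n. f (n + M) = f n" using assms by (auto simp: real_char_def)
  from periodic_bounded(1)[of M f, OF this, of "n div M" "n mod M"] show ?thesis by simp
qed

text \<open>Multiplication by m permutes the residues modulo M and changes the sign of the
  sum.\<close>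

lemma real_char_sum_zero:
  assumes f: "real_char M f" and m: "f m = -1"
  shows "(\<Sum>n<M. f n) = 0"
proof -
  have M: "M > 0" using f by (auto simp: real_char_def)
  have cop: "coprime m M" using f m unfolding real_char_def by (metis zero_neq_neg_one)
  let ?h = "\<lambda>n. m * n mod M"
  have inj: "inj_on ?h {..<M}"
  proof (rule inj_onI)
    fix x y assume xy: "x \<in> {..<M}" "y \<in> {..<M}" "?h x = ?h y"
    then have "[m * x = m * y] (mod M)" by (simp add: cong_def)
    then have "[x = y] (mod M)" using cop by (simp add: cong_mult_lcancel_nat)
    then show "x = y" using xy by (simp add: cong_def)
  qed
  have "?h ` {..<M} = {..<M}"
    by (rule endo_inj_surj[OF _ _ inj]) (use M in auto)
  then have "(\<Sum>n<M. f n) = (\<Sum>n<M. f (?h n))"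
    using sum.reindex[OF inj, of f] by simp
  also have "\<dots> = (\<Sum>n<M. - f n)"
    by (simp add: real_char_mod[OF f] real_char_mult[OF f] m)
  finally show ?thesis by (simp add: sum_negf)
qed

text \<open>Splitting off the mean value of f leaves a periodic function of mean zero, so the only
  singularity comes from a multiple of zeta; its residue, the mean value, is V 1.\<close>

lemma real_char_continuation:
  assumes f: "real_char M f"
  obtains V where "V holomorphic_on {s. Re s > 0}" "V 1 = of_real ((\<Sum>n<M. f n) / real M)"
    and "\<And>s. Re s > 1 \<Longrightarrow> (s - 1) * dirichlet_series f s = V s"
proof -
  have M: "M > 0" and per: "\<And>n. f (n + M) = f n" using f by (auto simp: real_char_def)
  define m where "m = (\<Sum>n<M. f n) / real M"
  define g where "g = (\<lambda>n. f n - m)"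
  have m1: "\<bar>m\<bar> \<le> 1"
  proof -
    have "\<bar>\<Sum>n<M. f n\<bar> \<le> (\<Sum>n<M. 1)"
      by (rule order_trans[OF sum_abs]) (intro sum_mono real_char_abs_le[OF f])
    then show ?thesis using M by (simp add: m_def)
  qed
  obtain W where W: "W holomorphic_on {s. Re s > 0}" "W 1 = 1"
    "\<And>s. Re s > 1 \<Longrightarrow> (s - 1) * dirichlet_series (\<lambda>_. 1) s = W s"
    using zeta_continuation by blast
  obtain K where K: "K holomorphic_on {s. Re s > 0}"
    "\<And>s. Re s > 0 \<Longrightarrow> (\<lambda>N. \<Sum>n<N * M. of_real (g n) * of_nat n powr (-s)) \<longlonglongrightarrow> K s"
  proof (rule mean_zero_continuation[of M g])
    show "(\<Sum>n<M. g n) = 0" using M by (simp add: g_def m_def sum_subtractf)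
  qed (use M per in \<open>auto simp: g_def\<close>)
  have gc: "dirichlet_abs_conv g"
  proof (rule dirichlet_abs_convI[of _ 2])
    fix n :: nat assume "n > 0"
    have "\<bar>g n\<bar> \<le> 2" using real_char_abs_le[OF f, of n] m1 unfolding g_def by linarith
    then show "\<bar>g n\<bar> \<le> 2 * (1 + ln (real n))" by (rule order_trans) (use \<open>n > 0\<close> in simp)
  qed
  have oc: "dirichlet_abs_conv (\<lambda>_. 1)" by (rule dirichlet_abs_convI[of _ 1]) auto
  have D: "dirichlet_series f s = of_real m * dirichlet_series (\<lambda>_. 1) s + K s" if s: "Re s > 1" for s
  proof -
    have "(\<lambda>n. of_real m * (of_real 1 * of_nat n powr (-s)) + of_real (g n) * of_nat n powr (-s)) sums
       (of_real m * dirichlet_series (\<lambda>_. 1) s + dirichlet_series g s)"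
      by (intro sums_add sums_mult dirichlet_series_sums oc gc s)
    then have "dirichlet_series f s = of_real m * dirichlet_series (\<lambda>_. 1) s + dirichlet_series g s"
      unfolding dirichlet_series_def[of f] by (simp add: g_def algebra_simps sums_iff)
    moreover have "dirichlet_series g s = K s"
      using mean_zero_continuation_eq[OF M gc s K(2)] s by simp
    ultimately show ?thesis by simp
  qed
  show ?thesis
  proof (rule that[of "\<lambda>s. of_real m * W s + (s - 1) * K s"])
    show "(\<lambda>s. of_real m * W s + (s - 1) * K s) holomorphic_on {s. Re s > 0}"
      by (intro holomorphic_intros W K)
    show "of_real m * W 1 + (1 - 1) * K 1 = of_real ((\<Sum>n<M. f n) / real M)"
      using W by (simp add: m_def)
    show "(s - 1) * dirichlet_series f s = of_real m * W s + (s - 1) * K s" if "Re s > 1" for s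
      unfolding D[OF that] W(3)[OF that, symmetric] by (simp add: algebra_simps)
  qed
qed

text \<open>A zero at 1 + i t would enter the product of \<open>real_char_341\<close> to the fourth
  power. It would face a pole of order at most 3 from the series of f^2 at 1, while that series has
  no pole at 1 + 2 i t. The product would then tend to 0 as \<sigma> tends to 1, against its
  positive lower bound.\<close>

lemma real_char_nonvanishing:
  assumes f: "real_char M f" and V: "V holomorphic_on {s. Re s > 0}"
    and VD: "\<And>s. Re s > 1 \<Longrightarrow> (s - 1) * dirichlet_series f s = V s" and t: "t \<noteq> 0"
  shows "V (Complex 1 t) \<noteq> 0"
proof
  assume V0: "V (Complex 1 t) = 0"
  define g where "g = (\<lambda>n. f n * f n)"
  have g: "real_char M g" unfolding g_def by (rule real_char_times[OF f f])
  obtain U where U: "U holomorphic_on {s. Re s > 0}" "\<And>s. Re s > 1 \<Longrightarrow> (s - 1) * dirichlet_series g s = U s"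
    using real_char_continuation[OF g] by blast
  obtain k where k: "k > 0" "\<And>\<sigma> t. \<sigma> > 1 \<Longrightarrow>
     norm (dirichlet_series g (Complex \<sigma> 0)) ^ 3 * norm (dirichlet_series f (Complex \<sigma> t)) ^ 4 *
     norm (dirichlet_series g (Complex \<sigma> (2 * t))) \<ge> k"
    using real_char_341[OF f] unfolding g_def by blast
  have op: "open {s::complex. Re s > 0}" by (rule open_halfspace_Re_gt)
  have fl: "((\<lambda>\<sigma>. Complex \<sigma> u) \<longlongrightarrow> Complex 1 u) (at_right 1)" for u
    unfolding Complex_eq by (intro tendsto_intros)
  have cont: "((\<lambda>\<sigma>. h (Complex \<sigma> u)) \<longlongrightarrow> h (Complex 1 u)) (at_right 1)" if "h holomorphic_on {s. Re s > 0}" for h u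
  proof -
    have "isCont h (Complex 1 u)"
      using holomorphic_on_imp_continuous_on[OF that] op by (simp add: continuous_on_eq_continuous_at)
    then show ?thesis by (rule isCont_tendsto_compose[OF _ fl])
  qed
  have quot: "((\<lambda>\<sigma>. V (Complex \<sigma> t) / of_real (\<sigma> - 1)) \<longlongrightarrow> deriv V (Complex 1 t)) (at_right 1)"
  proof -
    have "(V has_field_derivative deriv V (Complex 1 t)) (at (Complex 1 t))"
      by (rule holomorphic_derivI[OF V op]) simp
    then have lim: "((\<lambda>z. (V z - V (Complex 1 t)) / (z - Complex 1 t)) \<longlongrightarrow> deriv V (Complex 1 t)) (at (Complex 1 t))"
      by (simp add: has_field_derivative_iff)
    have "filterlim (\<lambda>\<sigma>. Complex \<sigma> t) (at (Complex 1 t)) (at_right 1)"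
      using fl[of t] by (auto simp: filterlim_at eventually_at_filter)
    from filterlim_compose[OF lim this]
    have "((\<lambda>\<sigma>. (V (Complex \<sigma> t) - V (Complex 1 t)) / (Complex \<sigma> t - Complex 1 t)) \<longlongrightarrow> deriv V (Complex 1 t)) (at_right 1)" .
    moreover have "Complex \<sigma> t - Complex 1 t = of_real (\<sigma> - 1)" for \<sigma> by (simp add: complex_eq_iff)
    ultimately show ?thesis by (simp add: V0 del: of_real_diff)
  qed
  have lin: "((\<lambda>\<sigma>. Complex \<sigma> u - 1) \<longlongrightarrow> Complex 1 u - 1) (at_right 1)" for u
    by (intro tendsto_diff fl tendsto_const)
  have nz: "Complex 1 u - 1 \<noteq> 0" if "u \<noteq> 0" for u using that by (simp add: complex_eq_iff)
  \<comment> \<open>The product of \<open>real_char_341\<close> rewritten so that the one surplus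
    factor \<sigma> - 1 stands in front and everything else converges.\<close>
  define X where "X = (\<lambda>\<sigma>. (\<sigma> - 1) * norm (U (Complex \<sigma> 0)) ^ 3 * norm (V (Complex \<sigma> t) / of_real (\<sigma> - 1)) ^ 4 *
     norm (1 / (Complex \<sigma> t - 1)) ^ 4 * norm (U (Complex \<sigma> (2 * t)) / (Complex \<sigma> (2 * t) - 1)))"
  have "(X \<longlongrightarrow> (1 - 1) * norm (U (Complex 1 0)) ^ 3 * norm (deriv V (Complex 1 t)) ^ 4 *
     norm (1 / (Complex 1 t - 1)) ^ 4 * norm (U (Complex 1 (2 * t)) / (Complex 1 (2 * t) - 1))) (at_right 1)"
    unfolding X_def
    by (intro tendsto_mult tendsto_power tendsto_norm tendsto_divide quot cont U lin tendsto_diff tendsto_const tendsto_ident_at nz)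
       (use t in auto)
  then have "(X \<longlongrightarrow> 0) (at_right 1)" by simp
  moreover have "eventually (\<lambda>\<sigma>. X \<sigma> \<ge> k) (at_right 1)"
    using eventually_at_right_less[of 1]
  proof eventually_elim
    case (elim \<sigma>)
    have nz': "Complex \<sigma> u - 1 \<noteq> 0" for u using elim by (simp add: complex_eq_iff)
    have s0: "Complex \<sigma> 0 - 1 = of_real (\<sigma> - 1)" by (simp add: complex_eq_iff)
    have g': "dirichlet_series g (Complex \<sigma> u) = U (Complex \<sigma> u) / (Complex \<sigma> u - 1)" for u
      using U(2)[of "Complex \<sigma> u"] elim nz'[of u] by (simp add: field_simps)
    have f': "dirichlet_series f (Complex \<sigma> t) = V (Complex \<sigma> t) * (1 / (Complex \<sigma> t - 1))"
      using VD[of "Complex \<sigma> t"] elim nz'[of t] by (simp add: field_simps)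
    have e1: "norm (dirichlet_series g (Complex \<sigma> 0)) = norm (U (Complex \<sigma> 0)) / (\<sigma> - 1)"
      unfolding g' s0 norm_divide norm_of_real using elim by simp
    have e2: "norm (dirichlet_series f (Complex \<sigma> t)) = norm (V (Complex \<sigma> t)) * norm (1 / (Complex \<sigma> t - 1))"
      unfolding f' norm_mult ..
    have e3: "norm (V (Complex \<sigma> t) / of_real (\<sigma> - 1)) = norm (V (Complex \<sigma> t)) / (\<sigma> - 1)"
      unfolding norm_divide norm_of_real using elim by simp
    have alg: "e * A ^ 3 * (v / e) ^ 4 * w ^ 4 * z = (A / e) ^ 3 * (v * w) ^ 4 * z" if "e \<noteq> 0" for e A v w z :: real
      using that by (simp add: power_mult_distrib power_divide) (simp add: eval_nat_numeral)
    have "X \<sigma> = norm (dirichlet_series g (Complex \<sigma> 0)) ^ 3 * norm (dirichlet_series f (Complex \<sigma> t)) ^ 4 *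
       norm (dirichlet_series g (Complex \<sigma> (2 * t)))"
      unfolding X_def g'[of "2 * t"] e1 e2 e3 by (rule alg) (use elim in simp)
    then show ?case using k(2)[OF elim] by simp
  qed
  ultimately have "k \<le> 0" by (intro tendsto_lowerbound) auto
  with k(1) show False by simp
qed

section \<open>Nonvanishing at s = 1\<close>

lemma divisor_sum_prime_power_mult:
  fixes f :: "nat \<Rightarrow> real"
  assumes mult: "\<And>m n. f (m * n) = f m * f n" and p: "prime p" and pm: "\<not> p dvd m" and f1: "f 1 = 1"
  shows "(\<Sum>d | d dvd p ^ a * m. f d) = (\<Sum>i\<le>a. f p ^ i) * (\<Sum>d | d dvd m. f d)"
proof -
  have m: "m > 0" using pm by (auto intro!: Nat.gr0I)
  have pw: "f (p ^ i) = f p ^ i" for i by (induction i) (auto simp: mult f1[simplified])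
  have mul: "multiplicity p (p ^ i * d) = i" if "d dvd m" for i d
  proof -
    have "\<not> p dvd d" using that pm by (meson dvd_trans)
    then show ?thesis using p by (simp add: multiplicity_prime_elem_times_other multiplicity_times_same prime_imp_prime_elem
          prime_elem_multiplicity_mult_distrib not_dvd_imp_multiplicity_0 dvd_pos_nat[OF m that] prime_gt_0_nat)
  qed
  have inj: "inj_on (\<lambda>(i, d). p ^ i * d) ({..a} \<times> {d. d dvd m})"
  proof (rule inj_onI, clarify)
    fix i d j e assume *: "d dvd m" "e dvd m" "p ^ i * d = p ^ j * e"
    then have "i = j" using mul by metis
    then show "i = j \<and> d = e" using * p by (simp add: prime_gt_0_nat)
  qed
  have img: "{d. d dvd p ^ a * m} = (\<lambda>(i, d). p ^ i * d) ` ({..a} \<times> {d. d dvd m})"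
  proof (intro equalityI subsetI)
    fix k assume "k \<in> {d. d dvd p ^ a * m}"
    then obtain b c where bc: "k = b * c" "b dvd p ^ a" "c dvd m" by (auto dest: division_decomp)
    then obtain i where "i \<le> a" "b = p ^ i" using p by (auto simp: divides_primepow_nat)
    with bc show "k \<in> (\<lambda>(i, d). p ^ i * d) ` ({..a} \<times> {d. d dvd m})" by force
  qed (auto intro!: mult_dvd_mono le_imp_power_dvd)
  have "(\<Sum>d | d dvd p ^ a * m. f d) = (\<Sum>(i, d)\<in>{..a} \<times> {d. d dvd m}. f (p ^ i * d))"
    unfolding img by (subst sum.reindex[OF inj]) (simp add: case_prod_unfold)
  also have "\<dots> = (\<Sum>i\<le>a. f p ^ i) * (\<Sum>d | d dvd m. f d)"
    by (simp add: sum_product sum.cartesian_product mult pw)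
  finally show ?thesis .
qed

text \<open>By multiplicativity only prime powers matter. There the sum 1 + f p + ... + (f p)^a is a
  + 1 for f p = 1, equals 1 for f p = 0, and alternates between 1 and 0 for f p = -1; the value 0
  occurs for odd a only, never at a square.\<close>

lemma real_char_divisor_sum:
  assumes f: "real_char M f" and "n > 0"
  shows "(\<Sum>d | d dvd n. f d) \<ge> 0 \<and> (\<Sum>d | d dvd n\<^sup>2. f d) \<ge> 1"
  using \<open>n > 0\<close>
proof (induction n rule: less_induct)
  case (less n)
  note f1 = real_char_1[OF f]
  show ?case
  proof (cases "n = 1")
    case True
    then show ?thesis using f1 by simp
  next
    case False
    then obtain p where p: "prime p" "p dvd n" by (metis prime_factor_nat)
    define a where "a = multiplicity p n"
    obtain m where nm: "n = p ^ a * m" "\<not> p dvd m"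
    proof -
      have "n \<noteq> 0" "\<not> is_unit p" using less.prems p(1) not_prime_unit by auto
      then show ?thesis using that multiplicity_decompose'[of n p] unfolding a_def by blast
    qed
    have m: "m > 0" using nm less.prems by (auto intro!: Nat.gr0I)
    have "a > 0" using p less.prems unfolding a_def by (simp add: prime_multiplicity_gt_zero_iff)
    then have "p ^ a > 1" using prime_gt_1_nat[OF p(1)] by (metis one_less_power)
    then have "m < n" using m nm by simp
    from less.IH[OF this m] have IH: "(\<Sum>d | d dvd m. f d) \<ge> 0" "(\<Sum>d | d dvd m\<^sup>2. f d) \<ge> 1" by auto
    have geom: "(\<Sum>i\<le>k. f p ^ i) \<ge> 0 \<and> (\<Sum>i\<le>2 * k. f p ^ i) \<ge> 1" for k
    proof -
      consider "f p = 1" | "f p = -1" | "f p = 0" using real_char_cases[OF f] by blast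
      then show ?thesis
      proof cases
        case 2
        have "(\<Sum>i\<le>k. (-1::real) ^ i) = (if even k then 1 else 0)" for k by (induction k) auto
        then show ?thesis using 2 by simp
      next
        case 3
        have "(\<Sum>i\<le>k. (0::real) ^ i) = 1" for k by (induction k) auto
        then show ?thesis using 3 by simp
      qed auto
    qed
    have "n\<^sup>2 = p ^ (2 * a) * m\<^sup>2" by (simp add: nm(1) power_mult_distrib power_mult[symmetric] mult.commute)
    moreover have "\<not> p dvd m\<^sup>2" using p nm by (simp add: prime_dvd_power_iff)
    ultimately have "(\<Sum>d | d dvd n\<^sup>2. f d) = (\<Sum>i\<le>2 * a. f p ^ i) * (\<Sum>d | d dvd m\<^sup>2. f d)"
      using divisor_sum_prime_power_mult[of f p "m\<^sup>2" "2 * a"] real_char_mult[OF f] p f1 by simp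
    moreover have "1 * 1 \<le> (\<Sum>i\<le>2 * a. f p ^ i) * (\<Sum>d | d dvd m\<^sup>2. f d)"
      using geom[of a] IH by (intro mult_mono) auto
    moreover have "(\<Sum>d | d dvd n. f d) = (\<Sum>i\<le>a. f p ^ i) * (\<Sum>d | d dvd m. f d)"
      using divisor_sum_prime_power_mult[of f p m a] real_char_mult[OF f] p f1 nm by simp
    ultimately show ?thesis using geom[of a] IH by simp
  qed
qed

text \<open>Summation by parts: all weights c n - c (Suc n) are nonnegative, and together with the
  boundary weight c N they telescope to c 0.\<close>

lemma abel_sum_bound:
  fixes f c :: "nat \<Rightarrow> real"
  assumes P: "\<And>N. \<bar>\<Sum>n<N. f n\<bar> \<le> P" and dec: "\<And>n. c (Suc n) \<le> c n" and nn: "\<And>n. c n \<ge> 0"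
  shows "\<bar>\<Sum>n<N. f n * c n\<bar> \<le> P * c 0"
proof -
  define F where "F = (\<lambda>N. \<Sum>n<N. f n)"
  have id: "(\<Sum>n<N. f n * c n) = F N * c N + (\<Sum>n<N. F (Suc n) * (c n - c (Suc n)))"
    by (induction N) (auto simp: F_def algebra_simps)
  have "\<bar>\<Sum>n<N. f n * c n\<bar> \<le> \<bar>F N * c N\<bar> + (\<Sum>n<N. \<bar>F (Suc n) * (c n - c (Suc n))\<bar>)"
    unfolding id by (rule order_trans[OF abs_triangle_ineq]) (intro add_left_mono sum_abs)
  also have "\<dots> \<le> P * c N + (\<Sum>n<N. P * (c n - c (Suc n)))"
  proof (intro add_mono sum_mono)
    have P': "\<bar>F N\<bar> \<le> P" for N unfolding F_def by (rule P)
    show "\<bar>F N * c N\<bar> \<le> P * c N" using P'[of N] nn[of N] by (simp add: abs_mult mult_right_mono)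
    show "\<bar>F (Suc n) * (c n - c (Suc n))\<bar> \<le> P * (c n - c (Suc n))" for n
      using P'[of "Suc n"] dec[of n] by (simp add: abs_mult mult_right_mono)
  qed
  also have "(\<Sum>n<N. P * (c n - c (Suc n))) = P * (c 0 - c N)"
    by (simp add: sum_lessThan_telescope' flip: sum_distrib_left)
  finally show ?thesis by (simp add: algebra_simps)
qed

lemma real_char_partial_sums_bounded:
  assumes f: "real_char M f" and zero: "(\<Sum>n<M. f n) = 0"
  shows "\<bar>\<Sum>n<N. f n\<bar> \<le> real M"
proof (induction N rule: less_induct)
  case (less N)
  show ?case
  proof (cases "N < M")
    case True
    have "\<bar>\<Sum>n<N. f n\<bar> \<le> (\<Sum>n<N. 1)"
      by (rule order_trans[OF sum_abs]) (intro sum_mono real_char_abs_le[OF f])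
    then show ?thesis using True by simp
  next
    case False
    have M: "M > 0" and per: "\<And>n. f (n + M) = f n" using f by (auto simp: real_char_def)
    have "(\<Sum>n<M + k. f n) = (\<Sum>n<M. f n) + (\<Sum>n<k. f n)" for k
      by (induction k) (auto simp: per add.commute[of M])
    from this[of "N - M"] have "(\<Sum>n<N. f n) = (\<Sum>n<N - M. f n)" using False zero by simp
    then show ?thesis using less.IH[of "N - M"] M False by simp
  qed
qed

text \<open>The terms with indices i and n - 1 - i are paired, and each pair is bounded below by the
  inequality between arithmetic and geometric mean.\<close>

lemma geometric_sum_ge:
  fixes y :: real
  assumes "y \<ge> 0"
  shows "(\<Sum>i<n. (y\<^sup>2) ^ i) \<ge> real n * y ^ (n - 1)"
proof -
  have "2 * (\<Sum>i<n. (y\<^sup>2) ^ i) = (\<Sum>i<n. (y\<^sup>2) ^ i + (y\<^sup>2) ^ (n - Suc i))"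
    using sum.nat_diff_reindex[of "\<lambda>i. (y\<^sup>2) ^ i" n] by (simp add: sum.distrib)
  also have "\<dots> \<ge> (\<Sum>i<n. 2 * y ^ (n - 1))"
  proof (rule sum_mono)
    fix i assume i: "i \<in> {..<n}"
    have sq: "(y\<^sup>2) ^ k = (y ^ k)\<^sup>2" for k by (metis power_mult mult.commute)
    have "2 * y ^ i * y ^ (n - Suc i) \<le> (y ^ i)\<^sup>2 + (y ^ (n - Suc i))\<^sup>2" by (rule sum_squares_bound)
    moreover have "y ^ i * y ^ (n - Suc i) = y ^ (n - 1)" using i by (simp flip: power_add)
    ultimately show "2 * y ^ (n - 1) \<le> (y\<^sup>2) ^ i + (y\<^sup>2) ^ (n - Suc i)"
      by (simp add: sq mult.assoc)
  qed
  finally show ?thesis by simp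
qed

text \<open>As x tends to 1 the Lambert kernel x^n / (1 - x^n) behaves like 1 / (n (1 - x)); this is
  the error of that approximation. At n = 1 it equals 1 for every x < 1.\<close>

definition monsky_coeff :: "real \<Rightarrow> nat \<Rightarrow> real" where
  "monsky_coeff x n = 1 / (real n * (1 - x)) - x ^ n / (1 - x ^ n)"

text \<open>With S n = 1 + x + ... + x^(n - 1), monotonicity reduces to n (n + 1) x^n \<le> S n * S
  (n + 1), which follows from \<open>geometric_sum_ge\<close> applied with y = sqrt x to both
  factors.\<close>

lemma monsky_coeff_props:
  assumes x: "0 < x" "x < 1" and n: "n \<ge> 1"
  shows "monsky_coeff x n \<ge> 0" and "monsky_coeff x (Suc n) \<le> monsky_coeff x n"
proof -
  define S where "S = (\<lambda>n. \<Sum>i<n. x ^ i)"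
  define y where "y = sqrt x"
  have y: "0 < y" "y < 1" "y\<^sup>2 = x" using x by (auto simp: y_def)
  have S: "1 - x ^ n = (1 - x) * S n" for n unfolding S_def by (rule one_diff_power_eq)
  have Sge: "S n \<ge> real n * y ^ (n - 1)" for n
    using geometric_sum_ge[of y n] y unfolding S_def by simp
  have Spos: "S n > 0" if "n \<ge> 1" for n
    using Sge[of n] y that by (intro less_le_trans[OF _ Sge]) auto
  have mc: "monsky_coeff x n = (1 / real n - x ^ n / S n) / (1 - x)" for n
    unfolding monsky_coeff_def S by (simp add: diff_divide_distrib mult.commute)
  have Sx: "x ^ n * real n \<le> S n" for n
  proof -
    have "(\<Sum>i<n. x ^ n) \<le> S n" unfolding S_def using x by (intro sum_mono power_decreasing) auto
    then show ?thesis by (simp add: mult.commute)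
  qed
  have "x ^ n / S n \<le> 1 / real n" using Sx[of n] Spos[OF n] n by (simp add: field_simps)
  then show "monsky_coeff x n \<ge> 0" unfolding mc using x by simp
  have "x ^ n / S n - x ^ Suc n / S (Suc n) \<le> 1 / real n - 1 / real (Suc n)"
  proof -
    have SS: "S (Suc n) = 1 + x * S n" unfolding S_def by (subst sum.lessThan_Suc_shift) (simp add: sum_distrib_left)
    have "x ^ n / S n - x ^ Suc n / S (Suc n) = x ^ n * (S (Suc n) - x * S n) / (S n * S (Suc n))"
      using Spos[OF n] Spos[of "Suc n"] by (simp add: divide_simps) (simp add: algebra_simps)
    also have "\<dots> = x ^ n / (S n * S (Suc n))" by (simp add: SS)
    also have "\<dots> \<le> 1 / (real n * real (Suc n))"
    proof -
      have "real n * real (Suc n) * x ^ n = real n * real (Suc n) * y ^ (2 * n)" by (simp add: y(3)[symmetric] power_mult)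
      \<comment> \<open>One factor y < 1 is given away, because the two lower bounds multiply to the
        odd power 2 n - 1 = (n - 1) + n.\<close>
      also have "\<dots> \<le> real n * real (Suc n) * y ^ (2 * n - 1)"
        using y by (intro mult_left_mono power_decreasing) auto
      also have "\<dots> = (real n * y ^ (n - 1)) * (real (Suc n) * y ^ (Suc n - 1))"
      proof -
        have "y ^ (2 * n - 1) = y ^ (n - 1) * y ^ n" using n by (simp flip: power_add) (simp add: mult_2)
        then show ?thesis by simp
      qed
      also have "\<dots> \<le> S n * S (Suc n)"
        using y Spos[OF n] by (intro mult_mono Sge) auto
      finally have *: "real n * real (Suc n) * x ^ n \<le> S n * S (Suc n)" .
      have pos: "real n * real (Suc n) > 0" "S n * S (Suc n) > 0" using n Spos[OF n] Spos[of "Suc n"] by auto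
      show ?thesis using * pos by (simp only: pos_divide_le_eq pos_le_divide_eq times_divide_eq_left mult_1 mult.commute[of "x ^ n"])
    qed
    also have "\<dots> = 1 / real n - 1 / real (Suc n)" using n by (simp add: field_simps)
    finally show ?thesis .
  qed
  then show "monsky_coeff x (Suc n) \<le> monsky_coeff x n"
    unfolding mc using x by (intro divide_right_mono) auto
qed

text \<open>Monsky's argument: the Lambert series \<open>\<Sum>f(n) x\<^sup>n/(1-x\<^sup>n)\<close> has coefficients \<open>\<ge> 0\<close>, and \<open>\<ge> 1\<close> at
  squares, so it is unbounded as \<open>x \<rightarrow> 1\<close>; if \<open>L(1,f) = 0\<close>, subtracting \<open>L(1,f)/(1-x)\<close> bounds it.\<close>

lemma real_char_L1_nonzero:
  assumes f: "real_char M f" and zero: "(\<Sum>n<M. f n) = 0"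
  shows "\<not> (\<lambda>N. \<Sum>n<N * M. f n / real n) \<longlonglongrightarrow> 0"
proof
  assume lim: "(\<lambda>N. \<Sum>n<N * M. f n / real n) \<longlonglongrightarrow> 0"
  have M: "M > 0" using f by (auto simp: real_char_def)
  define r where "r = (\<lambda>k. \<Sum>d | d dvd k. f d)"
  have bound: "(\<Sum>j=1..J. x ^ (j\<^sup>2)) \<le> real M" if x: "0 < x" "x < 1" for x :: real and J
  proof -
    have xn: "x ^ n < 1" if "n > 0" for n using x that by (simp add: power_less_one_iff)
    define u where "u = (\<lambda>n. f n * (x ^ n / (1 - x ^ n)))"
    have ub: "\<bar>u n\<bar> \<le> x ^ n / (1 - x)" for n
    proof (cases "n = 0")
      case False
      have "x ^ n \<le> x ^ 1" using x False by (intro power_decreasing) auto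
      then have "x ^ n / (1 - x ^ n) \<le> x ^ n / (1 - x)" using x xn[of n] False by (intro divide_left_mono) auto
      moreover have "0 \<le> x ^ n / (1 - x ^ n)" using x xn[of n] False by simp
      ultimately have "\<bar>f n\<bar> * (x ^ n / (1 - x ^ n)) \<le> 1 * (x ^ n / (1 - x))"
        using real_char_abs_le[OF f, of n] by (intro mult_mono) auto
      then show ?thesis unfolding u_def abs_mult abs_of_nonneg[OF \<open>0 \<le> x ^ n / (1 - x ^ n)\<close>] by simp
    qed (use x in \<open>simp add: u_def real_char_0[OF f]\<close>)
    have su: "summable (\<lambda>n. norm (u n))"
    proof (rule summable_comparison_test'[where N = 0])
      show "summable (\<lambda>n. x ^ n / (1 - x))" using x by (intro summable_divide summable_geometric) auto
    qed (use ub in simp)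
    define L where "L = suminf u"
    have uL: "u sums L" unfolding L_def by (intro summable_sums summable_norm_cancel[OF su])
    have L_le: "\<bar>L\<bar> \<le> real M"
    proof -
      \<comment> \<open>Index 0 gets the value at 1, so c is decreasing from 0 on with c 0 = 1, and
        the extra term is harmless because f 0 = 0.\<close>
      define c where "c = (\<lambda>n. monsky_coeff x (max 1 n))"
      have c: "c n \<ge> 0" "c (Suc n) \<le> c n" for n
        using monsky_coeff_props[OF x, of "max 1 n"] monsky_coeff_props[OF x, of n] by (auto simp: c_def max_def not_le)
      have c0: "c 0 = 1" using x by (simp add: c_def monsky_coeff_def flip: diff_divide_distrib)
      have "\<bar>\<Sum>n<N * M. f n * c n\<bar> \<le> real M" for N
        using abel_sum_bound[of f "real M" c "N * M"] real_char_partial_sums_bounded[OF f zero] c c0 by simp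
      moreover have "(\<Sum>n<N * M. f n * c n) = 1 / (1 - x) * (\<Sum>n<N * M. f n / real n) - (\<Sum>n<N * M. u n)" for N
      proof -
        have "f n * c n = 1 / (1 - x) * (f n / real n) - u n" for n
          by (cases "n = 0") (auto simp: real_char_0[OF f] u_def c_def monsky_coeff_def max_def algebra_simps)
        then show ?thesis by (simp add: sum_subtractf sum_distrib_left)
      qed
      ultimately have "\<bar>1 / (1 - x) * (\<Sum>n<N * M. f n / real n) - (\<Sum>n<N * M. u n)\<bar> \<le> real M" for N by simp
      moreover have "(\<lambda>N. \<bar>1 / (1 - x) * (\<Sum>n<N * M. f n / real n) - (\<Sum>n<N * M. u n)\<bar>) \<longlonglongrightarrow> \<bar>1 / (1 - x) * 0 - L\<bar>"
      proof (intro tendsto_rabs tendsto_diff tendsto_mult tendsto_const lim)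
        have "filterlim (\<lambda>N. N * M) at_top sequentially"
          using M by (intro filterlim_at_top_mono[OF filterlim_ident]) auto
        then show "(\<lambda>N. \<Sum>n<N * M. u n) \<longlonglongrightarrow> L"
          using uL filterlim_compose unfolding sums_def by blast
      qed
      ultimately have "\<bar>1 / (1 - x) * 0 - L\<bar> \<le> real M" by (intro LIMSEQ_le_const2) auto
      then show ?thesis by simp
    qed
    \<comment> \<open>Each Lambert term is expanded as a geometric series; grouping by the product n
      * k then makes the divisor sums r k the coefficients of x^k.\<close>
    have "((\<lambda>(n, k). f n * x ^ (n * k)) has_sum L) ({0<..} \<times> {0<..})"
    proof -
      have inner: "((\<lambda>k. (x ^ n) ^ k) has_sum (x ^ n / (1 - x ^ n))) {0<..}" if "n > 0" for n
      proof -
        have "(\<lambda>k. (x ^ n) ^ Suc k) sums (x ^ n * (1 / (1 - x ^ n)))"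
          unfolding power_Suc using x xn[OF that] by (intro sums_mult geometric_sums) auto
        then have "((\<lambda>k. (x ^ n) ^ Suc k) has_sum (x ^ n / (1 - x ^ n))) UNIV"
          using x by (intro sums_nonneg_imp_has_sum) auto
        then have "((\<lambda>k. (x ^ n) ^ k) has_sum (x ^ n / (1 - x ^ n))) (Suc ` UNIV)"
          by (subst has_sum_reindex) (auto simp: o_def)
        then show ?thesis by (simp add: greaterThan_0)
      qed
      show ?thesis
      proof (rule has_sum_SigmaI[where g = u])
        fix n :: nat assume n: "n \<in> {0<..}"
        then show "((\<lambda>k. case (n, k) of (n, k) \<Rightarrow> f n * x ^ (n * k)) has_sum u n) {0<..}"
          unfolding u_def using has_sum_cmult_right[OF inner[of n], of "f n"] by (simp add: power_mult)
      next
        have "(u has_sum L) UNIV" by (rule norm_summable_imp_has_sum[OF su uL])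
        then show "(u has_sum L) {0<..}"
          by (subst has_sum_cong_neutral[where T = UNIV and g = u]) (auto simp: u_def real_char_0[OF f])
      next
        have "(\<lambda>z. norm (case z of (n, k) \<Rightarrow> f n * x ^ (n * k))) summable_on ({0<..} \<times> {0<..})"
        proof (rule Infinite_Sum.abs_summable_on_Sigma_iff[THEN iffD2], intro conjI ballI)
          fix n :: nat assume n: "n \<in> {0<..}"
          have "((\<lambda>k. \<bar>f n\<bar> * (x ^ n) ^ k) has_sum (\<bar>f n\<bar> * (x ^ n / (1 - x ^ n)))) {0<..}"
            using n by (intro has_sum_cmult_right inner) auto
          then show "(\<lambda>k. norm (case (n, k) of (n, k) \<Rightarrow> f n * x ^ (n * k))) summable_on {0<..}"
            using x by (auto simp: abs_mult power_mult summable_on_def)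
        next
          have "infsum (\<lambda>k. norm (case (n, k) of (n, k) \<Rightarrow> f n * x ^ (n * k))) {0<..} = norm (u n)" if n: "n \<in> {0<..}" for n
          proof -
            have "((\<lambda>k. \<bar>f n\<bar> * (x ^ n) ^ k) has_sum (\<bar>f n\<bar> * (x ^ n / (1 - x ^ n)))) {0<..}"
              using n by (intro has_sum_cmult_right inner) auto
            moreover have "norm (u n) = \<bar>f n\<bar> * (x ^ n / (1 - x ^ n))" using x xn[of n] n by (simp add: u_def abs_mult)
            ultimately show ?thesis using x by (simp add: abs_mult power_mult infsumI)
          qed
          moreover have "(\<lambda>n. norm (u n)) summable_on {0<..}"
            by (rule summable_on_subset[of _ UNIV]) (use su in \<open>auto simp: summable_on_UNIV_nonneg_real_iff\<close>)
          ultimately show "(\<lambda>n. norm (infsum (\<lambda>k. norm (case (n, k) of (n, k) \<Rightarrow> f n * x ^ (n * k))) {0<..})) summable_on {0<..}"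
            by (subst summable_on_cong[where g = "\<lambda>n. norm (u n)"]) auto
        qed
        then show "(\<lambda>(n, k). f n * x ^ (n * k)) summable_on ({0<..} \<times> {0<..})"
          by (rule Infinite_Sum.abs_summable_summable)
      qed
    qed
    from has_sum_group_divisors[OF this]
    have hs: "((\<lambda>k. \<Sum>d | d dvd k. f d * x ^ (d * (k div d))) has_sum L) {0<..}" by simp
    have hs: "((\<lambda>k. r k * x ^ k) has_sum L) {0<..}"
    proof (rule has_sum_cong[THEN iffD1, OF _ hs])
      fix k :: nat
      show "(\<Sum>d | d dvd k. f d * x ^ (d * (k div d))) = r k * x ^ k"
        unfolding r_def sum_distrib_right by (intro sum.cong) auto
    qed
    have inj: "inj_on (\<lambda>j::nat. j\<^sup>2) {1..J}" by (auto simp: inj_on_def)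
    have "(\<Sum>j=1..J. x ^ (j\<^sup>2)) \<le> (\<Sum>j=1..J. r (j\<^sup>2) * x ^ (j\<^sup>2))"
    proof (rule sum_mono)
      fix j assume "j \<in> {1..J}"
      then have "r (j\<^sup>2) \<ge> 1" using real_char_divisor_sum[OF f, of j] by (simp add: r_def)
      then show "x ^ (j\<^sup>2) \<le> r (j\<^sup>2) * x ^ (j\<^sup>2)" using x by simp
    qed
    also have "\<dots> = (\<Sum>k\<in>(\<lambda>j. j\<^sup>2) ` {1..J}. r k * x ^ k)" by (subst sum.reindex[OF inj]) simp
    also have "\<dots> \<le> L"
    proof (rule has_sum_mono_neutral[OF has_sum_finite hs])
      show "0 \<le> r k * x ^ k" if "k \<in> {0<..} - (\<lambda>j. j\<^sup>2) ` {1..J}" for k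
        using real_char_divisor_sum[OF f, of k] that x by (simp add: r_def)
    qed auto
    finally show ?thesis using L_le by simp
  qed
  \<comment> \<open>As x tends to 1 the sum over J squares tends to J = M + 1, exceeding the bound M
    that holds for every x < 1.\<close>
  define J where "J = Suc M"
  have "((\<lambda>x::real. \<Sum>j=1..J. x ^ (j\<^sup>2)) \<longlongrightarrow> (\<Sum>j=1..J. 1 ^ (j\<^sup>2))) (at_left 1)"
    by (intro tendsto_intros)
  moreover have "eventually (\<lambda>x::real. (\<Sum>j=1..J. x ^ (j\<^sup>2)) \<le> real M) (at_left 1)"
  proof -
    have "eventually (\<lambda>x::real. x \<in> {0<..<1}) (at_left 1)" by (rule eventually_at_left_real) simp
    then show ?thesis by (rule eventually_mono) (rule bound; simp)
  qed
  ultimately have "(\<Sum>j=1..J. (1::real) ^ (j\<^sup>2)) \<le> real M"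
    by (rule tendsto_upperbound) simp
  then show False by (simp add: J_def)
qed

section \<open>Logarithmic derivatives up to the line Re s = 1\<close>

lemma real_char_series_nonzero:
  assumes "real_char M f" "Re s > 1"
  shows "dirichlet_series f s \<noteq> 0"
proof -
  obtain C where "C \<noteq> 0" "\<And>s. Re s > 1 \<Longrightarrow> dirichlet_series f s = C * exp (dirichlet_series (\<lambda>n. f n * mangoldt n / ln (real n)) s)"
    using real_char_series_exp[OF assms(1)] by blast
  then show ?thesis using assms(2) by simp
qed

lemma real_char_log_deriv_eq:
  assumes f: "real_char M f" and s: "Re s > 1" and d: "(dirichlet_series f has_field_derivative d) (at s)"
  shows "dirichlet_series (\<lambda>n. f n * mangoldt n) s = - d / dirichlet_series f s"
proof -
  have "d = - dirichlet_series (\<lambda>n. f n * ln (real n)) s"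
    by (rule DERIV_unique[OF d dirichlet_series_has_field_derivative]) (use f s real_char_abs_conv in auto)
  then show ?thesis
    using real_char_log_deriv[OF f s] real_char_series_nonzero[OF f s] by simp
qed

lemma complex_ge1_cases:
  assumes "Re s \<ge> 1"
  obtains "Re s > 1" | t where "t \<noteq> 0" "s = Complex 1 t" | "s = 1"
proof (cases "Re s > 1")
  case False
  then have s: "s = Complex 1 (Im s)" using assms by (simp add: complex_eq_iff)
  show ?thesis
  proof (cases "Im s = 0")
    case True
    then show ?thesis using s that(3) by (simp add: complex_eq_iff)
  next
    case False
    then show ?thesis using s that(2) by blast
  qed
qed (use that in blast)

lemma nat_powr_minus_one: "of_nat n powr (-1) = (of_real (1 / real n) :: complex)"
  by (cases "n = 0") (auto simp: powr_def Ln_of_nat exp_minus exp_of_real inverse_eq_divide)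

text \<open>\<delta> is the order of the pole at 1. If f takes the value -1, the series continues
  without a pole and nonvanishing at 1 is Monsky's argument. Otherwise f is nonnegative, V 1 is a
  positive mean value, and subtracting the series with constant coefficient 1 cancels the simple
  pole of -L'/L. The rest of the line is covered by \<open>real_char_nonvanishing\<close>.\<close>

lemma real_char_log_deriv_continuous:
  assumes f: "real_char M f"
  obtains \<delta> :: real and G where "\<delta> \<ge> 0" "(\<And>n. f n \<ge> 0) \<Longrightarrow> \<delta> = 1" "continuous_on {s. Re s \<ge> 1} G"
    "\<And>s. Re s > 1 \<Longrightarrow> dirichlet_series (\<lambda>n. f n * mangoldt n) s - of_real \<delta> * dirichlet_series (\<lambda>_. 1) s = G s"
proof -
  have M: "M > 0" and per: "\<And>n. f (n + M) = f n" using f by (auto simp: real_char_def)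
  have op: "open {s::complex. Re s > 0}" "open {s::complex. Re s > 1}" by (rule open_halfspace_Re_gt)+
  have cont: "continuous_on {s. Re s \<ge> 1} h" if "h holomorphic_on {s. Re s > 0}" for h
    using holomorphic_on_imp_continuous_on[OF that] by (rule continuous_on_subset) auto
  show ?thesis
  proof (cases "\<exists>m. f m = -1")
    case True
    then have zero: "(\<Sum>n<M. f n) = 0" using real_char_sum_zero[OF f] by blast
    obtain K where K: "K holomorphic_on {s. Re s > 0}"
      "\<And>s. Re s > 0 \<Longrightarrow> (\<lambda>N. \<Sum>n<N * M. of_real (f n) * of_nat n powr (-s)) \<longlonglongrightarrow> K s"
      using mean_zero_continuation[of M f, OF M per zero] by blast
    have DK: "dirichlet_series f s = K s" if "Re s > 1" for s
      using mean_zero_continuation_eq[OF M real_char_abs_conv(1)[OF f] that K(2)] that by simp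
    have nz: "K s \<noteq> 0" if "Re s \<ge> 1" for s
      using that
    proof (cases s rule: complex_ge1_cases)
      case 1
      then show ?thesis using real_char_series_nonzero[OF f] DK by metis
    next
      case (2 t)
      have "(Complex 1 t - 1) * K (Complex 1 t) \<noteq> 0"
        by (rule real_char_nonvanishing[OF f, where V = "\<lambda>s. (s - 1) * K s"])
           (use 2 DK in \<open>auto intro!: holomorphic_intros K\<close>)
      then show ?thesis using 2 by simp
    next
      case 3
      have "(\<lambda>N. \<Sum>n<N * M. of_real (f n) * of_nat n powr (-1)) \<longlonglongrightarrow> K 1" by (rule K(2)) simp
      then have "(\<lambda>N. of_real (\<Sum>n<N * M. f n / real n)) \<longlonglongrightarrow> K 1"
        unfolding nat_powr_minus_one by simp
      from tendsto_Re[OF this] have "(\<lambda>N. \<Sum>n<N * M. f n / real n) \<longlonglongrightarrow> Re (K 1)" by simp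
      then show ?thesis using real_char_L1_nonzero[OF f zero] 3 by auto
    qed
    show ?thesis
    proof (rule that[of 0 "\<lambda>s. - deriv K s / K s"])
      show "(0::real) = 1" if "\<And>n. f n \<ge> 0"
        using True that by (metis neg_0_le_iff_le not_one_le_zero)
      show "continuous_on {s. Re s \<ge> 1} (\<lambda>s. - deriv K s / K s)"
        by (intro continuous_intros cont holomorphic_deriv K op) (use nz in auto)
      fix s :: complex assume s: "Re s > 1"
      have "(K has_field_derivative deriv K s) (at s)"
        by (rule holomorphic_derivI[OF K(1) op(1)]) (use s in simp)
      then have "(dirichlet_series f has_field_derivative deriv K s) (at s)"
        by (rule has_field_derivative_transform_within_open[OF _ op(2)]) (use s DK in auto)
      from real_char_log_deriv_eq[OF f s this]
      show "dirichlet_series (\<lambda>n. f n * mangoldt n) s - of_real 0 * dirichlet_series (\<lambda>_. 1) s = - deriv K s / K s"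
        using DK[OF s] by simp
    qed simp
  next
    case False
    then have f0: "f n \<ge> 0" for n using real_char_cases[OF f, of n] by auto
    obtain V where V: "V holomorphic_on {s. Re s > 0}" "V 1 = of_real ((\<Sum>n<M. f n) / real M)"
      "\<And>s. Re s > 1 \<Longrightarrow> (s - 1) * dirichlet_series f s = V s"
      using real_char_continuation[OF f] by blast
    obtain W where W: "W holomorphic_on {s. Re s > 0}" "W 1 = 1"
      "\<And>s. Re s > 1 \<Longrightarrow> (s - 1) * dirichlet_series (\<lambda>_. 1) s = W s"
      using zeta_continuation by blast
    \<comment> \<open>R continues zeta (s) - 1 / (s - 1); the singularity at 1 is removable.\<close>
    define R where "R = (\<lambda>z. if z = 1 then deriv W 1 else (W z - W 1) / (z - 1))"
    have R: "R holomorphic_on {s. Re s > 0}" unfolding R_def by (rule pole_lemma_open[OF W(1) op(1)])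
    have nz: "V s \<noteq> 0" if "Re s \<ge> 1" for s
      using that
    proof (cases s rule: complex_ge1_cases)
      case 1
      then have "s \<noteq> 1" by auto
      with 1 show ?thesis using real_char_series_nonzero[OF f, of s] V(3)[OF 1] by (metis eq_iff_diff_eq_0 mult_eq_0_iff)
    next
      case (2 t)
      then show ?thesis using real_char_nonvanishing[OF f V(1,3)] by blast
    next
      case 3
      have "f 1 \<le> (\<Sum>n<M. f n)" using f f0 by (intro member_le_sum) (auto simp: real_char_def)
      then have "(\<Sum>n<M. f n) / real M > 0" using M real_char_1[OF f] by simp
      then show ?thesis unfolding 3 V(2) by (metis less_irrefl of_real_eq_0_iff)
    qed
    show ?thesis
    proof (rule that[of 1 "\<lambda>s. - deriv V s / V s - R s"])
      show "continuous_on {s. Re s \<ge> 1} (\<lambda>s. - deriv V s / V s - R s)"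
        by (intro continuous_intros cont holomorphic_deriv V R op) (use nz in auto)
      fix s :: complex assume s: "Re s > 1"
      then have s1: "s - 1 \<noteq> 0" by auto
      have Df: "dirichlet_series f s = V s / (s - 1)" if "Re s > 1" for s
        using V(3)[OF that] that by (metis eq_iff_diff_eq_0 less_irrefl nonzero_mult_div_cancel_left one_complex.sel(1))
      have "((\<lambda>s. V s / (s - 1)) has_field_derivative (deriv V s * (s - 1) - V s) / (s - 1)\<^sup>2) (at s)"
        using s1 s by (auto intro!: derivative_eq_intros holomorphic_derivI[OF V(1) op(1)] simp: power2_eq_square)
      then have "(dirichlet_series f has_field_derivative (deriv V s * (s - 1) - V s) / (s - 1)\<^sup>2) (at s)"
        by (rule has_field_derivative_transform_within_open[OF _ op(2)]) (use s Df in auto)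
      from real_char_log_deriv_eq[OF f s this]
      have "dirichlet_series (\<lambda>n. f n * mangoldt n) s = - ((deriv V s * (s - 1) - V s) / (s - 1)\<^sup>2) / (V s / (s - 1))"
        using Df[OF s] by simp
      also have "\<dots> = - deriv V s / V s + 1 / (s - 1)"
      proof -
        have "- ((d * z - v) / z\<^sup>2) / (v / z) = - d / v + 1 / z" if "v \<noteq> 0" "z \<noteq> 0" for d v z :: complex
          using that by (simp add: field_simps power2_eq_square)
        then show ?thesis using s1 nz[of s] s by simp
      qed
      finally have 1: "dirichlet_series (\<lambda>n. f n * mangoldt n) s = - deriv V s / V s + 1 / (s - 1)" .
      have "dirichlet_series (\<lambda>_. 1) s = W s / (s - 1)" using W(3)[OF s] s1 by (simp add: field_simps)
      then have "dirichlet_series (\<lambda>_. 1) s = R s + 1 / (s - 1)" using s1 W(2) by (simp add: R_def diff_divide_distrib)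
      with 1 show "dirichlet_series (\<lambda>n. f n * mangoldt n) s - of_real 1 * dirichlet_series (\<lambda>_. 1) s = - deriv V s / V s - R s"
        by simp
    qed auto
  qed
qed

section \<open>Primes with prescribed values of real characters\<close>

lemma dirichlet_series_continuous:
  assumes a: "summable (\<lambda>n. \<bar>a n\<bar> * real n powr (-1))"
  shows "continuous_on {s. Re s \<ge> 1} (dirichlet_series a)"
proof -
  have "uniform_limit {s. Re s \<ge> 1} (\<lambda>N s. \<Sum>n<N. of_real (a n) * of_nat n powr (-s) :: complex) (dirichlet_series a) sequentially"
    unfolding dirichlet_series_def
  proof (rule Weierstrass_m_test[OF _ a])
    fix n :: nat and s :: complex assume "s \<in> {s. Re s \<ge> 1}"
    then show "norm (of_real (a n) * of_nat n powr (-s) :: complex) \<le> \<bar>a n\<bar> * real n powr (-1)"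
      unfolding norm_mult norm_nat_powr norm_of_real
      by (cases "n = 0") (simp, intro mult_left_mono powr_mono, auto)
  qed
  then show ?thesis
    by (rule uniform_limit_theorem[rotated])
       (auto intro!: always_eventually holomorphic_on_imp_continuous_on holomorphic_intros nat_powr_minus_holomorphic)
qed

text \<open>For k \<ge> 2 and p \<ge> 2 one has ln p / p^k \<le> (ln p / p^2) * 2^(2 - k), so the
  double series is dominated by a product of two convergent series. Injectivity of (p, k) \<mapsto>
  p^k turns it into a series over integers.\<close>

lemma summable_proper_prime_powers: "summable (\<lambda>n. (if prime n then 0 else mangoldt n) * real n powr (-1))"
proof -
  define P where "P = {(p :: nat, k :: nat). prime p \<and> k \<ge> 2}"
  define h where "h = (\<lambda>n. mangoldt n / real n :: real)"
  define u where "u = (\<lambda>p. ln (real p) / real p ^ 2)"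
  define v where "v = (\<lambda>k. (1/2::real) ^ (k - 2))"
  have "dirichlet_abs_conv (\<lambda>n. ln (real n))" by (rule dirichlet_abs_convI[of _ 1]) auto
  then have "summable (\<lambda>n. \<bar>ln (real n)\<bar> * real n powr (-2))" unfolding dirichlet_abs_conv_def by auto
  then have nu: "summable (\<lambda>n. norm (u n))"
    by (rule summable_cong[THEN iffD1, rotated]) (auto simp: u_def powr_minus divide_inverse eventually_sequentially powr_numeral intro!: exI[of _ 1])
  have su: "(\<lambda>n. norm (u n)) summable_on {2..}"
    by (rule summable_on_subset[of _ UNIV]) (use nu in \<open>auto simp: summable_on_UNIV_nonneg_real_iff\<close>)
  have "summable (\<lambda>k. (1/2::real) ^ k)" by (rule summable_geometric) simp
  then have "summable (\<lambda>k. v (k + 2))" by (simp add: v_def)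
  then have nv: "summable v" by (rule summable_iff_shift[THEN iffD1])
  have sv: "(\<lambda>k. norm (v k)) summable_on {2..}"
    by (rule summable_on_subset[of _ UNIV]) (use nv in \<open>auto simp: summable_on_UNIV_nonneg_real_iff v_def\<close>)
  have "((\<lambda>(p, k). u p * v k) has_sum (infsum u {2..} * infsum v {2..})) ({2..} \<times> {2..})"
    using su sv Infinite_Sum.abs_summable_summable[OF su] Infinite_Sum.abs_summable_summable[OF sv]
    by (intro has_sum_prod_mult has_sum_infsum) auto
  then have "(\<lambda>(p, k). u p * v k) summable_on ({2..} \<times> {2..})" by (auto simp: summable_on_def)
  then have "(\<lambda>(p, k). u p * v k) summable_on P"
    by (rule summable_on_subset) (auto simp: P_def dest: prime_ge_2_nat)
  then have "(\<lambda>(p, k). h (p ^ k)) summable_on P"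
  proof (rule summable_on_comparison_test, goal_cases)
    case (1 z)
    obtain p k where z: "z = (p, k)" by force
    with 1 have p: "prime p" "k \<ge> 2" by (auto simp: P_def)
    then have p2: "real p \<ge> 2" using prime_ge_2_nat by force
    obtain j where j: "k = j + 2" using p(2) by (metis add.commute le_Suc_ex)
    have "mangoldt (p ^ k) = ln (real p)" using p by simp
    moreover have "real p ^ k = real p ^ 2 * real p ^ j" by (simp only: j power_add mult.commute)
    ultimately have "h (p ^ k) = ln (real p) / (real p ^ 2 * real p ^ j)" by (simp only: h_def of_nat_power)
    also have "\<dots> = u p * (1 / real p ^ j)" by (simp add: u_def)
    also have "\<dots> \<le> u p * (1 / 2 ^ j)"
      using p2 by (intro mult_left_mono divide_left_mono power_mono) (auto simp: u_def)
    also have "\<dots> = u p * v k" by (simp add: v_def j power_one_over)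
    finally show ?case by (simp add: z)
  next
    case (2 z)
    then show ?case by (cases z) (auto simp: h_def intro!: divide_nonneg_nonneg mangoldt_nonneg)
  qed
  also have "(\<lambda>(p, k). h (p ^ k)) = h \<circ> (\<lambda>(p, k). p ^ k)" by auto
  also have "\<dots> summable_on P \<longleftrightarrow> h summable_on ((\<lambda>(p, k). p ^ k) ` P)"
  proof (rule summable_on_reindex[symmetric], rule inj_onI, clarify)
    fix p k p' k' assume *: "(p, k) \<in> P" "(p', k') \<in> P" "p ^ k = p' ^ k'"
    then have "prime p" "prime p'" "k > 0" "k' > 0" by (auto simp: P_def)
    from prime_power_inj'[OF this(1,2) *(3) this(3,4)] show "p = p' \<and> k = k'" by simp
  qed
  also have "\<dots> \<longleftrightarrow> (\<lambda>n. (if prime n then 0 else mangoldt n) * real n powr (-1)) summable_on UNIV"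
  proof (rule summable_on_cong_neutral)
    fix n :: nat assume n: "n \<in> UNIV - (\<lambda>(p, k). p ^ k) ` P"
    show "(if prime n then 0 else mangoldt n) * real n powr (-1) = 0"
    proof (cases "primepow n \<and> \<not> prime n")
      case True
      then obtain p k where pk: "prime p" "k > 0" "n = p ^ k" by (auto simp: primepow_def)
      then have "k \<noteq> 1" using True by auto
      then have "(p, k) \<in> P" using pk by (auto simp: P_def)
      then show ?thesis using n pk by force
    qed (auto simp: mangoldt_def)
  next
    fix n :: nat assume "n \<in> (\<lambda>(p, k). p ^ k) ` P \<inter> UNIV"
    then obtain p k where pk: "prime p" "k \<ge> 2" "n = p ^ k" by (auto simp: P_def)
    then have "\<not> prime n" using prime_power_iff[of p k] by (auto simp: prime_power_iff)
    then show "h n = (if prime n then 0 else mangoldt n) * real n powr (-1)"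
      by (simp add: h_def powr_minus_divide)
  qed auto
  finally show ?thesis by (rule summable_on_imp_summable)
qed

text \<open>The weight \<Prod> (g i + 1) is nonnegative, and at a prime not dividing M it is nonzero
  only if all g i are 1 there. Expanded over the subsets of I it is a sum of real characters modulo
  M. The empty subset gives the principal character, so the total pole c is at least 1; other
  products that turn out principal only increase it.\<close>

theorem primes_in_log_window_real_chars:
  fixes g :: "'i \<Rightarrow> nat \<Rightarrow> real"
  assumes I: "finite I" and g: "\<And>i. i \<in> I \<Longrightarrow> real_char M (g i)" and M: "M > 1" and \<eta>: "\<eta> > 0"
  shows "eventually (\<lambda>x. \<exists>p. prime p \<and> coprime p M \<and> (\<forall>i\<in>I. g i p = 1) \<and> \<bar>ln (real p) - x\<bar> \<le> \<eta>) at_top"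
proof -
  define f0 where "f0 = (\<lambda>n. if coprime n M then 1 else 0 :: real)"
  have cp: "coprime (n + M) M \<longleftrightarrow> coprime n M" for n unfolding coprime_iff_gcd_eq_1 by simp
  have f0: "real_char M f0"
    using M unfolding real_char_def f0_def by (auto simp: coprime_mult_left_iff cp)
  define f where "f = (\<lambda>A n. f0 n * (\<Prod>i\<in>A. g i n))"
  have f: "real_char M (f A)" if "A \<subseteq> I" for A
    using finite_subset[OF that I] that
  proof (induction A rule: finite_induct)
    case empty
    then show ?case using f0 by (simp add: f_def)
  next
    case (insert i A)
    then have "real_char M (\<lambda>n. g i n * f A n)" using g by (intro real_char_times) auto
    also have "(\<lambda>n. g i n * f A n) = f (insert i A)" using insert.hyps by (auto simp: f_def)
    finally show ?case .
  qed
  define R :: "'i set \<Rightarrow> real \<times> (complex \<Rightarrow> complex) \<Rightarrow> bool" where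
    "R = (\<lambda>A (\<delta>, G). \<delta> \<ge> 0 \<and> ((\<forall>n. f A n \<ge> 0) \<longrightarrow> \<delta> = 1) \<and> continuous_on {s. Re s \<ge> 1} G \<and>
     (\<forall>s. Re s > 1 \<longrightarrow> dirichlet_series (\<lambda>n. f A n * mangoldt n) s - of_real \<delta> * dirichlet_series (\<lambda>_. 1) s = G s))"
  have "\<exists>z. R A z" if "A \<in> Pow I" for A
  proof (rule real_char_log_deriv_continuous[OF f[of A]])
    fix \<delta> G assume "\<delta> \<ge> 0" "(\<And>n. f A n \<ge> 0) \<Longrightarrow> \<delta> = 1" "continuous_on {s. Re s \<ge> 1} G"
      "\<And>s. Re s > 1 \<Longrightarrow> dirichlet_series (\<lambda>n. f A n * mangoldt n) s - of_real \<delta> * dirichlet_series (\<lambda>_. 1) s = G s"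
    then have "R A (\<delta>, G)" unfolding R_def by simp
    then show ?thesis by blast
  qed (use that in simp)
  then have "\<forall>A\<in>Pow I. \<exists>z. R A z" by blast
  from bchoice[OF this] obtain Z where Z: "\<forall>A\<in>Pow I. R A (Z A)" by blast
  define \<delta> where "\<delta> = (\<lambda>A. fst (Z A))"
  define G where "G = (\<lambda>A. snd (Z A))"
  have RZ: "R A (\<delta> A, G A)" if "A \<in> Pow I" for A using Z that by (simp add: \<delta>_def G_def)
  have \<delta>: "\<And>A. A \<in> Pow I \<Longrightarrow> \<delta> A \<ge> 0" "\<And>A. A \<in> Pow I \<Longrightarrow> (\<And>n. f A n \<ge> 0) \<Longrightarrow> \<delta> A = 1"
    and G: "\<And>A. A \<in> Pow I \<Longrightarrow> continuous_on {s. Re s \<ge> 1} (G A)"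
    and DG: "\<And>A s. A \<in> Pow I \<Longrightarrow> Re s > 1 \<Longrightarrow> dirichlet_series (\<lambda>n. f A n * mangoldt n) s - of_real (\<delta> A) * dirichlet_series (\<lambda>_. 1) s = G A s"
    using RZ unfolding R_def prod.case by blast+
  define w where "w = (\<lambda>n. \<Sum>A\<in>Pow I. f A n)"
  have w: "w n = f0 n * (\<Prod>i\<in>I. g i n + 1)" for n
    unfolding w_def f_def using prod_add[OF I, of "\<lambda>i. g i n" "\<lambda>_. 1"] by (simp add: sum_distrib_left)
  have w0: "w n \<ge> 0" for n
  proof -
    have "g i n + 1 \<ge> 0" if "i \<in> I" for i using real_char_cases[OF g[OF that], of n] by auto
    then show ?thesis unfolding w f0_def by (auto intro!: prod_nonneg)
  qed
  \<comment> \<open>Only primes may carry positive coefficients. The proper prime powers go into q,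
    whose series is continuous on Re s \<ge> 1 and is absorbed into the function \<open>G\<close> of
    the Tauberian theorem.\<close>
  define a where "a = (\<lambda>n. w n * (if prime n then mangoldt n else 0))"
  define q where "q = (\<lambda>n. w n * (if prime n then 0 else mangoldt n))"
  have wle: "\<bar>w n\<bar> \<le> 2 ^ card I" for n
  proof -
    have "\<bar>w n\<bar> \<le> (\<Sum>A\<in>Pow I. 1)" unfolding w_def
      by (rule order_trans[OF sum_abs]) (intro sum_mono real_char_abs_le[OF f], auto)
    then show ?thesis using I by (simp add: card_Pow)
  qed
  have wconv: "dirichlet_abs_conv (\<lambda>n. w n * b n)" if b: "\<And>n. 0 \<le> b n" "\<And>n. b n \<le> mangoldt n" for b
  proof (rule dirichlet_abs_convI[of _ "2 ^ card I"])
    fix n :: nat assume n: "n > 0"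
    have "b n \<le> 1 + ln (real n)" using b(2)[of n] mangoldt_le_ln[OF n] by linarith
    then show "\<bar>w n * b n\<bar> \<le> 2 ^ card I * (1 + ln (real n))"
      unfolding abs_mult using wle[of n] b(1)[of n] by (intro mult_mono) auto
  qed
  have ac: "dirichlet_abs_conv a"
    unfolding a_def by (rule wconv) (auto simp: mangoldt_nonneg simp del: mangoldt_prime)
  have qc: "dirichlet_abs_conv q"
    unfolding q_def by (rule wconv) (auto simp: mangoldt_nonneg simp del: mangoldt_prime)
  have q1: "summable (\<lambda>n. \<bar>q n\<bar> * real n powr (-1))"
  proof (rule summable_comparison_test'[where N = 0])
    show "summable (\<lambda>n. 2 ^ card I * ((if prime n then 0 else mangoldt n) * real n powr (-1)) :: real)"
      by (intro summable_mult summable_proper_prime_powers)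
    fix n :: nat
    have "\<bar>w n\<bar> * ((if prime n then 0 else mangoldt n) * real n powr (-1)) \<le> 2 ^ card I * ((if prime n then 0 else mangoldt n) * real n powr (-1))"
      by (intro mult_right_mono wle mult_nonneg_nonneg) (auto simp: mangoldt_nonneg simp del: mangoldt_prime)
    then show "norm (\<bar>q n\<bar> * real n powr (-1)) \<le> 2 ^ card I * ((if prime n then 0 else mangoldt n) * real n powr (-1))"
      by (simp add: q_def abs_mult mangoldt_nonneg)
  qed
  have Daq: "dirichlet_series a s + dirichlet_series q s = (\<Sum>A\<in>Pow I. dirichlet_series (\<lambda>n. f A n * mangoldt n) s)" if s: "Re s > 1" for s
  proof (rule sums_unique2)
    show "(\<lambda>n. of_real (a n) * of_nat n powr (-s) + of_real (q n) * of_nat n powr (-s)) sums (dirichlet_series a s + dirichlet_series q s)"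
      by (intro sums_add dirichlet_series_sums ac qc s)
    have "(\<lambda>n. \<Sum>A\<in>Pow I. of_real (f A n * mangoldt n) * of_nat n powr (-s)) sums (\<Sum>A\<in>Pow I. dirichlet_series (\<lambda>n. f A n * mangoldt n) s)"
      using f by (intro sums_sum dirichlet_series_sums s real_char_abs_conv(2)[where M = M]) auto
    moreover have "(\<Sum>A\<in>Pow I. of_real (f A n * mangoldt n) * of_nat n powr (-s)) = of_real (a n) * of_nat n powr (-s) + of_real (q n) * of_nat n powr (-s)" for n
    proof -
      have "a n + q n = (\<Sum>A\<in>Pow I. f A n * mangoldt n)" by (simp add: a_def q_def w_def sum_distrib_right)
      then have "(of_real (a n) + of_real (q n) :: complex) = (\<Sum>A\<in>Pow I. of_real (f A n * mangoldt n))"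
        by (metis of_real_add of_real_sum)
      then show ?thesis by (simp add: sum_distrib_right[symmetric] distrib_right[symmetric])
    qed
    ultimately show "(\<lambda>n. of_real (a n) * of_nat n powr (-s) + of_real (q n) * of_nat n powr (-s)) sums (\<Sum>A\<in>Pow I. dirichlet_series (\<lambda>n. f A n * mangoldt n) s)"
      by simp
  qed
  define c where "c = (\<Sum>A\<in>Pow I. \<delta> A)"
  have "eventually (\<lambda>x. \<exists>n. a n > 0 \<and> \<bar>ln (real n) - x\<bar> \<le> \<eta>) at_top"
  proof (rule positive_coeff_in_log_window[where c = c and G = "\<lambda>s. (\<Sum>A\<in>Pow I. G A s) - dirichlet_series q s"])
    show a0: "a n \<ge> 0" for n using w0[of n] by (simp add: a_def mangoldt_nonneg del: mangoldt_prime)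
    show "summable (\<lambda>n. a n * real n powr (-\<sigma>))" if "\<sigma> > 1" for \<sigma>
      using ac that a0 unfolding dirichlet_abs_conv_def by simp
    have "\<delta> {} = 1" by (rule \<delta>(2)) (auto simp: f_def f0_def)
    then show "c > 0" unfolding c_def using \<delta>(1) I member_le_sum[of "{}" "Pow I" \<delta>] by simp
    show "continuous_on {s. Re s \<ge> 1} (\<lambda>s. (\<Sum>A\<in>Pow I. G A s) - dirichlet_series q s)"
      by (intro continuous_intros G dirichlet_series_continuous q1)
    fix s :: complex assume s: "Re s > 1"
    have "(\<Sum>A\<in>Pow I. G A s) = (\<Sum>A\<in>Pow I. dirichlet_series (\<lambda>n. f A n * mangoldt n) s - of_real (\<delta> A) * dirichlet_series (\<lambda>_. 1) s)"
      by (intro sum.cong DG[symmetric] s) auto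
    also have "\<dots> = dirichlet_series a s + dirichlet_series q s - of_real c * dirichlet_series (\<lambda>_. 1) s"
      by (simp add: sum_subtractf Daq[OF s] c_def sum_distrib_right)
    finally show "dirichlet_series a s - of_real c * dirichlet_series (\<lambda>_. 1) s = (\<Sum>A\<in>Pow I. G A s) - dirichlet_series q s"
      by simp
  qed (rule \<eta>)
  then show ?thesis
  proof (rule eventually_mono)
    fix x assume "\<exists>n. a n > 0 \<and> \<bar>ln (real n) - x\<bar> \<le> \<eta>"
    then obtain p where p: "a p > 0" "\<bar>ln (real p) - x\<bar> \<le> \<eta>" by blast
    then have "prime p" "w p \<noteq> 0" by (auto simp: a_def split: if_splits)
    then have "f0 p \<noteq> 0" "(\<Prod>i\<in>I. g i p + 1) \<noteq> 0" unfolding w by auto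
    then have cop: "coprime p M" and "\<And>i. i \<in> I \<Longrightarrow> g i p \<noteq> -1"
      using I by (auto simp: f0_def split: if_splits)
    then have "g i p = 1" if "i \<in> I" for i
      using g[OF that] that unfolding real_char_def by blast
    with cop show "\<exists>p. prime p \<and> coprime p M \<and> (\<forall>i\<in>I. g i p = 1) \<and> \<bar>ln (real p) - x\<bar> \<le> \<eta>"
      using \<open>prime p\<close> p(2) by blast
  qed
qed

section \<open>Primes modulo which given integers are squares\<close>

lemma real_char_restrict:
  fixes h :: "nat \<Rightarrow> real"
  assumes M: "M > 1" and mult: "\<And>m n. coprime m M \<Longrightarrow> coprime n M \<Longrightarrow> h (m * n) = h m * h n"
    and per: "\<And>n. h (n + M) = h n" and vals: "\<And>n. coprime n M \<Longrightarrow> h n = 1 \<or> h n = -1"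
  shows "real_char M (\<lambda>n. if coprime n M then h n else 0)"
proof -
  have cp: "coprime (n + M) M \<longleftrightarrow> coprime n M" for n unfolding coprime_iff_gcd_eq_1 by simp
  show ?thesis
    using assms unfolding real_char_def by (auto simp: coprime_mult_left_iff cp)
qed

section \<open>Legendre symbols and explicit squares\<close>

lemma cong_small_int_eq:
  fixes a b :: int
  assumes "[a = b] (mod p)" "\<bar>a\<bar> \<le> 1" "\<bar>b\<bar> \<le> 1" "p > 2"
  shows "a = b"
proof -
  have "p dvd (a - b)" using assms(1) by (simp add: cong_iff_dvd_diff)
  moreover have "\<bar>a - b\<bar> < p" using assms by linarith
  ultimately have "a - b = 0" using zdvd_not_zless[of "\<bar>a - b\<bar>" p] by (metis abs_ge_zero abs_eq_0 dvd_abs_iff order_le_less)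
  then show ?thesis by simp
qed

lemma Legendre_abs_le: "\<bar>Legendre a p\<bar> \<le> 1"
  by (simp add: Legendre_def)

text \<open>Euler's criterion makes both sides congruent modulo q, and congruent integers of
  absolute value at most 1 are equal when q > 2.\<close>

lemma Legendre_mult:
  assumes "prime q" "2 < q"
  shows "Legendre (a * b) (int q) = Legendre a (int q) * Legendre b (int q)"
proof (rule cong_small_int_eq)
  let ?k = "(q - 1) div 2"
  have "[Legendre a q * Legendre b q = a ^ ?k * b ^ ?k] (mod q)"
    by (intro cong_mult euler_criterion assms)
  also have "a ^ ?k * b ^ ?k = (a * b) ^ ?k" by (simp add: power_mult_distrib)
  finally show "[Legendre (a * b) q = Legendre a q * Legendre b q] (mod q)"
    using euler_criterion[OF assms, of "a * b"] cong_sym cong_trans by blast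
  show "\<bar>Legendre a q * Legendre b q\<bar> \<le> 1"
    unfolding abs_mult using mult_mono[OF Legendre_abs_le[of a q] Legendre_abs_le[of b q]] by simp
qed (use assms in \<open>auto simp: Legendre_abs_le\<close>)

lemma Legendre_cong: "[a = b] (mod p) \<Longrightarrow> Legendre a p = Legendre b p"
proof -
  assume ab: "[a = b] (mod p)"
  have "[y = a] (mod p) \<longleftrightarrow> [y = b] (mod p)" for y using ab cong_trans cong_sym by blast
  moreover from this[of 0] have "[a = 0] (mod p) \<longleftrightarrow> [b = 0] (mod p)" using cong_sym by blast
  ultimately show ?thesis by (simp add: Legendre_def QuadRes_def)
qed

lemma QuadRes_mult: "QuadRes p a \<Longrightarrow> QuadRes p b \<Longrightarrow> QuadRes p (a * b)"
proof -
  assume "QuadRes p a" "QuadRes p b"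
  then obtain y z where "[y\<^sup>2 = a] (mod p)" "[z\<^sup>2 = b] (mod p)" unfolding QuadRes_def by blast
  from cong_mult[OF this] have "[(y * z)\<^sup>2 = a * b] (mod p)" by (simp add: power_mult_distrib)
  then show ?thesis unfolding QuadRes_def by blast
qed

lemma QuadRes_of_euler:
  assumes p: "prime p" "2 < p" and a: "[a ^ ((p - 1) div 2) = 1] (mod int p)"
  shows "QuadRes (int p) a"
proof -
  have "[Legendre a p = 1] (mod p)" using euler_criterion[OF p, of a] a cong_trans by blast
  then have "Legendre a p = 1" by (rule cong_small_int_eq) (use p in \<open>auto simp: Legendre_abs_le\<close>)
  then show ?thesis by (auto simp: Legendre_def split: if_splits)
qed

text \<open>If i^2 = -1 then (1 + i)^2 = 2 i, hence 2 = - i (1 + i)^2. Here -1 is a square because 4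
  divides p - 1, and i is a square because 8 does, both by Euler's criterion.\<close>

lemma QuadRes_minus_one_and_two:
  assumes p: "prime p" "p mod 8 = 1"
  shows "QuadRes (int p) (-1)" "QuadRes (int p) 2"
proof -
  have p2: "2 < p" using p prime_ge_2_nat[OF p(1)] by (cases "p = 2") auto
  obtain k where k: "p = 8 * k + 1" using p(2) by (metis mod_eq_nat1E div_mult_mod_eq mult.commute)
  have half: "(p - 1) div 2 = 4 * k" using k by simp
  show m1: "QuadRes (int p) (-1)"
    by (rule QuadRes_of_euler[OF p(1) p2]) (subst half, simp add: power_mult)
  then obtain i where i: "[i\<^sup>2 = -1] (mod p)" by (auto simp: QuadRes_def)
  have "[(i\<^sup>2)\<^sup>2 = (-1)\<^sup>2] (mod p)" by (intro cong_pow i)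
  then have "[i ^ 4 = 1] (mod p)" by (simp flip: power_mult)
  then have "[(i ^ 4) ^ k = 1 ^ k] (mod p)" by (rule cong_pow)
  then have "QuadRes (int p) i"
    by (intro QuadRes_of_euler[OF p(1) p2]) (subst half, simp add: power_mult)
  moreover have "QuadRes (int p) ((1 + i)\<^sup>2)" unfolding QuadRes_def by (intro exI[of _ "1 + i"]) simp
  ultimately have "QuadRes (int p) (-1 * (i * (1 + i)\<^sup>2))" using m1 by (intro QuadRes_mult)
  moreover have "[-1 * (i * (1 + i)\<^sup>2) = 2] (mod p)"
  proof -
    have "-1 * (i * (1 + i)\<^sup>2) - 2 = - (i + 2) * (i\<^sup>2 - (-1))"
      by (simp add: power2_eq_square algebra_simps)
    then show ?thesis using i by (metis cong_iff_dvd_diff dvd_mult)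
  qed
  ultimately show "QuadRes (int p) 2" unfolding QuadRes_def using cong_trans by blast
qed

text \<open>Squares are closed under products, so -1 and the primes up to N are enough. Once p is 1
  modulo 8, reciprocity has no sign, and the condition at an odd prime q becomes the value at p of
  the Legendre character modulo q, whose modulus divides M.\<close>

theorem primes_with_small_squares:
  fixes N :: nat
  assumes \<eta>: "\<eta> > 0"
  shows "eventually (\<lambda>x. \<exists>p. prime p \<and> \<bar>ln (real p) - x\<bar> \<le> \<eta> \<and> (\<forall>a::int. \<bar>a\<bar> \<le> int N \<longrightarrow> QuadRes (int p) a)) at_top"
proof -
  define M :: nat where "M = 8 * fact N"
  have "fact N > (0::nat)" by simp
  then have M: "M > 1" unfolding M_def by linarith
  have dM: "8 dvd M" by (simp add: M_def)
  have qM: "q dvd M" if "1 \<le> q" "q \<le> N" for q unfolding M_def using that by (simp add: dvd_fact)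
  \<comment> \<open>The indices 0 and 1, not being primes, are free to carry the characters modulo 4
    and modulo 8 that together force p mod 8 = 1. All remaining indices give the principal
    character.\<close>
  define h :: "nat \<Rightarrow> nat \<Rightarrow> real" where "h = (\<lambda>q n.
     if q = 0 then (if n mod 4 = 1 then 1 else -1)
     else if q = 1 then (if n mod 8 = 1 \<or> n mod 8 = 7 then 1 else -1)
     else if prime q \<and> 2 < q \<and> q \<le> N then of_int (Legendre (int n) (int q)) else 1)"
  define g where "g = (\<lambda>q n. if coprime n M then h q n else 0)"
  have odd: "n mod 8 \<in> {1, 3, 5, 7}" if "coprime n M" for n
  proof -
    have "coprime n 8" using that dM coprime_divisors[of n n 8 M] by auto
    then have "odd n" by (metis coprime_common_divisor even_numeral odd_one)
    then have "n mod 8 = 1 \<or> n mod 8 = 3 \<or> n mod 8 = 5 \<or> n mod 8 = 7" by presburger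
    then show ?thesis by simp
  qed
  have M4: "(n + M) mod 8 = n mod 8" "(n + M) mod 4 = n mod 4" for n
  proof -
    have "4 dvd M" using dM by presburger
    then show "(n + M) mod 8 = n mod 8" "(n + M) mod 4 = n mod 4" using dM by (auto simp: mod_add_right_eq[symmetric])
  qed
  have g: "real_char M (g q)" for q
    unfolding g_def
  proof (rule real_char_restrict[OF M])
    fix m n assume mn: "coprime m M" "coprime n M"
    consider "q = 0" | "q = 1" | "prime q" "2 < q" "q \<le> N" | "q \<noteq> 0" "q \<noteq> 1" "\<not> (prime q \<and> 2 < q \<and> q \<le> N)" by blast
    then show "h q (m * n) = h q m * h q n"
    proof cases
      case 1
      have "m mod 8 mod 4 = m mod 4" "n mod 8 mod 4 = n mod 4" by (simp_all add: mod_mod_cancel)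
      then have "m mod 4 \<in> {1, 3}" "n mod 4 \<in> {1, 3}" using odd[OF mn(1)] odd[OF mn(2)] by auto
      moreover have mn4: "m * n mod 4 = (m mod 4) * (n mod 4) mod 4" by (simp add: mod_mult_eq)
      moreover have h0: "h 0 k = (if k mod 4 = 1 then 1 else -1)" for k
        unfolding h_def by (simp only: if_True refl simp_thms)
      ultimately show ?thesis unfolding 1 h0 mn4 by (elim insertE emptyE) simp_all
    next
      case 2
      have mn8: "m * n mod 8 = (m mod 8) * (n mod 8) mod 8" by (simp add: mod_mult_eq)
      have h1: "h 1 k = (if k mod 8 = 1 \<or> k mod 8 = 7 then 1 else -1)" for k
        unfolding h_def by (simp only: if_True if_False one_neq_zero refl simp_thms)
      show ?thesis
        using odd[OF mn(1)] odd[OF mn(2)] unfolding 2 h1 mn8 by (elim insertE emptyE) simp_all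
    next
      case 3
      then show ?thesis using Legendre_mult[of q "int m" "int n"] by (simp add: h_def)
    qed (auto simp: h_def)
  next
    fix n
    show "h q (n + M) = h q n"
    proof -
      have "Legendre (int (n + M)) (int q) = Legendre (int n) (int q)" if "prime q" "2 < q" "q \<le> N"
      proof (rule Legendre_cong)
        have "int q dvd int M" using qM[of q] that by simp
        then show "[int (n + M) = int n] (mod int q)" by (simp add: cong_iff_dvd_diff)
      qed
      then show ?thesis unfolding h_def by (simp only: M4) simp
    qed
  next
    fix n assume n: "coprime n M"
    have "Legendre (int n) (int q) \<noteq> 0" if "prime q" "2 < q" "q \<le> N"
    proof -
      have "coprime n q" using n qM[of q] that coprime_divisors[of n n q M] by auto
      then have "\<not> q dvd n" using that by (metis coprime_absorb_right nat_dvd_1_iff_1 not_prime_1)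
      then show ?thesis by (auto simp: Legendre_def cong_0_iff)
    qed
    moreover have "Legendre (int n) (int q) \<in> {0, 1, -1}" by (simp add: Legendre_def)
    ultimately show "h q n = 1 \<or> h q n = -1" by (auto simp: h_def)
  qed
  have "eventually (\<lambda>x. \<exists>p. prime p \<and> coprime p M \<and> (\<forall>q\<in>{..N + 1}. g q p = 1) \<and> \<bar>ln (real p) - x\<bar> \<le> \<eta>) at_top"
    by (rule primes_in_log_window_real_chars) (use g M \<eta> in auto)
  then show ?thesis
  proof (rule eventually_mono, elim exE conjE)
    fix x p assume p: "prime p" "coprime p M" "\<forall>q\<in>{..N + 1}. g q p = 1" "\<bar>ln (real p) - x\<bar> \<le> \<eta>"
    then have hp: "h q p = 1" if "q \<le> N + 1" for q using that by (auto simp: g_def)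
    have "p mod 8 = 1"
    proof -
      have h01: "h 0 p = (if p mod 4 = 1 then 1 else -1)"
        "h 1 p = (if p mod 8 = 1 \<or> p mod 8 = 7 then 1 else -1)"
        unfolding h_def by (simp_all only: if_True if_False one_neq_zero refl simp_thms)
      have "1 \<noteq> (-1 :: real)" by simp
      then have "p mod 4 = 1" "p mod 8 = 1 \<or> p mod 8 = 7"
        using h01 hp[of 0] hp[of 1] by (metis le_add2 zero_le)+
      then show ?thesis by presburger
    qed
    note m1 = QuadRes_minus_one_and_two[OF p(1) this]
    have p2: "2 < p" using \<open>p mod 8 = 1\<close> prime_ge_2_nat[OF p(1)] by (cases "p = 2") auto
    have prime: "QuadRes (int p) (int q)" if q: "prime q" "q \<le> N" for q
    proof (cases "q = 2")
      case False
      then have q2: "2 < q" using prime_ge_2_nat[OF q(1)] by simp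
      have "p \<noteq> q" using p(1,2) qM[of q] q2 q by (metis coprime_absorb_left less_imp_le nat_dvd_1_iff_1 not_prime_1 order_trans one_le_numeral)
      \<comment> \<open>(p - 1) / 2 is a multiple of 4, so the exponent in the reciprocity law is
        even.\<close>
      have e: "(p - 1) div 2 * ((q - 1) div 2) = 2 * (2 * (p div 8) * ((q - 1) div 2))"
      proof -
        have "p = 8 * (p div 8) + 1" using \<open>p mod 8 = 1\<close> by (metis div_mult_mod_eq mult.commute)
        then have "(p - 1) div 2 = 4 * (p div 8)" by linarith
        then show ?thesis by simp
      qed
      have "Legendre p q * Legendre q p = (-1) ^ (2 * (2 * (p div 8) * ((q - 1) div 2)))"
        using Quadratic_Reciprocity[OF p(1) p2 q(1) q2 \<open>p \<noteq> q\<close>] unfolding e .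
      moreover have "Legendre p q = 1" using hp[of q] q q2 by (simp add: h_def)
      ultimately have "Legendre q p = 1" by simp
      then show ?thesis by (auto simp: Legendre_def split: if_splits)
    qed (use m1 in simp)
    have nat: "QuadRes (int p) (int a)" if "a \<le> N" for a
      using that
    proof (induction a rule: less_induct)
      case (less a)
      consider "a = 0" | "a = 1" | "a > 1" by linarith
      then show ?case
      proof cases
        case 1
        then show ?thesis unfolding QuadRes_def by (intro exI[of _ 0]) simp
      next
        case 2
        then show ?thesis unfolding QuadRes_def by (intro exI[of _ 1]) simp
      next
        case 3
        then obtain q where q: "prime q" "q dvd a" by (metis prime_factor_nat less_irrefl)
        then obtain b where b: "a = q * b" by (elim dvdE)
        with 3 have "b > 0" by (cases b) auto
        then have "b < a" "q \<le> a" using b prime_gt_1_nat[OF q(1)] by auto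
        then have "QuadRes (int p) (int q * int b)"
          using less.prems q \<open>b < a\<close> \<open>q \<le> a\<close> by (intro QuadRes_mult prime[OF q(1)] less.IH) auto
        then show ?thesis by (simp add: b)
      qed
    qed
    have "QuadRes (int p) a" if "\<bar>a\<bar> \<le> int N" for a
    proof (cases "a \<ge> 0")
      case True
      then show ?thesis using nat[of "nat a"] that by simp
    next
      case False
      then have "QuadRes (int p) (-1 * int (nat (-a)))" using nat[of "nat (-a)"] that m1 by (intro QuadRes_mult) auto
      then show ?thesis using False by simp
    qed
    then show "\<exists>p. prime p \<and> \<bar>ln (real p) - x\<bar> \<le> \<eta> \<and> (\<forall>a::int. \<bar>a\<bar> \<le> int N \<longrightarrow> QuadRes (int p) a)"
      using p by blast
  qed
qed

section \<open>Curves with isotropic points at infinity\<close>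

text \<open>Lagrange's bound on roots over F_p, kept in the integers. The conclusion speaks of
  values rather than coefficients because the polynomial is going to be evaluated at the poles of
  the curve.\<close>

lemma int_poly_many_roots_mod_prime:
  fixes P :: "int poly" and p :: int
  assumes "prime p" "finite R" "degree P < card R" "inj_on (\<lambda>t. t mod p) R" "\<And>t. t \<in> R \<Longrightarrow> p dvd poly P t"
  shows "p dvd poly P t"
  using assms(2-)
proof (induction "degree P" arbitrary: P R t)
  case 0
  then obtain c where c: "P = [:c:]" by (metis degree_eq_zeroE)
  obtain a where "a \<in> R" using 0 by fastforce
  with 0(5)[OF this] show ?case by (simp add: c)
next
  case (Suc n)
  obtain a where a: "a \<in> R" using Suc.prems by fastforce
  define S where "S = synthetic_div P a"
  have PS: "poly P t = (t - a) * poly S t + poly P a" for t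
    using arg_cong[OF synthetic_div_correct'[of a P], of "\<lambda>q. poly q t"] by (simp add: S_def algebra_simps)
  have "p dvd poly S t" for t
  proof (rule Suc.hyps(1)[of S "R - {a}"])
    show "n = degree S" using Suc.hyps(2) by (simp add: S_def degree_synthetic_div)
    then show "degree S < card (R - {a})" using Suc.prems(1,2) Suc.hyps(2) a by (simp add: card_Diff_singleton)
    show "inj_on (\<lambda>t. t mod p) (R - {a})" using Suc.prems(3) by (rule inj_on_subset) auto
    fix t assume t: "t \<in> R - {a}"
    then have "t mod p \<noteq> a mod p" using Suc.prems(3) a by (auto dest: inj_onD)
    then have "\<not> p dvd (t - a)" by (simp add: mod_eq_dvd_iff)
    moreover have "p dvd (t - a) * poly S t"
      using PS[of t] Suc.prems(4)[of t] Suc.prems(4)[OF a] t by (metis DiffD1 add_diff_cancel_right' dvd_diff)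
    ultimately show "p dvd poly S t" using assms(1) by (simp add: prime_dvd_mult_iff)
  qed (use Suc.prems in auto)
  then show ?case using PS[of t] Suc.prems(4)[OF a] by simp
qed

text \<open>A \<open>\<rat>\<close>-linear functional obtained from a Hamel basis transports real relations between rational
  vectors to rational ones.\<close>

lemma exists_rat_linear_functional:
  fixes c :: real
  assumes "c \<noteq> 0"
  obtains \<phi> :: "real \<Rightarrow> rat" where "\<phi> c = 1" "\<And>x y. \<phi> (x + y) = \<phi> x + \<phi> y" "\<And>q x. \<phi> (of_rat q * x) = q * \<phi> x"
proof -
  interpret R: vector_space "\<lambda>(q::rat) (x::real). of_rat q * x"
    by unfold_locales (auto simp: algebra_simps of_rat_add of_rat_mult)
  interpret V: vector_space_pair "\<lambda>(q::rat) (x::real). of_rat q * x" "\<lambda>(q::rat) (x::rat). q * x"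
    by unfold_locales (auto simp: algebra_simps)
  have "R.independent {c}" using assms by simp
  then obtain \<phi> where \<phi>: "Vector_Spaces.linear (\<lambda>(q::rat) (x::real). of_rat q * x) (\<lambda>(q::rat) (x::rat). q * x) \<phi>" "\<phi> c = 1"
    using V.linear_independent_extend[of "{c}" "\<lambda>_. 1"] by auto
  interpret L: Vector_Spaces.linear "\<lambda>(q::rat) (x::real). of_rat q * x" "\<lambda>(q::rat) (x::rat). q * x" \<phi> by (rule \<phi>(1))
  show ?thesis using that[of \<phi>] \<phi>(2) L.add L.scale by blast
qed

text \<open>A \<rat>-linear functional normalised at a nonzero coefficient turns the relation into a
  rational one that is still nontrivial. Clearing denominators and then dividing by the gcd of the
  coefficients leaves one that p does not divide.\<close>

lemma real_relation_imp_int_relation: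
  fixes c :: "'k \<Rightarrow> real" and Y :: "('k \<Rightarrow> int) set" and p :: int
  assumes K: "finite K" and c: "\<exists>k\<in>K. c k \<noteq> 0" and p: "prime p"
    and rel: "\<And>y. y \<in> Y \<Longrightarrow> (\<Sum>k\<in>K. c k * of_int (y k)) = 0"
  obtains e :: "'k \<Rightarrow> int" where "\<exists>k\<in>K. \<not> p dvd e k" "\<And>y. y \<in> Y \<Longrightarrow> (\<Sum>k\<in>K. e k * y k) = 0"
proof -
  obtain k0 where k0: "k0 \<in> K" "c k0 \<noteq> 0" using c by blast
  obtain \<phi> :: "real \<Rightarrow> rat" where \<phi>: "\<phi> (c k0) = 1" "\<And>x y. \<phi> (x + y) = \<phi> x + \<phi> y" "\<And>q x. \<phi> (of_rat q * x) = q * \<phi> x"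
    using exists_rat_linear_functional[OF k0(2)] by blast
  have \<phi>0: "\<phi> 0 = 0" using \<phi>(3)[of 0 0] by simp
  have \<phi>sum: "\<phi> (sum f K) = (\<Sum>k\<in>K. \<phi> (f k))" for f
    using K by (induction K rule: finite_induct) (auto simp: \<phi>0 \<phi>(2))
  define r where "r = (\<lambda>k. \<phi> (c k))"
  have r: "(\<Sum>k\<in>K. r k * of_int (y k)) = 0" if "y \<in> Y" for y
  proof -
    have "\<phi> (c k * of_int (y k)) = r k * of_int (y k)" for k
      using \<phi>(3)[of "of_int (y k)" "c k"] by (simp add: r_def mult.commute)
    then show ?thesis using \<phi>sum[of "\<lambda>k. c k * of_int (y k)"] rel[OF that] \<phi>0 by simp
  qed
  define den where "den = (\<lambda>k. snd (quotient_of (r k)))"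
  define num where "num = (\<lambda>k. fst (quotient_of (r k)))"
  have rk: "r k = of_int (num k) / of_int (den k)" "den k > 0" for k
    using quotient_of_div[of "r k" "num k" "den k"] quotient_of_denom_pos[of "r k" "num k" "den k"] by (auto simp: num_def den_def)
  define E where "E = (\<Prod>k\<in>K. den k)"
  have E: "E > 0" unfolding E_def using rk(2) by (intro prod_pos) auto
  define d where "d = (\<lambda>k. num k * (\<Prod>j\<in>K - {k}. den j))"
  have d: "of_int (d k) = of_int E * r k" if "k \<in> K" for k
  proof -
    have "E = den k * (\<Prod>j\<in>K - {k}. den j)" unfolding E_def using K that by (rule prod.remove)
    then show ?thesis using rk[of k] by (simp add: d_def)
  qed
  have rel_d: "(\<Sum>k\<in>K. d k * y k) = 0" if "y \<in> Y" for y
  proof -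
    have "(of_int (\<Sum>k\<in>K. d k * y k) :: rat) = (\<Sum>k\<in>K. of_int E * (r k * of_int (y k)))"
      by (simp add: d mult.assoc)
    also have "\<dots> = of_int E * (\<Sum>k\<in>K. r k * of_int (y k))" by (simp only: sum_distrib_left)
    also have "\<dots> = 0" using r[OF that] by simp
    finally show ?thesis by (simp only: of_int_eq_0_iff)
  qed
  have dk0: "d k0 \<noteq> 0"
  proof
    assume "d k0 = 0"
    then have "of_int E * r k0 = 0" using d[OF k0(1)] by simp
    then show False using E \<phi>(1) by (simp add: r_def)
  qed
  define g where "g = Gcd (d ` K)"
  have gd: "g dvd d k" if "k \<in> K" for k unfolding g_def using that by (intro Gcd_dvd) auto
  have g0: "g \<noteq> 0" using gd[OF k0(1)] dk0 by auto
  define e where "e = (\<lambda>k. d k div g)"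
  have de: "d k = g * e k" if "k \<in> K" for k using gd[OF that] by (simp add: e_def)
  show ?thesis
  proof (rule that[of e])
    show "\<exists>k\<in>K. \<not> p dvd e k"
    proof (rule ccontr)
      assume "\<not> (\<exists>k\<in>K. \<not> p dvd e k)"
      then have "g * p dvd d k" if "k \<in> K" for k using de[OF that] that by auto
      then have "g * p dvd g" unfolding g_def by (intro Gcd_greatest) (auto simp: g_def)
      then have "p dvd 1" using g0 by simp
      then show False using p by (simp add: not_prime_unit)
    qed
    fix y assume y: "y \<in> Y"
    have "g * (\<Sum>k\<in>K. e k * y k) = (\<Sum>k\<in>K. d k * y k)"
      unfolding sum_distrib_left by (intro sum.cong) (auto simp: de mult.assoc)
    then show "(\<Sum>k\<in>K. e k * y k) = 0" using rel_d[OF y] g0 by simp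
  qed
qed

abbreviation qform :: "('d::finite \<Rightarrow> 'd \<Rightarrow> int) \<Rightarrow> ('d \<Rightarrow> int) \<Rightarrow> int" where
  "qform B x \<equiv> \<Sum>i\<in>UNIV. \<Sum>j\<in>UNIV. B i j * x i * x j"

text \<open>Integers stand for residues modulo p throughout. \<open>dual\<close> and
  \<open>indep\<close> are two faces of the invertibility of v modulo p: no nonzero functional kills
  every v k, and no nontrivial combination of them vanishes. The former trivialises relations, the
  latter separates points of the curve.\<close>

locale isotropic_curve =
  fixes p :: int and B :: "'d::finite \<Rightarrow> 'd \<Rightarrow> int" and v :: "'d \<Rightarrow> 'd \<Rightarrow> int" and \<alpha> :: "'d \<Rightarrow> int" and j0 :: 'd
  assumes p: "prime p"
    and iso: "\<And>k. k \<noteq> j0 \<Longrightarrow> p dvd (qform B (v k))"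
    and aniso: "\<not> p dvd (qform B (v j0))"
    and dual: "\<And>c. (\<And>k. p dvd (\<Sum>i\<in>UNIV. c i * v k i)) \<Longrightarrow> p dvd c i"
    and indep: "\<And>l. (\<And>i. p dvd (\<Sum>k\<in>UNIV. l k * v k i)) \<Longrightarrow> p dvd l k"
    and poles: "\<And>k l. k \<noteq> l \<Longrightarrow> \<not> p dvd (\<alpha> k - \<alpha> l)"
begin

text \<open>\<open>G {}\<close> is the common denominator of the curve, and \<open>G A\<close>
  divided by it is the product of 1 / (t - \<alpha> l) over l in A.\<close>

definition G :: "'d set \<Rightarrow> int poly" where
  "G A = (\<Prod>l\<in>- A. [:- \<alpha> l, 1:])"

definition good :: "int \<Rightarrow> bool" where
  "good t \<longleftrightarrow> (\<forall>k. \<not> p dvd (t - \<alpha> k))"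

text \<open>\<open>x\<close> is the point \<open>\<Sum>\<^sub>k v\<^sub>k / (t - \<alpha>\<^sub>k)\<close> modulo \<open>p\<close>.\<close>

definition on_curve :: "int \<Rightarrow> ('d \<Rightarrow> int) \<Rightarrow> bool" where
  "on_curve t x \<longleftrightarrow> (\<forall>i. [poly (G {}) t * x i = (\<Sum>k\<in>UNIV. v k i * poly (G {k}) t)] (mod p))"

lemma poly_G: "poly (G A) t = (\<Prod>l\<in>- A. (t - \<alpha> l))"
  unfolding G_def by (simp add: poly_prod algebra_simps)

lemma degree_G: "degree (G A) \<le> card (- A)"
proof -
  have "degree (G A) \<le> (\<Sum>l\<in>- A. (degree \<circ> (\<lambda>l. [:- \<alpha> l, 1:])) l)"
    unfolding G_def by (rule degree_prod_sum_le) simp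
  then show ?thesis by simp
qed

lemma poly_G_insert: "k \<notin> A \<Longrightarrow> poly (G A) t = (t - \<alpha> k) * poly (G (insert k A)) t"
proof -
  assume k: "k \<notin> A"
  have "- A = insert k (- insert k A)" using k by auto
  then show ?thesis unfolding poly_G by (subst \<open>- A = _\<close>, subst prod.insert) auto
qed

lemma good_G: "good t \<Longrightarrow> \<not> p dvd poly (G A) t"
  unfolding poly_G good_def using p by (simp add: prime_dvd_prod_iff)

lemma G_at_pole: "\<not> p dvd poly (G {k}) (\<alpha> k)" "l \<noteq> k \<Longrightarrow> poly (G {l}) (\<alpha> k) = 0" "poly (G {}) (\<alpha> k) = 0"
  unfolding poly_G using p poles[of k] by (auto simp: prime_dvd_prod_iff)

text \<open>Multiplied by the denominator, the relation becomes a polynomial of degree at most d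
  with d + 1 roots modulo p, so all its values vanish modulo p. At the pole \<alpha> k only the
  residue \<open>w k\<close>, the pairing of c with v k, survives.\<close>

lemma linear_relation_trivial:
  assumes T: "finite T" "card T \<ge> CARD('d) + 1" "inj_on (\<lambda>t. t mod p) T" "\<And>t. t \<in> T \<Longrightarrow> good t"
    and x: "\<And>t. t \<in> T \<Longrightarrow> on_curve t (x t)"
    and rel: "\<And>t. t \<in> T \<Longrightarrow> p dvd c0 + (\<Sum>i\<in>UNIV. c i * x t i)"
  shows "p dvd c0" "p dvd c i"
proof -
  define w where "w = (\<lambda>k. \<Sum>i\<in>UNIV. c i * v k i)"
  define R where "R = Polynomial.smult c0 (G {}) + (\<Sum>k\<in>UNIV. Polynomial.smult (w k) (G {k}))"
  have Rt: "poly R t = c0 * poly (G {}) t + (\<Sum>k\<in>UNIV. w k * poly (G {k}) t)" for t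
    by (simp add: R_def poly_sum)
  have "degree R \<le> CARD('d)"
    unfolding R_def
  proof (intro degree_add_le degree_sum_le order_trans[OF degree_smult_le])
    show "degree (G {}) \<le> CARD('d)" using degree_G[of "{}"] by simp
    show "degree (G {k}) \<le> CARD('d)" for k by (rule order_trans[OF degree_G card_mono]) auto
  qed auto
  then have deg: "degree R < card T" using T by simp
  have all: "p dvd poly R t" for t
  proof (rule int_poly_many_roots_mod_prime[OF p T(1) deg T(3)])
    fix t assume t: "t \<in> T"
    have "[(\<Sum>i\<in>UNIV. c i * (poly (G {}) t * x t i)) = (\<Sum>i\<in>UNIV. c i * (\<Sum>k\<in>UNIV. v k i * poly (G {k}) t))] (mod p)"
      using x[OF t] unfolding on_curve_def by (intro cong_sum cong_mult cong_refl) auto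
    also have "(\<Sum>i\<in>UNIV. c i * (\<Sum>k\<in>UNIV. v k i * poly (G {k}) t)) = (\<Sum>k\<in>UNIV. w k * poly (G {k}) t)"
      unfolding w_def sum_distrib_left sum_distrib_right by (subst sum.swap) (simp add: mult_ac)
    finally have "[c0 * poly (G {}) t + (\<Sum>i\<in>UNIV. c i * (poly (G {}) t * x t i)) = poly R t] (mod p)"
      unfolding Rt by (intro cong_add cong_refl)
    moreover have "c0 * poly (G {}) t + (\<Sum>i\<in>UNIV. c i * (poly (G {}) t * x t i)) = poly (G {}) t * (c0 + (\<Sum>i\<in>UNIV. c i * x t i))"
      by (simp add: algebra_simps sum_distrib_left)
    ultimately show "p dvd poly R t" using rel[OF t] by (metis cong_dvd_iff dvd_mult)
  qed
  have "p dvd w k" for k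
  proof -
    have "poly R (\<alpha> k) = w k * poly (G {k}) (\<alpha> k)"
      unfolding Rt using G_at_pole by (subst sum.remove[of _ k]) auto
    then show ?thesis using all[of "\<alpha> k"] G_at_pole(1)[of k] p by (simp add: prime_dvd_mult_iff)
  qed
  then show ci: "p dvd c i" for i unfolding w_def by (rule dual)
  obtain t where "t \<in> T" using T by fastforce
  from rel[OF this] ci show "p dvd c0" by (metis (no_types, lifting) dvd_add_left_iff dvd_mult2 dvd_sum)
qed

text \<open>Isotropy removes all double poles but the one at \<alpha> j0, so one factor t - \<alpha>
  j0 beyond \<open>G {}\<close> clears the denominators, and the numerator has degree at most d + 1.
  Having d + 2 roots, it vanishes modulo p everywhere. At \<alpha> j0 only c' times the anisotropic
  value times a unit remains, whence c' vanishes and the relation is affine.\<close>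

lemma quadratic_relation_trivial:
  assumes T: "finite T" "card T \<ge> CARD('d) + 2" "inj_on (\<lambda>t. t mod p) T" "\<And>t. t \<in> T \<Longrightarrow> good t"
    and x: "\<And>t. t \<in> T \<Longrightarrow> on_curve t (x t)"
    and rel: "\<And>t. t \<in> T \<Longrightarrow> p dvd c0 + (\<Sum>i\<in>UNIV. c i * x t i) + c' * (qform B (x t))"
  shows "p dvd c0" "p dvd c i" "p dvd c'"
proof -
  define w where "w = (\<lambda>k. \<Sum>i\<in>UNIV. c i * v k i)"
  define b where "b = (\<lambda>k l. \<Sum>i\<in>UNIV. \<Sum>j\<in>UNIV. B i j * v k i * v l j)"
  define X0 where "X0 = [:- \<alpha> j0, 1:]"
  \<comment> \<open>The relation multiplied by \<open>G {}\<close> * (t - \<alpha> j0). The terms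
    with k = l are already dropped except for j0, where the extra factor cancels and leaves
    \<open>b j0 j0 * G {j0}\<close>.\<close>
  define P where "P = Polynomial.smult c0 (G {}) * X0 + (\<Sum>k\<in>UNIV. Polynomial.smult (w k) (G {k})) * X0
     + Polynomial.smult c' ((\<Sum>k\<in>UNIV. \<Sum>l\<in>- {k}. Polynomial.smult (b k l) (G {k, l})) * X0 + Polynomial.smult (b j0 j0) (G {j0}))"
  have Pt: "poly P t = (c0 * poly (G {}) t + (\<Sum>k\<in>UNIV. w k * poly (G {k}) t)) * (t - \<alpha> j0)
     + c' * ((\<Sum>k\<in>UNIV. \<Sum>l\<in>- {k}. b k l * poly (G {k, l}) t) * (t - \<alpha> j0) + b j0 j0 * poly (G {j0}) t)" for t
    by (simp add: P_def poly_sum X0_def algebra_simps)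
  have dG: "degree (G A) \<le> CARD('d)" for A by (rule order_trans[OF degree_G card_mono]) auto
  have dX: "degree (q * X0) \<le> CARD('d) + 1" if "degree q \<le> CARD('d)" for q
    using that degree_mult_le[of q X0] by (simp add: X0_def)
  have "degree P \<le> CARD('d) + 1"
    unfolding P_def
    by (intro degree_add_le dX order_trans[OF degree_smult_le] degree_sum_le dG le_trans[OF dG]) auto
  then have deg: "degree P < card T" using T by simp
  have all: "p dvd poly P t" for t
  proof (rule int_poly_many_roots_mod_prime[OF p T(1) deg T(3)])
    fix t assume t: "t \<in> T"
    define g where "g = poly (G {}) t"
    define z where "z = (\<lambda>i. \<Sum>k\<in>UNIV. v k i * poly (G {k}) t)"
    have gx: "[g * x t i = z i] (mod p)" for i using x[OF t] unfolding on_curve_def g_def z_def by blast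
    have ng: "\<not> p dvd g" unfolding g_def by (rule good_G[OF T(4)[OF t]])
    have lin: "[g * (\<Sum>i\<in>UNIV. c i * x t i) = (\<Sum>k\<in>UNIV. w k * poly (G {k}) t)] (mod p)"
    proof -
      have "g * (\<Sum>i\<in>UNIV. c i * x t i) = (\<Sum>i\<in>UNIV. c i * (g * x t i))" by (simp add: sum_distrib_left mult_ac)
      also have "[\<dots> = (\<Sum>i\<in>UNIV. c i * z i)] (mod p)" by (intro cong_sum cong_mult cong_refl gx)
      also have "(\<Sum>i\<in>UNIV. c i * z i) = (\<Sum>k\<in>UNIV. w k * poly (G {k}) t)"
        unfolding w_def z_def sum_distrib_left sum_distrib_right by (subst sum.swap) (simp add: mult_ac)
      finally show ?thesis .
    qed
    have quad: "[g * g * (qform B (x t)) * (t - \<alpha> j0)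
        = g * ((\<Sum>k\<in>UNIV. \<Sum>l\<in>- {k}. b k l * poly (G {k, l}) t) * (t - \<alpha> j0) + b j0 j0 * poly (G {j0}) t)] (mod p)"
    proof -
      have "g * g * (qform B (x t)) = (\<Sum>i\<in>UNIV. \<Sum>j\<in>UNIV. B i j * ((g * x t i) * (g * x t j)))"
        by (simp add: sum_distrib_left mult_ac)
      also have "[\<dots> = (\<Sum>i\<in>UNIV. \<Sum>j\<in>UNIV. B i j * (z i * z j))] (mod p)"
        by (intro cong_sum cong_mult cong_refl gx)
      also have "(\<Sum>i\<in>UNIV. \<Sum>j\<in>UNIV. B i j * (z i * z j)) = (\<Sum>k\<in>UNIV. \<Sum>l\<in>UNIV. b k l * (poly (G {k}) t * poly (G {l}) t))"
      proof -
        have zz: "B i j * (z i * z j) = (\<Sum>k\<in>UNIV. \<Sum>l\<in>UNIV. B i j * v k i * v l j * (poly (G {k}) t * poly (G {l}) t))" for i j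
          unfolding z_def sum_product unfolding sum_distrib_left by (intro sum.cong refl) (simp only: mult_ac)
        have "(\<Sum>i\<in>UNIV. \<Sum>j\<in>UNIV. B i j * (z i * z j))
           = (\<Sum>i\<in>UNIV. \<Sum>j\<in>UNIV. \<Sum>k\<in>UNIV. \<Sum>l\<in>UNIV. B i j * v k i * v l j * (poly (G {k}) t * poly (G {l}) t))"
          by (simp only: zz)
        also have "\<dots> = (\<Sum>i\<in>UNIV. \<Sum>k\<in>UNIV. \<Sum>j\<in>UNIV. \<Sum>l\<in>UNIV. B i j * v k i * v l j * (poly (G {k}) t * poly (G {l}) t))"
          by (intro sum.cong refl sum.swap)
        also have "\<dots> = (\<Sum>k\<in>UNIV. \<Sum>i\<in>UNIV. \<Sum>j\<in>UNIV. \<Sum>l\<in>UNIV. B i j * v k i * v l j * (poly (G {k}) t * poly (G {l}) t))"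
          by (rule sum.swap)
        also have "\<dots> = (\<Sum>k\<in>UNIV. \<Sum>i\<in>UNIV. \<Sum>l\<in>UNIV. \<Sum>j\<in>UNIV. B i j * v k i * v l j * (poly (G {k}) t * poly (G {l}) t))"
          by (intro sum.cong refl sum.swap)
        also have "\<dots> = (\<Sum>k\<in>UNIV. \<Sum>l\<in>UNIV. \<Sum>i\<in>UNIV. \<Sum>j\<in>UNIV. B i j * v k i * v l j * (poly (G {k}) t * poly (G {l}) t))"
          by (intro sum.cong refl sum.swap)
        also have "\<dots> = (\<Sum>k\<in>UNIV. \<Sum>l\<in>UNIV. b k l * (poly (G {k}) t * poly (G {l}) t))"
          by (simp add: b_def sum_distrib_right)
        finally show ?thesis .
      qed
      also have "\<dots> = (\<Sum>k\<in>UNIV. \<Sum>l\<in>- {k}. b k l * (poly (G {k}) t * poly (G {l}) t)) + (\<Sum>k\<in>UNIV. b k k * (poly (G {k}) t)\<^sup>2)"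
      proof -
        have "(\<Sum>l\<in>UNIV. b k l * (poly (G {k}) t * poly (G {l}) t)) = (\<Sum>l\<in>- {k}. b k l * (poly (G {k}) t * poly (G {l}) t)) + b k k * (poly (G {k}) t)\<^sup>2" for k
          by (subst sum.remove[of _ k]) (auto simp: Compl_eq_Diff_UNIV power2_eq_square)
        then show ?thesis by (simp add: sum.distrib)
      qed
      also have "[\<dots> = (\<Sum>k\<in>UNIV. \<Sum>l\<in>- {k}. b k l * (poly (G {k}) t * poly (G {l}) t)) + b j0 j0 * (poly (G {j0}) t)\<^sup>2] (mod p)"
      proof (intro cong_add cong_refl)
        have "p dvd (\<Sum>k\<in>UNIV - {j0}. b k k * (poly (G {k}) t)\<^sup>2)"
          by (intro dvd_sum dvd_mult2) (use iso in \<open>auto simp: b_def\<close>)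
        then show "[(\<Sum>k\<in>UNIV. b k k * (poly (G {k}) t)\<^sup>2) = b j0 j0 * (poly (G {j0}) t)\<^sup>2] (mod p)"
          by (subst sum.remove[of _ j0]) (auto simp: cong_iff_dvd_diff)
      qed
      also have "(\<Sum>k\<in>UNIV. \<Sum>l\<in>- {k}. b k l * (poly (G {k}) t * poly (G {l}) t)) = g * (\<Sum>k\<in>UNIV. \<Sum>l\<in>- {k}. b k l * poly (G {k, l}) t)"
      proof -
        have "poly (G {k}) t * poly (G {l}) t = g * poly (G {k, l}) t" if "l \<in> - {k}" for k l
        proof -
          have "poly (G {l}) t = (t - \<alpha> k) * poly (G {k, l}) t" using that by (intro poly_G_insert) auto
          moreover have "g = (t - \<alpha> k) * poly (G {k}) t" unfolding g_def by (intro poly_G_insert) auto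
          ultimately show ?thesis by simp
        qed
        then show ?thesis unfolding sum_distrib_left by (intro sum.cong refl) (simp add: mult.left_commute)
      qed
      finally have "[g * g * (qform B (x t)) * (t - \<alpha> j0)
         = (g * (\<Sum>k\<in>UNIV. \<Sum>l\<in>- {k}. b k l * poly (G {k, l}) t) + b j0 j0 * (poly (G {j0}) t)\<^sup>2) * (t - \<alpha> j0)] (mod p)"
        by (intro cong_mult cong_refl)
      moreover have "g = (t - \<alpha> j0) * poly (G {j0}) t" unfolding g_def by (intro poly_G_insert) auto
      then have "(poly (G {j0}) t)\<^sup>2 * (t - \<alpha> j0) = g * poly (G {j0}) t" by (simp add: power2_eq_square)
      then have "(g * S + b j0 j0 * (poly (G {j0}) t)\<^sup>2) * (t - \<alpha> j0) = g * (S * (t - \<alpha> j0) + b j0 j0 * poly (G {j0}) t)" for S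
        by (simp add: distrib_left distrib_right mult.assoc mult.left_commute)
      ultimately show ?thesis by simp
    qed
    \<comment> \<open>The point x t is known only through g * x t modulo p, so the quadratic term
      needs g twice; the surplus g is a unit and is cancelled afterwards.\<close>
    have C: "[g * (g * (t - \<alpha> j0) * (c0 + (\<Sum>i\<in>UNIV. c i * x t i) + c' * (qform B (x t)))) = g * poly P t] (mod p)"
    proof -
      have "g * (g * (t - \<alpha> j0) * (c0 + L + c' * q)) = g * ((c0 * g + g * L) * (t - \<alpha> j0)) + c' * (g * g * q * (t - \<alpha> j0))" for L q
        by (simp add: algebra_simps)
      then have "g * (g * (t - \<alpha> j0) * (c0 + (\<Sum>i\<in>UNIV. c i * x t i) + c' * (qform B (x t))))
        = g * ((c0 * g + g * (\<Sum>i\<in>UNIV. c i * x t i)) * (t - \<alpha> j0)) + c' * (g * g * (qform B (x t)) * (t - \<alpha> j0))" .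
      also have "[\<dots> = g * ((c0 * g + (\<Sum>k\<in>UNIV. w k * poly (G {k}) t)) * (t - \<alpha> j0))
          + c' * (g * ((\<Sum>k\<in>UNIV. \<Sum>l\<in>- {k}. b k l * poly (G {k, l}) t) * (t - \<alpha> j0) + b j0 j0 * poly (G {j0}) t))] (mod p)"
        by (intro cong_add cong_mult cong_refl lin quad)
      also have "g * ((c0 * g + (\<Sum>k\<in>UNIV. w k * poly (G {k}) t)) * (t - \<alpha> j0))
          + c' * (g * ((\<Sum>k\<in>UNIV. \<Sum>l\<in>- {k}. b k l * poly (G {k, l}) t) * (t - \<alpha> j0) + b j0 j0 * poly (G {j0}) t)) = g * poly P t"
        unfolding Pt g_def[symmetric] by (simp add: distrib_left mult.left_commute)
      finally show ?thesis .
    qed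
    have "p dvd g * poly P t" by (rule cong_dvd_iff[OF C, THEN iffD1]) (intro dvd_mult rel[OF t])
    then show "p dvd poly P t" using ng p by (simp add: prime_dvd_mult_iff)
  qed
  have "poly P (\<alpha> j0) = c' * (b j0 j0 * poly (G {j0}) (\<alpha> j0))" unfolding Pt by simp
  then show c': "p dvd c'"
    using all[of "\<alpha> j0"] aniso G_at_pole(1)[of j0] p unfolding b_def by (auto simp: prime_dvd_mult_iff)
  have rel': "p dvd c0 + (\<Sum>i\<in>UNIV. c i * x t i)" if "t \<in> T" for t
    using rel[OF that] dvd_add_left_iff[OF dvd_mult2[OF c']] by simp
  show "p dvd c0" by (rule linear_relation_trivial(1)[OF T(1) _ T(3,4) x rel']) (use T in auto)
  show "p dvd c i" by (rule linear_relation_trivial(2)[OF T(1) _ T(3,4) x rel']) (use T in auto)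
qed

text \<open>Equal points force 1 / (s - \<alpha> k) = 1 / (t - \<alpha> k) modulo p for each k, by
  independence of the v k. \<open>l k\<close> is this difference with denominators cleared, and k =
  j0 suffices.\<close>

lemma on_curve_inj:
  assumes "good s" "good t" "on_curve s x" "on_curve t x"
  shows "s mod p = t mod p"
proof -
  define l where "l = (\<lambda>k. poly (G {k}) s * poly (G {}) t - poly (G {k}) t * poly (G {}) s)"
  have "p dvd l k" for k
  proof (rule indep)
    fix i
    have sym: "[(\<Sum>k\<in>UNIV. v k i * poly (G {k}) u) = poly (G {}) u * x i] (mod p)" if "on_curve u x" for u
      using that cong_sym unfolding on_curve_def by blast
    have "[poly (G {}) t * (\<Sum>k\<in>UNIV. v k i * poly (G {k}) s) = poly (G {}) t * (poly (G {}) s * x i)] (mod p)"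
      using sym[OF assms(3)] by (intro cong_mult cong_refl)
    moreover have "[poly (G {}) s * (\<Sum>k\<in>UNIV. v k i * poly (G {k}) t) = poly (G {}) s * (poly (G {}) t * x i)] (mod p)"
      using sym[OF assms(4)] by (intro cong_mult cong_refl)
    ultimately have "[poly (G {}) t * (\<Sum>k\<in>UNIV. v k i * poly (G {k}) s) - poly (G {}) s * (\<Sum>k\<in>UNIV. v k i * poly (G {k}) t)
       = poly (G {}) t * (poly (G {}) s * x i) - poly (G {}) s * (poly (G {}) t * x i)] (mod p)"
      by (rule cong_diff)
    moreover have "poly (G {}) t * (\<Sum>k\<in>UNIV. v k i * poly (G {k}) s) - poly (G {}) s * (\<Sum>k\<in>UNIV. v k i * poly (G {k}) t) = (\<Sum>k\<in>UNIV. l k * v k i)"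
      unfolding l_def sum_distrib_left sum_subtractf[symmetric] by (intro sum.cong) (auto simp: algebra_simps)
    ultimately show "p dvd (\<Sum>k\<in>UNIV. l k * v k i)" by (simp add: cong_0_iff mult.left_commute)
  qed
  moreover have "l j0 = poly (G {j0}) s * poly (G {j0}) t * (t - s)"
    unfolding l_def poly_G_insert[of j0 "{}" s, simplified] poly_G_insert[of j0 "{}" t, simplified] by (simp add: algebra_simps)
  ultimately have "p dvd poly (G {j0}) s * poly (G {j0}) t * (t - s)" by metis
  then have "p dvd t - s" using good_G assms p by (simp add: prime_dvd_mult_iff)
  then show ?thesis by (metis mod_eq_dvd_iff)
qed

end

section \<open>Isotropic vectors on lines through an anisotropic vector\<close>

lemma bilinear_form_line:
  fixes B :: "'d::finite \<Rightarrow> 'd \<Rightarrow> int"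
  assumes sym: "\<And>i j. B i j = B j i"
  shows "(\<Sum>i\<in>UNIV. \<Sum>j\<in>UNIV. B i j * (h * u i + (if i = k then a else 0)) * (h * u j + (if j = k then a else 0)))
     = h * h * (qform B u) + 2 * h * a * (\<Sum>i\<in>UNIV. B i k * u i) + a * a * B k k"
proof -
  have "B i j * (h * u i + (if i = k then a else 0)) * (h * u j + (if j = k then a else 0))
     = h * h * (B i j * u i * u j) + (if j = k then h * a * (B i j * u i) else 0) + (if i = k then h * a * (B i j * u j) + (if j = k then a * a * B i j else 0) else 0)" for i j
    by (simp add: algebra_simps)
  then have "(\<Sum>i\<in>UNIV. \<Sum>j\<in>UNIV. B i j * (h * u i + (if i = k then a else 0)) * (h * u j + (if j = k then a else 0)))
    = (\<Sum>i\<in>UNIV. \<Sum>j\<in>UNIV. h * h * (B i j * u i * u j)) + (\<Sum>i\<in>UNIV. h * a * (B i k * u i)) + ((\<Sum>j\<in>UNIV. h * a * (B k j * u j)) + a * a * B k k)"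
    by (simp add: sum.distrib if_distrib[of "\<lambda>x. sum x UNIV"] sum.swap[of "\<lambda>i j. if i = k then _ i j else _"] cong: if_cong)
  also have "(\<Sum>j\<in>UNIV. h * a * (B k j * u j)) = (\<Sum>i\<in>UNIV. h * a * (B i k * u i))" by (simp add: sym[of k])
  finally show ?thesis by (simp add: sum_distrib_left algebra_simps)
qed

text \<open>On v k = h u + A e_k the form equals A ((h + b k)^2 - (b k)^2 + A B k k) with A the
  value at u, so h = y - b k works when y^2 is the discriminant. Since u j0 = 1, u replaces e_j0 in
  the standard basis, and the other v k differ from A e_k by multiples of u; as A is a unit, both
  independence conditions follow by elimination.\<close>

lemma isotropic_curve_exists:
  fixes B :: "'d::finite \<Rightarrow> 'd \<Rightarrow> int" and u :: "'d \<Rightarrow> int"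
  assumes p: "prime p" and sym: "\<And>i j. B i j = B j i" and u: "u j0 = 1"
    and a: "\<not> p dvd (qform B u)"
    and sq: "\<And>k. QuadRes p ((\<Sum>i\<in>UNIV. B i k * u i)\<^sup>2 - (qform B u) * B k k)"
    and poles: "\<And>k l. k \<noteq> l \<Longrightarrow> \<not> p dvd (\<alpha> k - \<alpha> l)"
  obtains v where "isotropic_curve p B v \<alpha> j0"
proof -
  define A where "A = (qform B u)"
  define b where "b = (\<lambda>k. \<Sum>i\<in>UNIV. B i k * u i)"
  have "\<forall>k. \<exists>y. [y\<^sup>2 = (b k)\<^sup>2 - A * B k k] (mod p)" using sq unfolding QuadRes_def A_def b_def by blast
  then obtain y where y: "\<And>k. [(y k)\<^sup>2 = (b k)\<^sup>2 - A * B k k] (mod p)" by metis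
  define h where "h = (\<lambda>k. y k - b k)"
  define v where "v = (\<lambda>k i. if k = j0 then u i else h k * u i + (if i = k then A else 0))"
  have A: "\<not> p dvd A" using a by (simp add: A_def)
  have "isotropic_curve p B v \<alpha> j0"
  proof
    show "prime p" by (rule p)
    show "p dvd (qform B (v k))" if k: "k \<noteq> j0" for k
    proof -
      have "(qform B (v k)) = h k * h k * A + 2 * h k * A * b k + A * A * B k k"
      proof -
        have vk: "v k i = h k * u i + (if i = k then A else 0)" for i using k by (simp add: v_def)
        show ?thesis unfolding vk bilinear_form_line[OF sym] A_def[symmetric] b_def ..
      qed
      also have "\<dots> = A * ((y k)\<^sup>2 - ((b k)\<^sup>2 - A * B k k))" by (simp add: h_def power2_eq_square algebra_simps)
      finally show ?thesis using y[of k] by (simp add: cong_iff_dvd_diff)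
    qed
    show "\<not> p dvd (qform B (v j0))" using a by (simp add: v_def)
    show "p dvd c i" if c: "\<And>k. p dvd (\<Sum>i\<in>UNIV. c i * v k i)" for c i
    proof -
      have cu: "p dvd (\<Sum>i\<in>UNIV. c i * u i)" using c[of j0] by (simp add: v_def)
      have ck: "p dvd c k" if k: "k \<noteq> j0" for k
      proof -
        have "(\<Sum>i\<in>UNIV. c i * v k i) = (\<Sum>i\<in>UNIV. h k * (c i * u i) + (if i = k then c i * A else 0))"
          using k by (intro sum.cong) (auto simp: v_def algebra_simps)
        also have "\<dots> = h k * (\<Sum>i\<in>UNIV. c i * u i) + c k * A"
          by (simp add: sum.distrib sum_distrib_left)
        finally have "p dvd h k * (\<Sum>i\<in>UNIV. c i * u i) + c k * A" using c[of k] by simp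
        then have "p dvd c k * A" using cu by (metis dvd_add_right_iff dvd_mult)
        then show ?thesis using A p by (simp add: prime_dvd_mult_iff)
      qed
      have "(\<Sum>i\<in>UNIV. c i * u i) = c j0 + (\<Sum>i\<in>UNIV - {j0}. c i * u i)"
        using u by (subst sum.remove[of _ j0]) auto
      moreover have "p dvd (\<Sum>i\<in>UNIV - {j0}. c i * u i)" using ck by (intro dvd_sum dvd_mult2) auto
      ultimately have "p dvd c j0" using cu by (metis dvd_add_left_iff)
      then show ?thesis using ck by (cases "i = j0") auto
    qed
    show "p dvd l k" if l: "\<And>i. p dvd (\<Sum>k\<in>UNIV. l k * v k i)" for l k
    proof -
      \<comment> \<open>S is the total coefficient of u in the combination. In coordinate j0 it
        stands alone, because u j0 = 1 and no e_j0 occurs.\<close>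
      define S where "S = l j0 + (\<Sum>k\<in>UNIV - {j0}. l k * h k)"
      have e: "(\<Sum>k\<in>UNIV. l k * v k i) = S * u i + (if i = j0 then 0 else l i * A)" for i
      proof -
        have "(\<Sum>k\<in>UNIV. l k * v k i) = l j0 * u i + (\<Sum>k\<in>UNIV - {j0}. l k * h k * u i + (if i = k then l k * A else 0))"
        proof -
          have "(\<Sum>k\<in>UNIV. l k * v k i) = l j0 * v j0 i + (\<Sum>k\<in>UNIV - {j0}. l k * v k i)"
            by (rule sum.remove) auto
          also have "(\<Sum>k\<in>UNIV - {j0}. l k * v k i) = (\<Sum>k\<in>UNIV - {j0}. l k * h k * u i + (if i = k then l k * A else 0))"
            by (intro sum.cong refl) (simp add: v_def distrib_left)
          finally show ?thesis by (simp add: v_def)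
        qed
        also have "\<dots> = S * u i + (\<Sum>k\<in>UNIV - {j0}. if i = k then l k * A else 0)"
          by (simp add: S_def sum.distrib sum_distrib_right distrib_right)
        finally show ?thesis by simp
      qed
      have S: "p dvd S" using l[of j0] e[of j0] u by simp
      have lk: "p dvd l k" if "k \<noteq> j0" for k
      proof -
        have "p dvd S * u k + l k * A" using l[of k] e[of k] that by simp
        then have "p dvd l k * A" using S by (metis dvd_add_right_iff dvd_mult2)
        then show ?thesis using A p by (simp add: prime_dvd_mult_iff)
      qed
      have "p dvd (\<Sum>k\<in>UNIV - {j0}. l k * h k)" using lk by (intro dvd_sum dvd_mult2) auto
      then have "p dvd l j0" using S unfolding S_def by (metis dvd_add_left_iff)
      then show ?thesis using lk by (cases "k = j0") auto
    qed
  qed (rule poles)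
  then show ?thesis by (rule that)
qed

section \<open>Quadrics and grids\<close>

text \<open>Peeling one unit off an exponent vector; used once for linear monomials and twice for
  quadratic ones.\<close>

lemma sum_nat_eq_Suc_decompose:
  fixes n :: "'d::finite \<Rightarrow> nat"
  assumes "(\<Sum>k\<in>UNIV. n k) = Suc s"
  obtains i n' where "n = (\<lambda>k. n' k + (if k = i then 1 else 0))" "(\<Sum>k\<in>UNIV. n' k) = s"
proof -
  have "\<exists>i. n i \<noteq> 0"
  proof (rule ccontr)
    assume "\<not> (\<exists>i. n i \<noteq> 0)"
    then show False using assms by simp
  qed
  then obtain i where i: "n i \<noteq> 0" by blast
  define n' where "n' = n(i := n i - 1)"
  have n: "n = (\<lambda>k. n' k + (if k = i then 1 else 0))" using i by (auto simp: n'_def)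
  have "(\<Sum>k\<in>UNIV. n k) = (\<Sum>k\<in>UNIV. n' k) + 1" by (subst n) (simp add: sum.distrib)
  with assms n show ?thesis by (intro that) auto
qed

lemma prod_power_add_unit:
  fixes x :: "'d::finite \<Rightarrow> real"
  shows "(\<Prod>k\<in>UNIV. x k ^ (n k + (if k = i then 1 else 0))) = (\<Prod>k\<in>UNIV. x k ^ n k) * x i"
  by (simp add: power_add prod.distrib if_distrib[of "\<lambda>e. _ ^ e"] cong: if_cong)

lemma eval_mpoly_affine:
  fixes f :: "('d::finite, real) mpoly"
  assumes "total_degree f \<le> 1"
  obtains a b where "\<And>x. eval_mpoly f x = b + a \<bullet> x"
proof -
  have "\<exists>z. \<forall>x::real^'d. (\<Prod>i\<in>UNIV. (x $ i) ^ Poly_Mapping.lookup m i) = fst z + snd z \<bullet> x" if m: "m \<in> Poly_Mapping.keys f" for m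
  proof -
    have "monom_degree m \<le> total_degree f" unfolding total_degree_def using m by (intro Max_ge) auto
    then have "monom_degree m \<le> 1" using assms by simp
    then consider "(\<Sum>i\<in>UNIV. Poly_Mapping.lookup m i) = 0" | "(\<Sum>i\<in>UNIV. Poly_Mapping.lookup m i) = Suc 0"
      unfolding monom_degree_def by linarith
    then show ?thesis
    proof cases
      case 1
      then show ?thesis by (intro exI[of _ "(1, 0)"]) simp
    next
      case 2
      then obtain i n' where n: "Poly_Mapping.lookup m = (\<lambda>k. n' k + (if k = i then 1 else 0))" "(\<Sum>k\<in>UNIV. n' k) = 0"
        by (rule sum_nat_eq_Suc_decompose)
      then show ?thesis
        unfolding n(1) prod_power_add_unit by (intro exI[of _ "(0, axis i 1)"]) (simp add: inner_axis' )
    qed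
  qed
  then have "\<forall>m\<in>Poly_Mapping.keys f. \<exists>z. \<forall>x::real^'d. (\<Prod>i\<in>UNIV. (x $ i) ^ Poly_Mapping.lookup m i) = fst z + snd z \<bullet> x" by blast
  from bchoice[OF this] obtain Z where Z: "\<forall>m\<in>Poly_Mapping.keys f. \<forall>x::real^'d. (\<Prod>i\<in>UNIV. (x $ i) ^ Poly_Mapping.lookup m i) = fst (Z m) + snd (Z m) \<bullet> x" by blast
  show ?thesis
  proof (rule that)
    fix x :: "real^'d"
    have "eval_mpoly f x = (\<Sum>m\<in>Poly_Mapping.keys f. Poly_Mapping.lookup f m * (fst (Z m) + snd (Z m) \<bullet> x))"
      unfolding eval_mpoly_def using Z by (intro sum.cong) auto
    also have "\<dots> = (\<Sum>m\<in>Poly_Mapping.keys f. Poly_Mapping.lookup f m * fst (Z m)) + (\<Sum>m\<in>Poly_Mapping.keys f. Poly_Mapping.lookup f m *\<^sub>R snd (Z m)) \<bullet> x"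
      by (simp add: inner_sum_left distrib_left sum.distrib)
    finally show "eval_mpoly f x = (\<Sum>m\<in>Poly_Mapping.keys f. Poly_Mapping.lookup f m * fst (Z m)) + (\<Sum>m\<in>Poly_Mapping.keys f. Poly_Mapping.lookup f m *\<^sub>R snd (Z m)) \<bullet> x" .
  qed
qed

lemma common_denominator:
  fixes S :: "real set"
  assumes "finite S" "S \<subseteq> \<rat>"
  obtains N :: int where "N > 0" "\<And>x. x \<in> S \<Longrightarrow> of_int N * x \<in> \<int>"
  using assms
proof (induction S arbitrary: thesis rule: finite_induct)
  case empty
  then show ?case by (metis empty_iff zero_less_one)
next
  case (insert y S)
  obtain N where N: "N > 0" "\<And>x. x \<in> S \<Longrightarrow> of_int N * x \<in> \<int>" using insert by auto
  have "y \<in> \<rat>" using insert by simp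
  then obtain a b :: int where ab: "b > 0" "y = of_int a / of_int b" by (auto elim: Rats_cases')
  show ?case
  proof (rule insert.prems(1)[of "N * b"])
    show "N * b > 0" using N ab by simp
    fix x assume "x \<in> insert y S"
    then consider "x = y" | "x \<in> S" by blast
    then show "of_int (N * b) * x \<in> \<int>"
    proof cases
      case 1
      then have "of_int (N * b) * x = of_int (N * a)" using ab by simp
      then show ?thesis by (metis Ints_of_int)
    next
      case 2
      have "of_int (N * b) * x = of_int b * (of_int N * x)" by simp
      then show ?thesis using N(2)[OF 2] by (metis Ints_mult Ints_of_int)
    qed
  qed
qed

text \<open>Scaling Q by s is harmless because the affine part of a quadric can be scaled along. In
  s = 2 N the N clears denominators and the 2 comes from adding the transpose, which makes the
  matrix symmetric.\<close>

lemma quadratic_form_int_matrix: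
  fixes Q :: "('d::finite, real) mpoly"
  assumes Q: "quadratic_form Q" and rat: "\<forall>m. Poly_Mapping.lookup Q m \<in> \<rat>" and nz: "Q \<noteq> 0"
  obtains B :: "'d \<Rightarrow> 'd \<Rightarrow> int" and s :: real where "s \<noteq> 0" "\<And>i j. B i j = B j i" "\<exists>i j. B i j \<noteq> 0"
    "\<And>x. s * eval_mpoly Q x = (\<Sum>i\<in>UNIV. \<Sum>j\<in>UNIV. of_int (B i j) * x $ i * x $ j)"
proof -
  let ?K = "Poly_Mapping.keys Q"
  define unit where "unit = (\<lambda>(i, j) (k::'d). (if k = i then 1 else 0) + (if k = j then 1 else 0) :: nat)"
  have "\<exists>z. Poly_Mapping.lookup m = unit z" if m: "m \<in> ?K" for m
  proof -
    have "(\<Sum>i\<in>UNIV. Poly_Mapping.lookup m i) = Suc (Suc 0)"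
      using Q m unfolding quadratic_form_def homogeneous_def monom_degree_def by auto
    then obtain j n' where 1: "Poly_Mapping.lookup m = (\<lambda>k. n' k + (if k = j then 1 else 0))" "(\<Sum>k\<in>UNIV. n' k) = Suc 0"
      by (rule sum_nat_eq_Suc_decompose)
    from 1(2) obtain i n'' where 2: "n' = (\<lambda>k. n'' k + (if k = i then 1 else 0))" "(\<Sum>k\<in>UNIV. n'' k) = 0"
      by (rule sum_nat_eq_Suc_decompose)
    have "Poly_Mapping.lookup m = unit (i, j)" using 2(2) unfolding 1(1) 2(1) unit_def by auto
    then show ?thesis by blast
  qed
  then have "\<forall>m\<in>?K. \<exists>z. Poly_Mapping.lookup m = unit z" by blast
  from bchoice[OF this] obtain \<phi> where \<phi>: "\<And>m. m \<in> ?K \<Longrightarrow> Poly_Mapping.lookup m = unit (\<phi> m)" by blast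
  define C where "C = (\<lambda>z. \<Sum>m\<in>{m\<in>?K. \<phi> m = z}. Poly_Mapping.lookup Q m)"
  have ev: "eval_mpoly Q x = (\<Sum>i\<in>UNIV. \<Sum>j\<in>UNIV. C (i, j) * (x $ i * x $ j))" for x
  proof -
    have mono: "(\<Prod>k\<in>UNIV. (x $ k) ^ unit (i, j) k) = x $ i * x $ j" for i j
      unfolding unit_def prod.case prod_power_add_unit using prod_power_add_unit[of "\<lambda>k. x $ k" "\<lambda>_. 0" i] by simp
    have "eval_mpoly Q x = (\<Sum>m\<in>?K. Poly_Mapping.lookup Q m * (x $ fst (\<phi> m) * x $ snd (\<phi> m)))"
      unfolding eval_mpoly_def
    proof (intro sum.cong refl)
      fix m assume "m \<in> ?K"
      then show "Poly_Mapping.lookup Q m * (\<Prod>i\<in>UNIV. (x $ i) ^ Poly_Mapping.lookup m i) = Poly_Mapping.lookup Q m * (x $ fst (\<phi> m) * x $ snd (\<phi> m))"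
        using \<phi>[of m] mono[of "fst (\<phi> m)" "snd (\<phi> m)"] by simp
    qed
    also have "\<dots> = (\<Sum>z\<in>UNIV. \<Sum>m\<in>{m\<in>?K. \<phi> m = z}. Poly_Mapping.lookup Q m * (x $ fst (\<phi> m) * x $ snd (\<phi> m)))"
      by (rule sum.group[symmetric]) auto
    also have "\<dots> = (\<Sum>z\<in>UNIV. C z * (x $ fst z * x $ snd z))"
      unfolding C_def sum_distrib_right by (intro sum.cong) auto
    also have "\<dots> = (\<Sum>i\<in>UNIV. \<Sum>j\<in>UNIV. C (i, j) * (x $ i * x $ j))"
      unfolding UNIV_Times_UNIV[symmetric] by (simp add: sum.cartesian_product case_prod_unfold)
    finally show ?thesis .
  qed
  have "range C \<subseteq> \<rat>" unfolding C_def using rat by (auto intro!: Rats_sum)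
  then obtain N where N: "N > 0" "\<And>z. of_int N * C z \<in> \<int>"
    using common_denominator[of "range C"] by (metis finite_class.finite_UNIV finite_imageI rangeI)
  define D where "D = (\<lambda>z. \<lfloor>of_int N * C z\<rfloor>)"
  have D: "of_int (D z) = of_int N * C z" for z unfolding D_def using N(2)[of z] by (metis Ints_cases floor_of_int)
  define B where "B = (\<lambda>i j. D (i, j) + D (j, i))"
  show ?thesis
  proof (rule that[of "2 * of_int N" B])
    show "2 * of_int N \<noteq> (0::real)" using N by simp
    show "B i j = B j i" for i j by (simp add: B_def)
    obtain m0 where m0: "m0 \<in> ?K" using nz by (metis all_not_in_conv keys_eq_empty)
    obtain i j where ij: "\<phi> m0 = (i, j)" by force
    have lookup_inj: "m = m0" if "m \<in> ?K" "unit (\<phi> m) = unit (i, j)" for m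
      using \<phi>[OF that(1)] \<phi>[OF m0] that(2) ij by (metis poly_mapping_eqI)
    have Cij: "C (i, j) = Poly_Mapping.lookup Q m0"
    proof -
      have "m = m0" if "m \<in> ?K" "\<phi> m = (i, j)" for m
        by (rule lookup_inj[OF that(1)]) (simp only: that(2))
      then have "{m \<in> ?K. \<phi> m = (i, j)} = {m0}" using m0 ij by blast
      then show ?thesis by (simp add: C_def)
    qed
    have swap: "unit (j, i) = unit (i, j)" unfolding unit_def prod.case by (simp only: add.commute)
    have "m = m0" if "m \<in> ?K" "\<phi> m = (j, i)" for m
      by (rule lookup_inj[OF that(1)]) (simp only: that(2) swap)
    then have sub: "{m \<in> ?K. \<phi> m = (j, i)} \<subseteq> {m0}" by blast
    \<comment> \<open>Symmetrisation cannot cancel a coefficient: \<phi> assigns each mixed monomial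
      to only one of the two orders, and on the diagonal the coefficient is doubled.\<close>
    have "C (j, i) = 0 \<or> C (j, i) = Poly_Mapping.lookup Q m0"
    proof (cases "{m \<in> ?K. \<phi> m = (j, i)} = {}")
      case False
      then have "{m \<in> ?K. \<phi> m = (j, i)} = {m0}" using sub by blast
      then show ?thesis by (simp add: C_def)
    next
      case True
      show ?thesis unfolding C_def True by simp
    qed
    moreover have "Poly_Mapping.lookup Q m0 \<noteq> 0" using m0 by (simp add: in_keys_iff)
    ultimately have "of_int N * (C (i, j) + C (j, i)) \<noteq> 0" using Cij N(1) by auto
    moreover have "real_of_int (B i j) = of_int N * (C (i, j) + C (j, i))"
      unfolding B_def of_int_add D by (simp only: distrib_left)
    ultimately have "real_of_int (B i j) \<noteq> 0" by simp
    then show "\<exists>i j. B i j \<noteq> 0" by (metis of_int_0)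
    fix x :: "real^'d"
    have "(\<Sum>i\<in>UNIV. \<Sum>j\<in>UNIV. of_int (B i j) * x $ i * x $ j)
      = of_int N * (\<Sum>i\<in>UNIV. \<Sum>j\<in>UNIV. C (i, j) * (x $ i * x $ j)) + of_int N * (\<Sum>i\<in>UNIV. \<Sum>j\<in>UNIV. C (j, i) * (x $ j * x $ i))"
      unfolding sum_distrib_left sum.distrib[symmetric] B_def of_int_add D
      by (intro sum.cong refl) (simp add: algebra_simps)
    also have "(\<Sum>i\<in>UNIV. \<Sum>j\<in>UNIV. C (j, i) * (x $ j * x $ i)) = (\<Sum>i\<in>UNIV. \<Sum>j\<in>UNIV. C (i, j) * (x $ i * x $ j))"
      by (rule sum.swap)
    finally show "2 * of_int N * eval_mpoly Q x = (\<Sum>i\<in>UNIV. \<Sum>j\<in>UNIV. of_int (B i j) * x $ i * x $ j)"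
      unfolding ev by simp
  qed
qed

text \<open>A unit vector works if some diagonal entry is nonzero; otherwise e_i + e_j has value 2 B
  i j. Either choice has a coordinate equal to 1.\<close>

lemma exists_anisotropic_int_vector:
  fixes B :: "'d::finite \<Rightarrow> 'd \<Rightarrow> int"
  assumes sym: "\<And>i j. B i j = B j i" and nz: "\<exists>i j. B i j \<noteq> 0"
  obtains u j0 where "u j0 = 1" "(qform B u) \<noteq> 0"
proof -
  have diag: "(\<Sum>i\<in>UNIV. \<Sum>j\<in>UNIV. B i j * (if i = k then 1 else 0) * (if j = k then 1 else 0)) = B k k" for k
    using bilinear_form_line[of B 0 "\<lambda>_. 0" k 1, OF sym] by simp
  show ?thesis
  proof (cases "\<exists>k. B k k \<noteq> 0")
    case True
    then obtain k where "B k k \<noteq> 0" by blast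
    then show ?thesis using diag[of k] by (intro that[of "\<lambda>i. if i = k then 1 else 0" k]) auto
  next
    case False
    obtain i j where ij: "B i j \<noteq> 0" using nz by blast
    then have "i \<noteq> j" using False by auto
    have "(\<Sum>l\<in>UNIV. B l j * (if l = i then 1 else 0)) = B i j" by (simp add: if_distrib cong: if_cong)
    \<comment> \<open>The factors 1 keep the shape h * u + a * e_j of
      \<open>bilinear_form_line\<close> with h = a = 1 and u = e_i.\<close>
    then have "(\<Sum>k\<in>UNIV. \<Sum>l\<in>UNIV. B k l * (1 * (if k = i then 1 else 0) + (if k = j then 1 else 0)) * (1 * (if l = i then 1 else 0) + (if l = j then 1 else 0))) = 2 * B i j"
      unfolding bilinear_form_line[OF sym] diag using False by simp
    then show ?thesis using ij \<open>i \<noteq> j\<close>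
      by (intro that[of "\<lambda>k. 1 * (if k = i then 1 else 0) + (if k = j then 1 else 0)" i]) auto
  qed
qed

section \<open>Finiteness and the upper bound\<close>

lemma finite_grid: "finite (grid n :: (real^'d::finite) set)"
proof -
  have "vec_nth ` (grid n :: (real^'d) set) \<subseteq> PiE UNIV (\<lambda>_. real ` {1..n})"
    by (auto simp: grid_def)
  moreover have "finite (PiE (UNIV :: 'd set) (\<lambda>_. real ` {1..n}))" by (intro finite_PiE) auto
  ultimately have "finite (vec_nth ` (grid n :: (real^'d) set))" by (rule finite_subset)
  then show ?thesis by (rule finite_imageD) (auto simp: inj_on_def vec_eq_iff)
qed

lemma finite_general_position_cards:
  fixes Q :: "('d::finite, real) mpoly"
  shows "finite {card D | D. D \<subseteq> grid n \<and> general_position Q D}"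
proof -
  have "{card D | D. D \<subseteq> grid n \<and> general_position Q D} \<subseteq> card ` Pow (grid n :: (real^'d) set)" by auto
  then show ?thesis by (rule finite_subset) (simp add: finite_grid)
qed

lemma max_general_position_ge:
  assumes "D \<subseteq> grid n" "general_position Q D"
  shows "card D \<le> max_general_position Q (grid n)"
  unfolding max_general_position_def
  by (rule Max_ge[OF finite_general_position_cards]) (use assms in blast)

lemma general_position_card_le:
  fixes Q :: "('d::finite, real) mpoly"
  assumes D: "D \<subseteq> grid n" "general_position Q D"
  shows "card D \<le> CARD('d) * n"
proof -
  fix i :: 'd
  define H where "H = (\<lambda>k. {x \<in> D. x $ i = real k})"
  have finD: "finite D" using D finite_grid finite_subset by blast
  have H: "card (H k) \<le> CARD('d)" for k
  proof (rule ccontr)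
    assume "\<not> card (H k) \<le> CARD('d)"
    then obtain S where S: "S \<subseteq> H k" "card S = CARD('d) + 1"
      by (metis Suc_eq_plus1 not_less_eq_eq obtain_subset_with_card_n)
    have "is_hyperplane {x. axis i 1 \<bullet> x = real k}"
      unfolding is_hyperplane_def by (intro exI[of _ "axis i 1"] exI[of _ "real k"]) (simp add: axis_eq_0_iff)
    moreover have "S \<subseteq> {x. axis i 1 \<bullet> x = real k}" using S by (auto simp: H_def inner_axis')
    moreover have "S \<subseteq> D" using S by (auto simp: H_def)
    ultimately show False using D(2) S(2) unfolding general_position_def by blast
  qed
  have "D \<subseteq> (\<Union>k\<in>{1..n}. H k)" using D(1) by (auto simp: H_def grid_def)
  then have "card D \<le> card (\<Union>k\<in>{1..n}. H k)" by (intro card_mono) (auto simp: H_def finD)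
  also have "\<dots> \<le> (\<Sum>k\<in>{1..n}. card (H k))" by (rule card_UN_le) simp
  also have "\<dots> \<le> (\<Sum>k\<in>{1..n}. CARD('d))" by (intro sum_mono H)
  finally show ?thesis by (simp add: mult.commute)
qed

lemma max_general_position_le:
  fixes Q :: "('d::finite, real) mpoly"
  shows "max_general_position Q (grid n) \<le> CARD('d) * n"
  unfolding max_general_position_def
proof (rule Max.boundedI[OF finite_general_position_cards])
  have "general_position Q {}" unfolding general_position_def by auto
  then have "card ({} :: (real^'d) set) \<in> {card D | D. D \<subseteq> grid n \<and> general_position Q D}" by blast
  then show "{card D | D. D \<subseteq> grid n \<and> general_position Q D} \<noteq> {}" by blast
qed (auto intro: general_position_card_le)

section \<open>Grid points obtained from the curve\<close>

lemma sum_UNIV_option: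
  fixes f :: "'e::finite option \<Rightarrow> 'b::comm_monoid_add"
  shows "(\<Sum>k\<in>UNIV. f k) = f None + (\<Sum>i\<in>UNIV. f (Some i))"
  by (simp add: UNIV_option_conv sum.reindex)

lemma curve_points_general_position:
  fixes Q :: "('d::finite, real) mpoly" and p :: nat
  assumes curve: "isotropic_curve (int p) B v \<alpha> j0"
    and s: "s \<noteq> 0" and QB: "\<And>x. s * eval_mpoly Q x = (\<Sum>i\<in>UNIV. \<Sum>j\<in>UNIV. of_int (B i j) * x $ i * x $ j)"
    and T: "finite T" "inj_on (\<lambda>t. t mod int p) T" "\<And>t. t \<in> T \<Longrightarrow> isotropic_curve.good (int p) \<alpha> t"
  obtains D where "D \<subseteq> grid p" "general_position Q D" "card D = card T"
proof -
  interpret isotropic_curve "int p" B v \<alpha> j0 by (rule curve)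
  define z where "z = (\<lambda>t i. \<Sum>k\<in>UNIV. v k i * poly (G {k}) t)"
  have "\<exists>r. [poly (G {}) t * r = 1] (mod int p)" if "t \<in> T" for t
  proof -
    have "coprime (int p) (poly (G {}) t)" using good_G[OF T(3)[OF that]] p by (simp add: prime_imp_coprime)
    then have "coprime (poly (G {}) t) (int p)" by (simp add: coprime_commute)
    then show ?thesis by (rule cong_solve_coprime_int)
  qed
  then obtain r where r: "\<And>t. t \<in> T \<Longrightarrow> [poly (G {}) t * r t = 1] (mod int p)" by metis
  have p0: "p > 0" using p by (auto intro!: Nat.gr0I)
  \<comment> \<open>The representative of the residue in {1..p} rather than {0..p-1}, to land in the
    grid.\<close>
  define x where "x = (\<lambda>t i. 1 + (r t * z t i - 1) mod int p)"
  have x_range: "1 \<le> x t i" "x t i \<le> int p" for t i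
  proof -
    have "0 \<le> m mod int p" "m mod int p + 1 \<le> int p" for m using p0 by (simp_all add: zless_imp_add1_zle)
    from this[of "r t * z t i - 1"] show "1 \<le> x t i" "x t i \<le> int p" unfolding x_def by simp_all
  qed
  have xc: "on_curve t (x t)" if t: "t \<in> T" for t
    unfolding on_curve_def
  proof
    fix i
    have "[x t i = 1 + (r t * z t i - 1)] (mod int p)"
      unfolding x_def by (intro cong_add cong_refl) (simp add: cong_def)
    then have "[poly (G {}) t * x t i = poly (G {}) t * (r t * z t i)] (mod int p)"
      by (intro cong_mult cong_refl) simp
    also have "poly (G {}) t * (r t * z t i) = (poly (G {}) t * r t) * z t i" by simp
    also have "[(poly (G {}) t * r t) * z t i = 1 * z t i] (mod int p)" by (intro cong_mult cong_refl r t)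
    finally show "[poly (G {}) t * x t i = (\<Sum>k\<in>UNIV. v k i * poly (G {k}) t)] (mod int p)" by (simp add: z_def)
  qed
  define X where "X = (\<lambda>t. \<chi> i. real_of_int (x t i))"
  have Xi: "X t $ i = of_int (x t i)" for t i by (simp add: X_def)
  have injX: "inj_on X T"
  proof (rule inj_onI)
    fix a b assume ab: "a \<in> T" "b \<in> T" "X a = X b"
    then have "x a = x b" by (auto simp: X_def vec_eq_iff)
    then have "on_curve a (x a)" "on_curve b (x a)" using xc[OF ab(1)] xc[OF ab(2)] by auto
    then have "a mod int p = b mod int p" using on_curve_inj T(3) ab by blast
    then show "a = b" using T(2) ab by (auto dest: inj_onD)
  qed
  have sub: "\<exists>T'. T' \<subseteq> T \<and> S = X ` T' \<and> card T' = card S" if S: "S \<subseteq> X ` T" for S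
  proof -
    obtain T' where T': "T' \<subseteq> T" "S = X ` T'" using S by (elim subset_imageE)
    then have "card S = card T'" using card_image[OF inj_on_subset[OF injX T'(1)]] by simp
    then show ?thesis using T' by auto
  qed
  have T'props: "finite T'" "inj_on (\<lambda>t. t mod int p) T'" "\<And>t. t \<in> T' \<Longrightarrow> good t" "\<And>t. t \<in> T' \<Longrightarrow> on_curve t (x t)" if "T' \<subseteq> T" for T'
    using that T(1,3) xc finite_subset inj_on_subset[OF T(2)] by auto
  have "general_position Q (X ` T)"
    unfolding general_position_def
  proof (intro conjI allI impI notI; elim exE conjE)
    fix S H assume S: "S \<subseteq> X ` T" "card S = CARD('d) + 1" and H: "is_hyperplane H" "S \<subseteq> H"
    obtain a b where ab: "a \<noteq> 0" "H = {x. a \<bullet> x = b}" using H(1) unfolding is_hyperplane_def by blast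
    obtain T' where T': "T' \<subseteq> T" "S = X ` T'" "card T' = CARD('d) + 1" using sub[OF S(1)] S(2) by auto
    \<comment> \<open>Coefficients of a relation are indexed by an option type, \<open>None\<close>
      being the constant term, so that hyperplanes become homogeneous relations between integer
      vectors.\<close>
    define c where "c = (\<lambda>k. case k of None \<Rightarrow> - b | Some i \<Rightarrow> a $ i)"
    define Y where "Y = (\<lambda>t k. case k of None \<Rightarrow> 1 | Some i \<Rightarrow> x t i) ` T'"
    obtain i where "a $ i \<noteq> 0" using ab(1) by (metis vec_eq_iff zero_index)
    then have cnz: "\<exists>k\<in>UNIV. c k \<noteq> 0" by (intro bexI[of _ "Some i"]) (auto simp: c_def)
    have rel: "(\<Sum>k\<in>UNIV. c k * of_int (y k)) = 0" if y: "y \<in> Y" for y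
    proof -
      obtain t where t: "t \<in> T'" "y = (\<lambda>k. case k of None \<Rightarrow> 1 | Some i \<Rightarrow> x t i)" using y by (auto simp: Y_def)
      have "a \<bullet> X t = b" using t(1) T'(2) H(2) ab(2) by blast
      then show ?thesis unfolding sum_UNIV_option by (simp add: c_def t(2) inner_vec_def Xi)
    qed
    obtain e where e: "\<exists>k\<in>UNIV. \<not> int p dvd e k" "\<And>y. y \<in> Y \<Longrightarrow> (\<Sum>k\<in>UNIV. e k * y k) = 0"
      using real_relation_imp_int_relation[of UNIV c "int p" Y] cnz p rel by auto
    have rel': "int p dvd e None + (\<Sum>i\<in>UNIV. e (Some i) * x t i)" if "t \<in> T'" for t
    proof -
      have "(\<lambda>k. case k of None \<Rightarrow> 1 | Some i \<Rightarrow> x t i) \<in> Y" using that by (auto simp: Y_def)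
      from e(2)[OF this] show ?thesis unfolding sum_UNIV_option by simp
    qed
    have "int p dvd e k" for k
      using linear_relation_trivial[OF T'props(1)[OF T'(1)] _ T'props(2-4)[OF T'(1)] rel'] T'(3) by (cases k) auto
    then show False using e(1) by blast
  next
    fix S C assume S: "S \<subseteq> X ` T" "card S = CARD('d) + 2" and C: "is_quadric Q C" "S \<subseteq> C"
    obtain f where f: "total_degree f \<le> 1" "C = {x. eval_mpoly Q x + eval_mpoly f x = 0}"
      using C(1) unfolding is_quadric_def by blast
    obtain a b where ab: "\<And>x. eval_mpoly f x = b + a \<bullet> x" using eval_mpoly_affine[OF f(1)] by blast
    obtain T' where T': "T' \<subseteq> T" "S = X ` T'" "card T' = CARD('d) + 2" using sub[OF S(1)] S(2) by auto
    define q where "q = (\<lambda>t. \<Sum>i\<in>UNIV. \<Sum>j\<in>UNIV. B i j * x t i * x t j)"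
    \<comment> \<open>The outer \<open>None\<close> carries the coefficient of the quadratic form.
      It is 1, so the relation is nontrivial whatever f is; the affine part is multiplied by s to
      match the integer matrix.\<close>
    define c where "c = (\<lambda>k. case k of None \<Rightarrow> 1 | Some None \<Rightarrow> s * b | Some (Some i) \<Rightarrow> s * a $ i)"
    define y where "y = (\<lambda>t k. case k of None \<Rightarrow> q t | Some None \<Rightarrow> 1 | Some (Some i) \<Rightarrow> x t i)"
    have cnz: "\<exists>k\<in>UNIV. c k \<noteq> 0" by (intro bexI[of _ None]) (auto simp: c_def)
    have rel: "(\<Sum>k\<in>UNIV. c k * of_int (w k)) = 0" if w: "w \<in> y ` T'" for w
    proof -
      obtain t where t: "t \<in> T'" "w = y t" using w by blast
      have "X t \<in> C" using t(1) T'(2) C(2) by blast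
      then have "eval_mpoly Q (X t) + (b + a \<bullet> X t) = 0" unfolding f(2) ab by simp
      then have "s * eval_mpoly Q (X t) + s * (b + a \<bullet> X t) = 0" by (simp only: distrib_left[symmetric] mult_zero_right)
      moreover have "s * eval_mpoly Q (X t) = of_int (q t)" unfolding QB by (simp add: q_def Xi)
      ultimately show ?thesis unfolding sum_UNIV_option
        by (simp add: c_def y_def t(2) inner_vec_def Xi sum_distrib_left distrib_left mult.assoc)
    qed
    obtain e where e: "\<exists>k\<in>UNIV. \<not> int p dvd e k" "\<And>w. w \<in> y ` T' \<Longrightarrow> (\<Sum>k\<in>UNIV. e k * w k) = 0"
      using real_relation_imp_int_relation[of UNIV c "int p" "y ` T'"] cnz p rel by auto
    have rel': "int p dvd e (Some None) + (\<Sum>i\<in>UNIV. e (Some (Some i)) * x t i) + e None * (qform B (x t))" if "t \<in> T'" for t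
    proof -
      have "(\<Sum>k\<in>UNIV. e k * y t k) = e (Some None) + (\<Sum>i\<in>UNIV. e (Some (Some i)) * x t i) + e None * (qform B (x t))"
        unfolding sum_UNIV_option by (simp add: y_def q_def)
      moreover have "(\<Sum>k\<in>UNIV. e k * y t k) = 0" using e(2) that by blast
      ultimately show ?thesis by simp
    qed
    have triv: "int p dvd e (Some None)" "int p dvd e (Some (Some i))" "int p dvd e None" for i
      using quadratic_relation_trivial[OF T'props(1)[OF T'(1)] _ T'props(2-4)[OF T'(1)] rel'] T'(3) by auto
    have "int p dvd e k" for k
    proof (cases k)
      case (Some k')
      then show ?thesis using triv by (cases k') auto
    qed (use triv in simp)
    then show False using e(1) by blast
  qed
  moreover have "X ` T \<subseteq> grid p"
  proof
    fix y assume "y \<in> X ` T"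
    then obtain t where t: "y = X t" by blast
    have "y $ i \<in> real ` {1..p}" for i
    proof (rule image_eqI[of _ _ "nat (x t i)"])
      show "y $ i = real (nat (x t i))" unfolding t Xi using x_range(1)[of t i] by simp
      show "nat (x t i) \<in> {1..p}" using x_range[of t i] by auto
    qed
    then show "y \<in> grid p" by (simp add: grid_def)
  qed
  moreover have "card (X ` T) = card T" using injX by (rule card_image)
  ultimately show ?thesis using that by blast
qed

lemma general_position_lower_bound:
  fixes Q :: "('d::finite, real) mpoly"
  assumes Q: "quadratic_form Q" and rat: "\<forall>m. Poly_Mapping.lookup Q m \<in> \<rat>" and nz: "Q \<noteq> 0"
  obtains N :: nat where "\<And>p n. prime p \<Longrightarrow> N < p \<Longrightarrow> (\<forall>a::int. \<bar>a\<bar> \<le> int N \<longrightarrow> QuadRes (int p) a) \<Longrightarrow> p \<le> n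
     \<Longrightarrow> p - CARD('d) \<le> max_general_position Q (grid n)"
proof -
  obtain B :: "'d \<Rightarrow> 'd \<Rightarrow> int" and s where B: "s \<noteq> 0" "\<And>i j. B i j = B j i" "\<exists>i j. B i j \<noteq> 0"
    "\<And>x. s * eval_mpoly Q x = (\<Sum>i\<in>UNIV. \<Sum>j\<in>UNIV. of_int (B i j) * x $ i * x $ j)"
  proof (rule quadratic_form_int_matrix[OF Q rat nz], goal_cases)
    case (1 B s)
    from 1(2-5) show ?case by (rule 1(1))
  qed
  obtain u j0 where u: "u j0 = 1" "(qform B u) \<noteq> 0"
    by (rule exists_anisotropic_int_vector[of B, OF B(2,3)])
  define A where "A = (qform B u)"
  define \<Delta> where "\<Delta> = (\<lambda>k. (\<Sum>i\<in>UNIV. B i k * u i)\<^sup>2 - A * B k k)"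
  \<comment> \<open>A prime p > N does not divide the nonzero value A and exceeds the differences of
    the d poles, and the discriminants \<Delta> k lie in the range where all integers are
    squares.\<close>
  define N where "N = nat \<bar>A\<bar> + (\<Sum>k\<in>UNIV. nat \<bar>\<Delta> k\<bar>) + CARD('d)"
  have \<Delta>N: "\<bar>\<Delta> k\<bar> \<le> int N" for k
  proof -
    have "nat \<bar>\<Delta> k\<bar> \<le> (\<Sum>k\<in>UNIV. nat \<bar>\<Delta> k\<bar>)" by (rule member_le_sum) auto
    then show ?thesis unfolding N_def by linarith
  qed
  obtain \<beta> :: "'d \<Rightarrow> nat" where \<beta>: "bij_betw \<beta> UNIV {0..<CARD('d)}"
    using ex_bij_betw_finite_nat[of "UNIV :: 'd set"] by auto
  define \<alpha> where "\<alpha> = (\<lambda>k. int (\<beta> k))"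
  have \<alpha>: "0 \<le> \<alpha> k" "\<alpha> k < int CARD('d)" for k
    using bij_betwE[OF \<beta>] by (auto simp: \<alpha>_def)
  have \<alpha>_inj: "\<alpha> k \<noteq> \<alpha> l" if "k \<noteq> l" for k l
    using \<beta> that by (auto simp: \<alpha>_def bij_betw_def inj_on_def)
  show ?thesis
  proof (rule that[of N])
    fix p n :: nat
    assume p: "prime p" "N < p" "\<forall>a::int. \<bar>a\<bar> \<le> int N \<longrightarrow> QuadRes (int p) a" and pn: "p \<le> n"
    have pp: "prime (int p)" using p(1) by simp
    have small: "\<not> int p dvd a" if "a \<noteq> 0" "\<bar>a\<bar> < int p" for a
      using that dvd_imp_le_int[of a "int p"] by auto
    have "int CARD('d) \<le> int N" "\<bar>A\<bar> \<le> int N" by (auto simp: N_def)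
    then have Np: "int CARD('d) < int p" "\<bar>A\<bar> < int p" using p(2) by auto
    obtain v where v: "isotropic_curve (int p) B v \<alpha> j0"
    proof (rule isotropic_curve_exists[of "int p" B u j0 \<alpha>])
      show "\<not> int p dvd (qform B u)"
        using small[of A] u(2) Np by (simp add: A_def)
      show "QuadRes (int p) ((\<Sum>i\<in>UNIV. B i k * u i)\<^sup>2 - (qform B u) * B k k)" for k
        using p(3) \<Delta>N[of k] unfolding \<Delta>_def A_def by blast
      show "\<not> int p dvd (\<alpha> k - \<alpha> l)" if "k \<noteq> l" for k l
        using \<alpha>[of k] \<alpha>[of l] \<alpha>_inj[OF that] Np by (intro small) auto
    qed (use pp B u in auto)
    \<comment> \<open>The poles occupy the residues 0, ..., d - 1; the other p - d residues are the
      parameters.\<close>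
    define T where "T = {int CARD('d)..<int p}"
    obtain D where D: "D \<subseteq> grid p" "general_position Q D" "card D = card T"
    proof (rule curve_points_general_position[OF v B(1,4), of T])
      show "finite T" by (simp add: T_def)
      show "inj_on (\<lambda>t. t mod int p) T" by (auto simp: inj_on_def T_def)
      fix t assume t: "t \<in> T"
      show "isotropic_curve.good (int p) \<alpha> t"
        unfolding isotropic_curve.good_def[OF v]
      proof
        fix k
        show "\<not> int p dvd (t - \<alpha> k)" using t \<alpha>[of k] unfolding T_def by (intro small) auto
      qed
    qed
    have "grid p \<subseteq> (grid n :: (real^'d) set)" using pn by (force simp: grid_def)
    then have "card D \<le> max_general_position Q (grid n)" using D by (intro max_general_position_ge) auto
    then show "p - CARD('d) \<le> max_general_position Q (grid n)" using D(3) by (simp add: T_def)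
  qed
qed

theorem theorem1p4:
  fixes Q :: "('d::finite, real) mpoly"
  assumes "CARD('d) \<ge> 2"
    and "quadratic_form Q"
    and "\<forall>m. Poly_Mapping.lookup Q m \<in> \<rat>"
    and "Q \<noteq> 0"
  shows "(\<exists>e :: nat \<Rightarrow> real. e \<in> o(\<lambda>n. real n) \<and>
            (\<forall>n. real n - e n \<le> real (max_general_position Q (grid n)))) \<and>
         (\<forall>n. max_general_position Q (grid n) \<le> CARD('d) * n)"
proof (intro conjI allI max_general_position_le)
  define f where "f = (\<lambda>n. real (max_general_position Q (grid n)))"
  define d where "d = real CARD('d)"
  obtain N :: nat where N: "\<And>p n. prime p \<Longrightarrow> N < p \<Longrightarrow> (\<forall>a::int. \<bar>a\<bar> \<le> int N \<longrightarrow> QuadRes (int p) a) \<Longrightarrow> p \<le> n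
     \<Longrightarrow> p - CARD('d) \<le> max_general_position Q (grid n)"
    using general_position_lower_bound[OF assms(2-4)] by blast
  have ev: "eventually (\<lambda>n. real n - f n \<le> \<epsilon> * real n) sequentially" if \<epsilon>: "\<epsilon> > 0" for \<epsilon>
  proof -
    \<comment> \<open>Centred at ln n - \<eta>, the window of radius \<eta> puts p between n exp (-2
      \<eta>) and n. As exp (-2 \<eta>) \<ge> 1 - \<epsilon>/2, half of \<epsilon> pays for the gap
      between p and n and the other half for the d excluded parameters.\<close>
    define \<eta> where "\<eta> = \<epsilon> / 4"
    have \<eta>: "\<eta> > 0" using \<epsilon> by (simp add: \<eta>_def)
    have "filterlim (\<lambda>n. ln (real n) - \<eta>) at_top sequentially" by real_asymp
    then have 1: "eventually (\<lambda>n. \<exists>p. prime p \<and> \<bar>ln (real p) - (ln (real n) - \<eta>)\<bar> \<le> \<eta> \<and> (\<forall>a::int. \<bar>a\<bar> \<le> int N \<longrightarrow> QuadRes (int p) a)) sequentially"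
      by (rule eventually_compose_filterlim[OF primes_with_small_squares[OF \<eta>, of N]])
    have "filterlim (\<lambda>n. real n * exp (- 2 * \<eta>)) at_top sequentially" by real_asymp
    then have 2: "eventually (\<lambda>n. real N < real n * exp (- 2 * \<eta>)) sequentially"
      by (simp add: filterlim_at_top_dense)
    have "filterlim (\<lambda>n. \<epsilon> / 2 * real n) at_top sequentially" using \<epsilon> by real_asymp
    then have 3: "eventually (\<lambda>n. d \<le> \<epsilon> / 2 * real n) sequentially"
      by (simp add: filterlim_at_top)
    show ?thesis
      using 1 2 3 eventually_gt_at_top[of 0]
    proof eventually_elim
      case (elim n)
      obtain p where p: "prime p" "\<bar>ln (real p) - (ln (real n) - \<eta>)\<bar> \<le> \<eta>" "\<forall>a::int. \<bar>a\<bar> \<le> int N \<longrightarrow> QuadRes (int p) a"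
        using elim(1) by blast
      have p0: "real p > 0" using prime_gt_0_nat[OF p(1)] by simp
      have n0: "real n > 0" using elim by simp
      have lnp: "ln (real p) \<le> ln (real n)" "ln (real n) + (- 2 * \<eta>) \<le> ln (real p)" using p(2) by linarith+
      have "real p \<le> real n" using lnp(1) p0 n0 by (simp only: ln_le_cancel_iff)
      then have pn: "p \<le> n" by simp
      have "exp (ln (real n) + (- 2 * \<eta>)) \<le> exp (ln (real p))" using lnp(2) by (simp only: exp_le_cancel_iff)
      then have pl: "real n * exp (- 2 * \<eta>) \<le> real p" unfolding exp_add using p0 n0 by (simp only: exp_ln)
      then have "N < p" using elim(2) by linarith
      then have "p - CARD('d) \<le> max_general_position Q (grid n)" using N p pn by blast
      then have "real (p - CARD('d)) \<le> f n" unfolding f_def by (simp only: of_nat_le_iff)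
      then have "real p - d \<le> f n" unfolding d_def by linarith
      moreover have "real n * (1 + (- 2 * \<eta>)) \<le> real n * exp (- 2 * \<eta>)"
        by (intro mult_left_mono exp_ge_add_one_self) auto
      moreover have "real n * (1 + (- 2 * \<eta>)) = real n - \<epsilon> / 2 * real n" by (simp add: \<eta>_def algebra_simps)
      ultimately show ?case using pl elim(3) by linarith
    qed
  qed
  show "\<exists>e :: nat \<Rightarrow> real. e \<in> o(\<lambda>n. real n) \<and> (\<forall>n. real n - e n \<le> real (max_general_position Q (grid n)))"
  proof (intro exI conjI allI)
    \<comment> \<open>Truncation at 0 is needed because f n may exceed n, and only the deficit n - f
      n is known to be o(n).\<close>
    show "(\<lambda>n. max 0 (real n - f n)) \<in> o(\<lambda>n. real n)"
    proof (rule landau_o.smallI)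
      fix c :: real assume c: "c > 0"
      show "eventually (\<lambda>n. norm (max 0 (real n - f n)) \<le> c * norm (real n)) sequentially"
        using ev[OF c] by eventually_elim (use c in auto)
    qed
    show "real n - max 0 (real n - f n) \<le> real (max_general_position Q (grid n))" for n
      unfolding f_def by linarith
  qed
qed

end
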